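(* Let $S$ be a closed connected orientable surface of genus at least $2$ and let $\mu_1,\mu_2$ be two geodesic currents on $S$. If $\mu_2$ dominates $\mu_1$, i.e. $i(\mu_1,C)\le i(\mu_2,C)$ for every closed curve $C$ on $S$, then $\ell_d(\mu_1)\le\ell_d(\mu_2)$ for all length pseudometrics $d$ on $S$ (for which $\ell_d$ is finite on every curve).
   Context: A pseudometric on $S$ is a function $d\colon S\times S\to\mathbb{R}_{\ge0}$ with $d(x,x)=0$, $d(x,y)=d(y,x)$, $d(x,z)\le d(x,y)+d(y,z)$. The $d$-length of a continuous path $c\colon[a,b]\to S$ is $\sup\sum_i d(c(t_i),c(t_{i+1}))$ over partitions of $[a,b]$ (cyclic partitions for closed curves). $d$ is a length pseudometric if $d(x,y)$ is the infimum of the $d$-lengths of continuous paths from $x$ to $y$. For a curve (free homotopy class) $C$, $\ell_d(C)$ is the infimum of the $d$-lengths of closed curves in the class. Geodesic currents. Fix a hyperbolic metric on $S$ with universal cover $\mathbb{H}^2$. A geodesic current is a $\pi_1(S)$-invariant Radon measure on the space of unoriented geodesics $(\partial_\infty S\times\partial_\infty S\setminus\Delta)/(\mathbb{Z}/2)$. For non-trivial $g$, $i(\mu,[g])$ is the $\mu$-measure of the set of geodesics crossing transversely $[q,g\cdot q)$, $q$ any point on the axis of $g$. Bonahon's intersection form $i(\cdot,\cdot)$ is the continuous symmetric bilinear extension of geometric intersection number to pairs of geodesic currents. By a result of the same paper, there is a unique geodesic current $\mu_d$ with $i(\mu_d,C)=\ell_d(C)$ for all curves $C$; $\ell_d$ is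 extended to geodesic currents by $\ell_d(\mu)=i(\mu_d,\mu)$, which is the unique continuous homogeneous extension of $\ell_d$ from weighted curves. *)

theory Defs
  imports "HOL-Analysis.Analysis" "HOL-Homology.Homology"
begin

section \<open>Closed orientable surfaces\<close>

text \<open>Surfaces are sets \<open>S\<close> carrying the subspace topology \<open>top_of_set S\<close>.\<close>

definition closed_surface :: "'a::topological_space set \<Rightarrow> bool" where
  "closed_surface S \<longleftrightarrow>
     compact S \<and> Hausdorff_space (top_of_set S) \<and>
     (\<forall>x\<in>S. \<exists>U V. openin (top_of_set S) U \<and> x \<in> U \<and> open (V :: complex set) \<and> U homeomorphic V)"

text \<open>An orientation is a locally consistent choice of generators of the local homology groups
  $H_2(S, S \setminus x)$.\<close>

definition orientable_surface :: "'a::topological_space set \<Rightarrow> bool" where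
  "orientable_surface S \<longleftrightarrow>
     (\<exists>ori. \<forall>x\<in>S.
        ori x \<in> carrier (relative_homology_group 2 (top_of_set S) (S - {x})) \<and>
        generate (relative_homology_group 2 (top_of_set S) (S - {x})) {ori x}
          = carrier (relative_homology_group 2 (top_of_set S) (S - {x})) \<and>
        (\<exists>U \<beta>. openin (top_of_set S) U \<and> x \<in> U \<and>
           \<beta> \<in> carrier (relative_homology_group 2 (top_of_set S) (S - U)) \<and>
           (\<forall>y\<in>U. hom_induced 2 (top_of_set S) (S - U) (top_of_set S) (S - {y}) id \<beta> = ori y)))"

text \<open>The genus is the maximal number of pairwise disjoint simple closed curves along which \<open>S\<close>
  can be cut without being disconnected.\<close>

definition genus :: "'a::topological_space set \<Rightarrow> enat" where
  "genus S = Sup {enat (card \<C>) | \<C>.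
     finite \<C> \<and> disjoint \<C> \<and>
     (\<forall>C\<in>\<C>. C \<subseteq> S \<and> (\<exists>\<gamma>. simple_path \<gamma> \<and> pathfinish \<gamma> = pathstart \<gamma> \<and> path_image \<gamma> = C)) \<and>
     connected (S - \<Union>\<C>)}"


section \<open>Closed curves, pseudometrics and lengths\<close>

text \<open>A curve (free homotopy class) is handled through its representatives
  \<open>c\<close>; the class of \<open>c\<close> is \<open>{c'. homotopic_loops S c c'}\<close>.\<close>

definition closed_curve :: "'a::topological_space set \<Rightarrow> (real \<Rightarrow> 'a) \<Rightarrow> bool" where
  "closed_curve S c \<longleftrightarrow> path c \<and> path_image c \<subseteq> S \<and> pathfinish c = pathstart c"

definition pseudometric_on :: "'a set \<Rightarrow> ('a \<Rightarrow> 'a \<Rightarrow> real) \<Rightarrow> bool" where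
  "pseudometric_on S d \<longleftrightarrow>
     (\<forall>x\<in>S. \<forall>y\<in>S. 0 \<le> d x y \<and> d x y = d y x) \<and>
     (\<forall>x\<in>S. d x x = 0) \<and>
     (\<forall>x\<in>S. \<forall>y\<in>S. \<forall>z\<in>S. d x z \<le> d x y + d y z)"

definition path_length :: "('a \<Rightarrow> 'a \<Rightarrow> real) \<Rightarrow> (real \<Rightarrow> 'a) \<Rightarrow> ennreal" where
  "path_length d c =
     (SUP ts \<in> {ts. ts \<noteq> [] \<and> sorted ts \<and> hd ts = 0 \<and> last ts = 1}.
        \<Sum>i<length ts - 1. ennreal (d (c (ts ! i)) (c (ts ! Suc i))))"

text \<open>For closed curves the partitions are cyclic: the last point is joined to the first one, and
  the base point need not belong to the partition.\<close>

definition closed_path_length :: "('a \<Rightarrow> 'a \<Rightarrow> real) \<Rightarrow> (real \<Rightarrow> 'a) \<Rightarrow> ennreal" where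
  "closed_path_length d c =
     (SUP ts \<in> {ts. ts \<noteq> [] \<and> sorted ts \<and> set ts \<subseteq> {0..1}}.
        \<Sum>i<length ts. ennreal (d (c (ts ! i)) (c (ts ! (Suc i mod length ts)))))"

definition length_pseudometric :: "'a::topological_space set \<Rightarrow> ('a \<Rightarrow> 'a \<Rightarrow> real) \<Rightarrow> bool" where
  "length_pseudometric S d \<longleftrightarrow>
     pseudometric_on S d \<and>
     (\<forall>x\<in>S. \<forall>y\<in>S. ennreal (d x y) =
        (INF c \<in> {c. path c \<and> path_image c \<subseteq> S \<and> pathstart c = x \<and> pathfinish c = y}.
           path_length d c))"

definition curve_length :: "'a::topological_space set \<Rightarrow> ('a \<Rightarrow> 'a \<Rightarrow> real) \<Rightarrow> (real \<Rightarrow> 'a) \<Rightarrow> ennreal" where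
  "curve_length S d c = (INF c' \<in> {c'. homotopic_loops S c c'}. closed_path_length d c')"

text \<open>Intersection points are counted as pairs of parameters on the circle, i.e. with multiplicity.
  Since the two representatives are chosen independently, the number of a curve with itself
  is twice its self-intersection number (for a primitive curve).\<close>

definition crossing_parameters :: "(real \<Rightarrow> 'a) \<Rightarrow> (real \<Rightarrow> 'a) \<Rightarrow> (real \<times> real) set" where
  "crossing_parameters c e = {(s, t). s \<in> {0..<1} \<and> t \<in> {0..<1} \<and> c s = e t}"

definition geometric_intersection ::
    "'a::topological_space set \<Rightarrow> (real \<Rightarrow> 'a) \<Rightarrow> (real \<Rightarrow> 'a) \<Rightarrow> nat" where
  "geometric_intersection S c e =
     (LEAST n. \<exists>c' e'. homotopic_loops S c c' \<and> homotopic_loops S e e' \<and>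
        finite (crossing_parameters c' e') \<and> card (crossing_parameters c' e') = n)"


section \<open>The hyperbolic plane (unit disc model)\<close>

definition hyp_dist :: "complex \<Rightarrow> complex \<Rightarrow> real" where
  "hyp_dist z w = arcosh (1 + 2 * (cmod (z - w))\<^sup>2 / ((1 - (cmod z)\<^sup>2) * (1 - (cmod w)\<^sup>2)))"

text \<open>For \<open>cmod b < cmod a\<close> these are exactly the orientation-preserving isometries of the disc; the
  same formula gives their action on the circle at infinity.\<close>

definition disc_map :: "complex \<Rightarrow> complex \<Rightarrow> complex \<Rightarrow> complex" where
  "disc_map a b z = (a * z + b) / (cnj b * z + cnj a)"

definition disc_isometries :: "(complex \<Rightarrow> complex) set" where
  "disc_isometries = {disc_map a b | a b. cmod b < cmod a}"

text \<open>An unoriented geodesic is the set of its two endpoints at infinity. The topology on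
  \<open>geodesics\<close> is the quotient of the topology on the ordered pairs of distinct points.\<close>

definition ordered_ends :: "(complex \<times> complex) set" where
  "ordered_ends = {(x, y). cmod x = 1 \<and> cmod y = 1 \<and> x \<noteq> y}"

definition geodesics :: "complex set set" where
  "geodesics = {{x, y} | x y. (x, y) \<in> ordered_ends}"

definition geodesic_topology :: "complex set topology" where
  "geodesic_topology = topology (\<lambda>U. U \<subseteq> geodesics \<and>
     openin (top_of_set ordered_ends) {(x, y) \<in> ordered_ends. {x, y} \<in> U})"

lemma openin_geodesic_topology:
  "openin geodesic_topology U \<longleftrightarrow> U \<subseteq> geodesics \<and>
     openin (top_of_set ordered_ends) {(x, y) \<in> ordered_ends. {x, y} \<in> U}"
proof -
  let ?P = "\<lambda>U. {(x, y) \<in> ordered_ends. {x, y} \<in> U}"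
  have 1: "?P (A \<inter> B) = ?P A \<inter> ?P B" for A B by auto
  have 2: "?P (\<Union>\<K>) = \<Union> (?P ` \<K>)" for \<K> by auto
  have "istopology (\<lambda>U. U \<subseteq> geodesics \<and> openin (top_of_set ordered_ends) (?P U))"
    unfolding istopology_def 1 2 by (auto intro!: openin_Union)
  then show ?thesis
    by (simp add: geodesic_topology_def topology_inverse')
qed

lemma topspace_geodesic_topology: "topspace geodesic_topology = geodesics"
proof -
  have "{(x, y) \<in> ordered_ends. {x, y} \<in> geodesics} = ordered_ends"
    by (auto simp: geodesics_def)
  then have "openin geodesic_topology geodesics"
    by (simp add: openin_geodesic_topology)
  then show ?thesis
    by (meson openin_geodesic_topology openin_subset openin_topspace subset_antisym)
qed

definition geodesic_borel :: "complex set measure" where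
  "geodesic_borel = sigma geodesics {U. openin geodesic_topology U}"

text \<open>The points of the disc on the geodesic with the pair of endpoints \<open>G\<close>: the images of the
  diameter $(-1,1)$ under the isometries that send its ends to the points of \<open>G\<close>.\<close>

definition geodesic_line :: "complex set \<Rightarrow> complex set" where
  "geodesic_line G =
     {f (of_real t) | f t. f \<in> disc_isometries \<and> {f (-1), f 1} = G \<and> -1 < t \<and> t < (1::real)}"

text \<open>The half-open geodesic segment $[z,w)$.\<close>

definition half_open_segment :: "complex \<Rightarrow> complex \<Rightarrow> complex set" where
  "half_open_segment z w =
     {u \<in> ball 0 1. hyp_dist z u + hyp_dist u w = hyp_dist z w \<and> u \<noteq> w}"


section \<open>Hyperbolic structures\<close>

definition deck_group :: "(complex \<Rightarrow> 'a) \<Rightarrow> (complex \<Rightarrow> complex) set" where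
  "deck_group p = {g \<in> disc_isometries. \<forall>z\<in>ball 0 1. p (g z) = p z}"

text \<open>A hyperbolic metric on \<open>S\<close> is given by a universal covering \<open>p\<close> from the hyperbolic plane
  whose deck transformations are isometries: \<open>S\<close> is the quotient of the disc by \<open>deck_group p\<close>, a copy
  of $\pi_1(S)$. On an orientable surface all deck transformations preserve the orientation.\<close>

definition hyperbolic_structure :: "'a::topological_space set \<Rightarrow> (complex \<Rightarrow> 'a) \<Rightarrow> bool" where
  "hyperbolic_structure S p \<longleftrightarrow>
     covering_space (ball 0 1) p S \<and>
     (\<forall>z\<in>ball 0 1. \<forall>w\<in>ball 0 1. p z = p w \<longrightarrow> (\<exists>g\<in>deck_group p. g z = w))"

text \<open>A deck transformation \<open>g\<close> in the conjugacy class of a closed curve \<open>c\<close>: a lift of \<open>c\<close> runs from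
  some \<open>z\<close> to \<open>g z\<close>. It is determined up to conjugation, and it is the identity iff \<open>c\<close> is
  homotopically trivial.\<close>

definition holonomy :: "(complex \<Rightarrow> 'a) \<Rightarrow> (real \<Rightarrow> 'a) \<Rightarrow> complex \<Rightarrow> complex" where
  "holonomy p c = (SOME g. g \<in> deck_group p \<and>
     (\<exists>c'. path c' \<and> path_image c' \<subseteq> ball 0 1 \<and> (\<forall>t\<in>{0..1}. p (c' t) = c t) \<and>
        g (pathstart c') = pathfinish c'))"

text \<open>For a hyperbolic isometry this is the pair of endpoints of the axis.\<close>

definition axis_ends :: "(complex \<Rightarrow> complex) \<Rightarrow> complex set" where
  "axis_ends g = {x. cmod x = 1 \<and> g x = x}"


section \<open>Geodesic currents\<close>

text \<open>A Radon measure is finite on compact sets and inner regular.\<close>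

definition currents :: "(complex \<Rightarrow> 'a) \<Rightarrow> complex set measure set" where
  "currents p = {\<mu>.
     sets \<mu> = sets geodesic_borel \<and>
     (\<forall>K. compactin geodesic_topology K \<longrightarrow> emeasure \<mu> K < \<infinity>) \<and>
     (\<forall>B\<in>sets geodesic_borel.
        emeasure \<mu> B = (SUP K \<in> {K. compactin geodesic_topology K \<and> K \<subseteq> B}. emeasure \<mu> K)) \<and>
     (\<forall>g\<in>deck_group p. \<forall>B\<in>sets geodesic_borel. emeasure \<mu> ((`) g ` B) = emeasure \<mu> B)}"

definition test_functions :: "(complex set \<Rightarrow> real) set" where
  "test_functions = {\<phi>. continuous_map geodesic_topology euclideanreal \<phi> \<and>
     (\<exists>K. compactin geodesic_topology K \<and> (\<forall>G\<in>geodesics - K. \<phi> G = 0))}"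

definition weak_star_topology :: "(complex \<Rightarrow> 'a) \<Rightarrow> complex set measure topology" where
  "weak_star_topology p = topology_generated_by
     {{\<mu> \<in> currents p. (\<integral>G. \<phi> G \<partial>\<mu>) \<in> U} | \<phi> U. \<phi> \<in> test_functions \<and> open U}"

text \<open>Two distinct geodesics that meet in the disc cross transversely.\<close>

definition crossing_geodesics :: "(complex \<Rightarrow> complex) \<Rightarrow> complex \<Rightarrow> complex set set" where
  "crossing_geodesics g q =
     {G \<in> geodesics. G \<noteq> axis_ends g \<and> geodesic_line G \<inter> half_open_segment q (g q) \<noteq> {}}"

text \<open>The intersection number of a current with a curve. By invariance of the current it does not
  depend on the representative of the conjugacy class or on the point \<open>q\<close> of the axis.\<close>

definition curve_intersection ::
    "(complex \<Rightarrow> 'a) \<Rightarrow> complex set measure \<Rightarrow> (real \<Rightarrow> 'a) \<Rightarrow> ennreal" where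
  "curve_intersection p \<mu> c =
     (let g = holonomy p c; q = (SOME q. q \<in> geodesic_line (axis_ends g))
      in if g = id then 0 else emeasure \<mu> (crossing_geodesics g q))"

text \<open>The current of a curve with holonomy \<open>g\<close> puts mass \<open>k\<close> on every lift of the closed geodesic,
  where \<open>g\<close> is the \<open>k\<close>-th power of a primitive element. Elements of the deck group are
  compared on the disc, since iterates of Moebius maps are not meaningful at poles.\<close>

definition root_exponent :: "(complex \<Rightarrow> 'a) \<Rightarrow> (complex \<Rightarrow> complex) \<Rightarrow> nat" where
  "root_exponent p g = Max {k. \<exists>h\<in>deck_group p. \<forall>z\<in>ball 0 1. g z = (h ^^ k) z}"

definition curve_current :: "(complex \<Rightarrow> 'a) \<Rightarrow> (real \<Rightarrow> 'a) \<Rightarrow> complex set measure" where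
  "curve_current p c =
     (let g = holonomy p c
      in scale_measure (of_nat (root_exponent p g))
           (distr (count_space {f ` axis_ends g | f. f \<in> deck_group p}) geodesic_borel (\<lambda>G. G)))"

text \<open>Bonahon's intersection form: the continuous symmetric bilinear form on currents that extends
  the geometric intersection number of curves and, on pairs of a current and a curve, the
  number \<open>curve_intersection\<close>. Linearity is stated for a current \<open>\<rho>\<close> that equals
  $a\mu + b\nu$; linearity in the second argument follows by symmetry.\<close>

definition intersection_form ::
    "'a::topological_space set \<Rightarrow> (complex \<Rightarrow> 'a)
       \<Rightarrow> (complex set measure \<Rightarrow> complex set measure \<Rightarrow> real) \<Rightarrow> bool" where
  "intersection_form S p i \<longleftrightarrow>
     (\<forall>\<mu>\<in>currents p. \<forall>\<nu>\<in>currents p. 0 \<le> i \<mu> \<nu> \<and> i \<mu> \<nu> = i \<nu> \<mu>) \<and>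
     (\<forall>\<mu>\<in>currents p. \<forall>\<nu>\<in>currents p. \<forall>\<rho>\<in>currents p. \<forall>\<xi>\<in>currents p. \<forall>a\<ge>0. \<forall>b\<ge>0.
        (\<forall>B\<in>sets geodesic_borel.
           emeasure \<rho> B = ennreal a * emeasure \<mu> B + ennreal b * emeasure \<nu> B) \<longrightarrow>
        i \<rho> \<xi> = a * i \<mu> \<xi> + b * i \<nu> \<xi>) \<and>
     continuous_map (prod_topology (weak_star_topology p) (weak_star_topology p)) euclideanreal
       (\<lambda>(\<mu>, \<nu>). i \<mu> \<nu>) \<and>
     (\<forall>c e. closed_curve S c \<and> closed_curve S e \<and> holonomy p c \<noteq> id \<and> holonomy p e \<noteq> id \<longrightarrow>
        i (curve_current p c) (curve_current p e) = real (geometric_intersection S c e)) \<and>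
     (\<forall>\<mu>\<in>currents p. \<forall>c. closed_curve S c \<and> holonomy p c \<noteq> id \<longrightarrow>
        ennreal (i \<mu> (curve_current p c)) = curve_intersection p \<mu> c)"

text \<open>\<open>dual_current S p d \<mu>d\<close>: \<open>\<mu>d\<close> is the current whose intersection numbers with curves are
  their \<open>d\<close>-lengths. The extension \<open>L\<close> of the length function to currents is the intersection
  number with that current.\<close>

definition dual_current ::
    "'a::topological_space set \<Rightarrow> (complex \<Rightarrow> 'a) \<Rightarrow> ('a \<Rightarrow> 'a \<Rightarrow> real) \<Rightarrow> complex set measure \<Rightarrow> bool" where
  "dual_current S p d \<mu>d \<longleftrightarrow>
     \<mu>d \<in> currents p \<and>
     (\<forall>c. closed_curve S c \<longrightarrow> curve_intersection p \<mu>d c = curve_length S d c)"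

definition current_length ::
    "'a::topological_space set \<Rightarrow> (complex \<Rightarrow> 'a)
       \<Rightarrow> (complex set measure \<Rightarrow> complex set measure \<Rightarrow> real) \<Rightarrow> ('a \<Rightarrow> 'a \<Rightarrow> real)
       \<Rightarrow> (complex set measure \<Rightarrow> real) \<Rightarrow> bool" where
  "current_length S p i d L \<longleftrightarrow>
     (\<exists>\<mu>d. dual_current S p d \<mu>d \<and> (\<forall>\<mu>\<in>currents p. L \<mu> = i \<mu>d \<mu>))"

end

theory Submission imports Defs begin

text \<open>The currents \<open>\<nu>\<close> with \<open>i \<nu> \<mu>\<^sub>1 \<le> i \<nu> \<mu>\<^sub>2\<close> form a weak* closed cone. It contains the currents of closed
  curves, so it suffices that weighted closed curves generate a dense cone of currents. The key point is
  that a test function whose sum over every closed geodesic is nonnegative has nonnegative integral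
  against every current: the integral is transported, by invariance of the current, to sums over long
  segments of geodesics; cocompactness cuts such a segment into boundedly many loops that return to
  nearly the same position modulo the group, and each loop is shadowed by a closed geodesic. Density
  follows by almost minimising a quadratic distance to the given current over the cone.\<close>

section \<open>Isometries of the disc\<close>

text \<open>The obstacle is that transport weights a geodesic by the number of group elements in its
  segment. Segments of fixed hyperbolic length would make this weight vary with the geodesic, and
  the integral of the test function could not be recovered. Segments are therefore measured by
  counting: the elements that carry the origin near the geodesic are ranked along it, and a segment
  consists of those within about \<open>N\<close> ranks of the identity on either side. Its
  cardinality is \<open>2 * N\<close> up to a bounded error, and being few ranks apart is a
  symmetric and invariant relation, which is what transport needs. Every other loss is of one of two
  kinds: at most \<epsilon> per element, from uniform continuity of the test function, or a constant
  per segment, from the ends of the boundedly many loops. Division by \<open>2 * N\<close> removes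
  the second kind in the limit. Positions along a geodesic are quotients of derivatives at its ends,
  and nearness to it is a lower bound for the distance of its ends after pulling back. Closeness to
  the given current is asked only on finitely many test functions, so density is a least squares
  problem.\<close>

abbreviation finv :: "('b \<Rightarrow> 'c) \<Rightarrow> 'c \<Rightarrow> 'b" where
  "finv f \<equiv> inv_into UNIV f"

text \<open>Isometries of the disc are replaced by the identity off the closed disc, so that they become
  bijections of the plane and form a group under composition.\<close>

definition disc_aut :: "(complex \<Rightarrow> complex) \<Rightarrow> bool" where
  "disc_aut f \<longleftrightarrow> (\<exists>a b. a * cnj a - b * cnj b = 1 \<and>
     (\<forall>z. f z = (if norm z \<le> 1 then disc_map a b z else z)))"

text \<open>The value at \<open>f z\<close> is $|f'(z)|^{1/2}$.\<close>

definition sqrt_deriv :: "(complex \<Rightarrow> complex) \<Rightarrow> complex \<Rightarrow> real" where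
  "sqrt_deriv f w = norm (1 - cnj (f 0) * w) / sqrt (1 - (norm (f 0))\<^sup>2)"

lemma unit_det_iff: "a * cnj a - b * cnj b = 1 \<longleftrightarrow> (norm a)\<^sup>2 - (norm b)\<^sup>2 = 1"
proof -
  have "a * cnj a - b * cnj b = complex_of_real ((norm a)\<^sup>2 - (norm b)\<^sup>2)"
    unfolding of_real_diff complex_norm_square by simp
  then show ?thesis by (metis of_real_1 of_real_eq_iff)
qed

lemma disc_map_den_nonzero:
  assumes "norm b < norm a" "norm z \<le> 1"
  shows "cnj b * z + cnj a \<noteq> 0"
proof
  assume "cnj b * z + cnj a = 0"
  then have "norm (cnj b * z) = norm (cnj a)" by (metis add_eq_0_iff norm_minus_cancel)
  moreover have "norm (cnj b * z) \<le> norm b"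
    using assms(2) by (simp add: norm_mult mult_left_le)
  ultimately show False using assms(1) by simp
qed

text \<open>With \<open>D\<close> the denominator of the Moebius map, cross multiplication in either
  expression leaves the determinant of the coefficient matrix as a factor, and that is normalised to
  1.\<close>

lemma disc_aut_den:
  assumes "disc_aut f"
  obtains D where "\<And>z. norm z \<le> 1 \<Longrightarrow> D z \<noteq> 0"
    "\<And>z w. norm z \<le> 1 \<Longrightarrow> norm w \<le> 1 \<Longrightarrow> f z - f w = (z - w) / (D z * D w)"
    "\<And>z w. norm z \<le> 1 \<Longrightarrow> norm w \<le> 1 \<Longrightarrow> 1 - cnj (f z) * f w = (1 - cnj z * w) / (cnj (D z) * D w)"
proof -
  from assms obtain a b where ab: "a * cnj a - b * cnj b = 1"
    and f: "\<And>z. f z = (if norm z \<le> 1 then disc_map a b z else z)"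
    unfolding disc_aut_def by auto
  have "norm b < norm a"
    using ab unfolding unit_det_iff by (smt (verit) norm_ge_zero power_mono)
  note nz = disc_map_den_nonzero[OF this]
  define D where "D z = cnj b * z + cnj a" for z
  have 1: "f z - f w = (z - w) / (D z * D w)" if "norm z \<le> 1" "norm w \<le> 1" for z w
  proof -
    have "(a * z + b) * (cnj b * w + cnj a) - (a * w + b) * (cnj b * z + cnj a)
        = (a * cnj a - b * cnj b) * (z - w)" by (simp add: algebra_simps)
    then show ?thesis
      using nz[OF that(1)] nz[OF that(2)] that ab
      by (simp add: f disc_map_def D_def diff_frac_eq)
  qed
  have 2: "1 - cnj (f z) * f w = (1 - cnj z * w) / (cnj (D z) * D w)"
    if "norm z \<le> 1" "norm w \<le> 1" for z w
  proof -
    have nz': "b * cnj z + a \<noteq> 0"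
      using nz[OF that(1)] by (metis complex_cnj_add complex_cnj_cnj complex_cnj_mult complex_cnj_zero_iff)
    have "(b * cnj z + a) * (cnj b * w + cnj a) - (cnj a * cnj z + cnj b) * (a * w + b)
        = (a * cnj a - b * cnj b) * (1 - cnj z * w)" by (simp add: algebra_simps)
    moreover have "1 - (x / y) * (u / v) = (y * v - x * u) / (y * v)" if "y \<noteq> 0" "v \<noteq> 0" for x y u v :: complex
      using that by (simp add: divide_simps)
    ultimately show ?thesis
      using nz[OF that(2)] nz' that ab by (simp add: f disc_map_def D_def)
  qed
  show ?thesis
    by (rule that[of D]) (use nz 1 2 in \<open>auto simp: D_def\<close>)
qed

text \<open>For equal points the second identity of \<open>disc_aut_den\<close> reads 1 - |f z|^2 =
  (1 - |z|^2) / |D z|^2 on the closed disc, so the sign of 1 - |z|^2 is kept.\<close>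

lemma disc_aut_norm:
  assumes "disc_aut f"
  shows "norm (f z) < 1 \<longleftrightarrow> norm z < 1" "norm (f z) = 1 \<longleftrightarrow> norm z = 1" "norm (f z) \<le> 1 \<longleftrightarrow> norm z \<le> 1"
proof -
  obtain D where nz: "\<And>z. norm z \<le> 1 \<Longrightarrow> D z \<noteq> 0"
    and D: "\<And>z w. norm z \<le> 1 \<Longrightarrow> norm w \<le> 1 \<Longrightarrow> 1 - cnj (f z) * f w = (1 - cnj z * w) / (cnj (D z) * D w)"
    using disc_aut_den[OF assms] by metis
  have *: "1 - (norm (f z))\<^sup>2 = (1 - (norm z)\<^sup>2) / (norm (D z))\<^sup>2" if "norm z \<le> 1" for z
  proof -
    have "complex_of_real (1 - (norm (f z))\<^sup>2) = complex_of_real ((1 - (norm z)\<^sup>2) / (norm (D z))\<^sup>2)"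
      using D[OF that that] unfolding of_real_diff of_real_divide complex_norm_square
      by (simp add: mult.commute)
    then show ?thesis using of_real_eq_iff by blast
  qed
  have "(norm (f z) < 1 \<longleftrightarrow> norm z < 1) \<and> (norm (f z) = 1 \<longleftrightarrow> norm z = 1)"
  proof (cases "norm z \<le> 1")
    case True
    have "1 / (norm (D z))\<^sup>2 > 0" using nz[OF True] by simp
    moreover have "1 - (norm (f z))\<^sup>2 = 1 / (norm (D z))\<^sup>2 * (1 - (norm z)\<^sup>2)"
      using *[OF True] by simp
    ultimately have "0 < 1 - (norm (f z))\<^sup>2 \<longleftrightarrow> 0 < 1 - (norm z)\<^sup>2"
      "1 - (norm (f z))\<^sup>2 = 0 \<longleftrightarrow> 1 - (norm z)\<^sup>2 = 0"
      by (metis zero_less_mult_pos mult_pos_pos, metis mult_eq_0_iff less_irrefl)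
    then show ?thesis
      using abs_square_less_1[of "norm (f z)"] abs_square_less_1[of "norm z"]
        abs_square_eq_1[of "norm (f z)"] abs_square_eq_1[of "norm z"]
      by simp
  next
    case False
    then have "f z = z" using assms by (auto simp: disc_aut_def)
    then show ?thesis by simp
  qed
  then show "norm (f z) < 1 \<longleftrightarrow> norm z < 1" "norm (f z) = 1 \<longleftrightarrow> norm z = 1" "norm (f z) \<le> 1 \<longleftrightarrow> norm z \<le> 1"
    by auto
qed

lemma disc_aut_id: "disc_aut id"
  unfolding disc_aut_def by (intro exI[of _ 1] exI[of _ 0]) (auto simp: disc_map_def)

lemma disc_aut_comp:
  assumes "disc_aut f" "disc_aut h"
  shows "disc_aut (f \<circ> h)"
proof -
  from assms(1) obtain a b where ab: "a * cnj a - b * cnj b = 1"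
    and f: "\<And>z. f z = (if norm z \<le> 1 then disc_map a b z else z)"
    unfolding disc_aut_def by auto
  from assms(2) obtain c d where cd: "c * cnj c - d * cnj d = 1"
    and h: "\<And>z. h z = (if norm z \<le> 1 then disc_map c d z else z)"
    unfolding disc_aut_def by auto
  have ba: "norm b < norm a" "norm d < norm c"
    using ab cd unfolding unit_det_iff by (smt (verit) norm_ge_zero power_mono)+
  \<comment> \<open>The entries of the product of the two coefficient matrices; multiplicativity of
    the determinant keeps the normalisation.\<close>
  define A B where "A = a * c + b * cnj d" and "B = a * d + b * cnj c"
  have AB: "A * cnj A - B * cnj B = 1"
  proof -
    have "A * cnj A - B * cnj B = (a * cnj a - b * cnj b) * (c * cnj c - d * cnj d)"
      by (simp add: A_def B_def algebra_simps)
    then show ?thesis using ab cd by simp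
  qed
  have "(f \<circ> h) z = disc_map A B z" if "norm z \<le> 1" for z
  proof -
    have hz: "norm (h z) \<le> 1" using disc_aut_norm[OF assms(2)] that by simp
    have n1: "cnj d * z + cnj c \<noteq> 0" using disc_map_den_nonzero ba that by blast
    have n2: "cnj b * ((c * z + d) / (cnj d * z + cnj c)) + cnj a \<noteq> 0"
      using disc_map_den_nonzero[OF ba(1) hz] that by (simp add: h disc_map_def)
    have "(f \<circ> h) z = (a * ((c * z + d) / (cnj d * z + cnj c)) + b) / (cnj b * ((c * z + d) / (cnj d * z + cnj c)) + cnj a)"
      using that hz by (simp add: f h disc_map_def)
    also have "\<dots> = (a * (c * z + d) + b * (cnj d * z + cnj c)) / (cnj b * (c * z + d) + cnj a * (cnj d * z + cnj c))"
      using n1 n2 by (simp add: divide_simps)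
    also have "\<dots> = disc_map A B z"
      by (simp add: A_def B_def disc_map_def algebra_simps)
    finally show ?thesis .
  qed
  moreover have "(f \<circ> h) z = z" if "\<not> norm z \<le> 1" for z
    using that by (simp add: f h)
  ultimately have "\<forall>z. (f \<circ> h) z = (if norm z \<le> 1 then disc_map A B z else z)"
    by metis
  then show ?thesis
    unfolding disc_aut_def using AB by blast
qed

lemma disc_aut_inverse:
  assumes "disc_aut f"
  shows "bij f" "disc_aut (finv f)"
proof -
  from assms obtain a b where ab: "a * cnj a - b * cnj b = 1"
    and f: "\<And>z. f z = (if norm z \<le> 1 then disc_map a b z else z)"
    unfolding disc_aut_def by auto
  \<comment> \<open>The inverse matrix, written without division because the determinant is
    1.\<close>
  define h where "h z = (if norm z \<le> 1 then disc_map (cnj a) (- b) z else z)" for z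
  have h: "disc_aut h" unfolding disc_aut_def
    by (intro exI[of _ "cnj a"] exI[of _ "- b"]) (use ab in \<open>auto simp: h_def algebra_simps\<close>)
  have ba: "norm b < norm a"
    using ab unfolding unit_det_iff by (smt (verit) norm_ge_zero power_mono)
  have 1: "h (f z) = z" for z
  proof (cases "norm z \<le> 1")
    case True
    then have fz: "norm (f z) \<le> 1" using disc_aut_norm[OF assms] by simp
    have n1: "cnj b * z + cnj a \<noteq> 0" using disc_map_den_nonzero ba True by blast
    have "h (f z) = (cnj a * ((a * z + b) / (cnj b * z + cnj a)) - b) / (a - cnj b * ((a * z + b) / (cnj b * z + cnj a)))"
      using fz True by (simp add: h_def f disc_map_def)
    also have "\<dots> = (cnj a * (a * z + b) - b * (cnj b * z + cnj a)) / (a * (cnj b * z + cnj a) - cnj b * (a * z + b))"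
      using n1 by (simp add: divide_simps)
    also have "\<dots> = ((a * cnj a - b * cnj b) * z) / (a * cnj a - b * cnj b)"
      by (simp add: algebra_simps)
    finally show ?thesis using ab by simp
  qed (simp add: f h_def)
  have 2: "f (h z) = z" for z
  proof (cases "norm z \<le> 1")
    case True
    then have fz: "norm (h z) \<le> 1" using disc_aut_norm[OF h] by simp
    have n1: "a - cnj b * z \<noteq> 0" using disc_map_den_nonzero[of "-b" "cnj a" z] ba True by simp
    have "f (h z) = (a * ((cnj a * z - b) / (a - cnj b * z)) + b) / (cnj b * ((cnj a * z - b) / (a - cnj b * z)) + cnj a)"
      using fz True by (simp add: h_def f disc_map_def)
    also have "\<dots> = (a * (cnj a * z - b) + b * (a - cnj b * z)) / (cnj b * (cnj a * z - b) + cnj a * (a - cnj b * z))"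
      using n1 by (simp add: divide_simps)
    also have "\<dots> = ((a * cnj a - b * cnj b) * z) / (a * cnj a - b * cnj b)"
      by (simp add: algebra_simps)
    finally show ?thesis using ab by simp
  qed (simp add: f h_def)
  show "bij f" using 1 2 by (metis bijI')
  have "finv f = h" using 1 2 by (metis inv_equality)
  then show "disc_aut (finv f)" using h by simp
qed

lemma disc_aut_continuous:
  assumes "disc_aut f"
  shows "continuous_on (cball 0 1) f"
proof -
  from assms obtain a b where ab: "a * cnj a - b * cnj b = 1"
    and f: "\<And>z. f z = (if norm z \<le> 1 then disc_map a b z else z)"
    unfolding disc_aut_def by auto
  have ba: "norm b < norm a"
    using ab unfolding unit_det_iff by (smt (verit) norm_ge_zero power_mono)
  have "continuous_on (cball 0 1) (disc_map a b)"
    unfolding disc_map_def using disc_map_den_nonzero[OF ba] by (intro continuous_intros) auto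
  then show ?thesis
    by (rule continuous_on_eq) (auto simp: f)
qed

lemma sqrt_deriv_pos:
  assumes "disc_aut f" "norm w \<le> 1"
  shows "sqrt_deriv f w > 0"
proof -
  have "norm (f 0) < 1" using disc_aut_norm[OF assms(1), of 0] by simp
  then have "norm (cnj (f 0) * w) < 1"
    using assms(2) by (simp add: norm_mult) (metis mult_left_le norm_ge_zero order_le_less_trans)
  then have "1 - cnj (f 0) * w \<noteq> 0" by auto
  then show ?thesis
    using \<open>norm (f 0) < 1\<close> by (auto simp: sqrt_deriv_def power_less_one_iff abs_square_less_1)
qed

text \<open>By \<open>disc_aut_den\<close> both expressions are distorted by a factor 1 / |D| for
  each of the two points. Putting one point at 0 eliminates the coefficients and expresses this
  factor through the image of the origin alone.\<close>

lemma disc_aut_diff_norms: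
  assumes "disc_aut f" "norm v \<le> 1" "norm w \<le> 1"
  shows "norm (f v - f w) = norm (v - w) * sqrt_deriv f (f v) * sqrt_deriv f (f w)"
    and "norm (1 - cnj (f v) * f w) = norm (1 - cnj v * w) * sqrt_deriv f (f v) * sqrt_deriv f (f w)"
proof -
  obtain D where nz: "\<And>z. norm z \<le> 1 \<Longrightarrow> D z \<noteq> 0"
    and 1: "\<And>z w. norm z \<le> 1 \<Longrightarrow> norm w \<le> 1 \<Longrightarrow> f z - f w = (z - w) / (D z * D w)"
    and 2: "\<And>z w. norm z \<le> 1 \<Longrightarrow> norm w \<le> 1 \<Longrightarrow> 1 - cnj (f z) * f w = (1 - cnj z * w) / (cnj (D z) * D w)"
    using disc_aut_den[OF assms(1)] by metis
  have J: "sqrt_deriv f (f u) = 1 / norm (D u)" if "norm u \<le> 1" for u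
  proof -
    have f0: "norm (f 0) < 1" using disc_aut_norm[OF assms(1), of 0] by simp
    have "norm (1 - cnj (f 0) * f 0) = 1 / (norm (D 0))\<^sup>2"
      using 2[of 0 0] by (simp add: norm_divide norm_mult power2_eq_square)
    moreover have "1 - cnj (f 0) * f 0 = complex_of_real (1 - (norm (f 0))\<^sup>2)"
      unfolding of_real_diff complex_norm_square by (simp add: mult.commute)
    moreover have "1 - (norm (f 0))\<^sup>2 \<ge> 0" using f0 by (simp add: abs_square_le_1)
    ultimately have "1 - (norm (f 0))\<^sup>2 = 1 / (norm (D 0))\<^sup>2"
      by (metis abs_of_nonneg norm_of_real)
    then have "sqrt (1 - (norm (f 0))\<^sup>2) = 1 / norm (D 0)"
      by (simp add: real_sqrt_divide)
    moreover have "norm (1 - cnj (f 0) * f u) = 1 / (norm (D 0) * norm (D u))"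
      using 2[of 0 u] that by (simp add: norm_divide norm_mult)
    ultimately show ?thesis using nz[of 0] by (simp add: sqrt_deriv_def)
  qed
  show "norm (f v - f w) = norm (v - w) * sqrt_deriv f (f v) * sqrt_deriv f (f w)"
    using assms by (simp add: 1 J norm_divide norm_mult)
  show "norm (1 - cnj (f v) * f w) = norm (1 - cnj v * w) * sqrt_deriv f (f v) * sqrt_deriv f (f w)"
    using assms by (simp add: 2 J norm_divide norm_mult)
qed

lemma norm_one_minus_cnj_self:
  assumes "norm v < 1"
  shows "norm (1 - cnj v * v) = 1 - (norm v)\<^sup>2"
proof -
  have "1 - cnj v * v = complex_of_real (1 - (norm v)\<^sup>2)"
    unfolding of_real_diff complex_norm_square by (simp add: mult.commute)
  moreover have "1 - (norm v)\<^sup>2 \<ge> 0" using assms by (simp add: abs_square_le_1)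
  ultimately show ?thesis by (metis abs_of_nonneg norm_of_real)
qed

text \<open>The chain rule, with derivatives indexed by image points: \<open>w\<close> is a value of
  \<open>f\<close>, and \<open>h w\<close> the corresponding value of the composition.\<close>

lemma sqrt_deriv_comp:
  assumes "disc_aut f" "disc_aut h" "norm w \<le> 1"
  shows "sqrt_deriv (h \<circ> f) (h w) = sqrt_deriv f w * sqrt_deriv h (h w)"
proof -
  have f0: "norm (f 0) < 1" using disc_aut_norm[OF assms(1), of 0] by simp
  have hf0: "norm (h (f 0)) < 1" using disc_aut_norm[OF assms(2), of "f 0"] f0 by simp
  have pos: "sqrt_deriv h (h (f 0)) > 0" using sqrt_deriv_pos assms(2) hf0 by simp
  have "1 - (norm (h (f 0)))\<^sup>2 = (1 - (norm (f 0))\<^sup>2) * (sqrt_deriv h (h (f 0)))\<^sup>2"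
    using disc_aut_diff_norms(2)[OF assms(2), of "f 0" "f 0"] f0 hf0
    by (simp add: norm_one_minus_cnj_self power2_eq_square)
  then have "sqrt (1 - (norm (h (f 0)))\<^sup>2) = sqrt (1 - (norm (f 0))\<^sup>2) * sqrt_deriv h (h (f 0))"
    using pos by (simp add: real_sqrt_mult)
  moreover have "norm (1 - cnj (h (f 0)) * h w)
      = norm (1 - cnj (f 0) * w) * sqrt_deriv h (h (f 0)) * sqrt_deriv h (h w)"
    using disc_aut_diff_norms(2)[OF assms(2)] f0 assms(3) by simp
  ultimately show ?thesis
    using pos by (simp add: sqrt_deriv_def[of "h \<circ> f"] sqrt_deriv_def[of f])
qed

lemma sqrt_deriv_id: "sqrt_deriv id w = 1"
  by (simp add: sqrt_deriv_def)

lemma norm_unit_diff_cnj: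
  assumes "norm w = 1"
  shows "norm (1 - cnj z * w) = norm (w - z)"
proof -
  have "cnj w * w = 1" using assms by (metis complex_norm_square mult.commute of_real_1 one_power2)
  then have "1 - cnj z * w = cnj (w - z) * w" by (simp add: algebra_simps)
  then show ?thesis using assms by (simp add: norm_mult del: complex_cnj_diff)
qed

text \<open>On the circle the square of this quantity is the reciprocal of the Poisson kernel of
  \<open>f 0\<close> at \<open>w\<close>.\<close>

lemma sqrt_deriv_boundary:
  "norm w = 1 \<Longrightarrow> sqrt_deriv f w = norm (w - f 0) / sqrt (1 - (norm (f 0))\<^sup>2)"
  by (simp add: sqrt_deriv_def norm_unit_diff_cnj)

section \<open>Discrete groups of disc isometries\<close>

text \<open>For \<open>x\<close>, \<open>y\<close> on the circle this is the position of the projection of \<open>f 0\<close> to the geodesic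
  from \<open>y\<close> to \<open>x\<close>, on a multiplicative scale on which the origin has position 1.\<close>

definition geo_pos :: "complex \<Rightarrow> complex \<Rightarrow> (complex \<Rightarrow> complex) \<Rightarrow> real" where
  "geo_pos x y f = sqrt_deriv f y / sqrt_deriv f x"

text \<open>The estimates along geodesics use the deck group only through these properties.
  Discreteness is stated for the orbit of the origin, and cocompactness as a disc of radius below 1
  that meets every orbit.\<close>

locale fuchsian_group =
  fixes \<Gamma> :: "(complex \<Rightarrow> complex) set"
  assumes aut: "f \<in> \<Gamma> \<Longrightarrow> disc_aut f"
    and id_in: "id \<in> \<Gamma>"
    and comp_in: "f \<in> \<Gamma> \<Longrightarrow> h \<in> \<Gamma> \<Longrightarrow> f \<circ> h \<in> \<Gamma>"
    and finv_in: "f \<in> \<Gamma> \<Longrightarrow> finv f \<in> \<Gamma>"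
    and free: "f \<in> \<Gamma> \<Longrightarrow> norm z < 1 \<Longrightarrow> f z = z \<Longrightarrow> f = id"
    and proper: "r < 1 \<Longrightarrow> finite {f \<in> \<Gamma>. norm (f 0) \<le> r}"
    and cocompact: "\<exists>r<1. \<forall>z. norm z < 1 \<longrightarrow> (\<exists>f\<in>\<Gamma>. norm (f z) \<le> r)"
begin

text \<open>For \<open>x\<close>, \<open>y\<close> on the circle: the elements that move the origin to a point whose distance from
  the geodesic with ends \<open>x\<close>, \<open>y\<close> is bounded in terms of \<open>\<delta>\<close>.\<close>

definition near :: "real \<Rightarrow> complex \<Rightarrow> complex \<Rightarrow> (complex \<Rightarrow> complex) set" where
  "near \<delta> x y = {f \<in> \<Gamma>. \<delta> \<le> norm (finv f x - finv f y)}"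

lemma bij_in: "f \<in> \<Gamma> \<Longrightarrow> bij f"
  using disc_aut_inverse aut by blast

lemma finv_f [simp]: "f \<in> \<Gamma> \<Longrightarrow> finv f (f z) = z" "f \<in> \<Gamma> \<Longrightarrow> f (finv f z) = z"
  by (simp_all add: bij_in bij_is_inj bij_is_surj surj_f_inv_f)

lemma finv_finv [simp]: "f \<in> \<Gamma> \<Longrightarrow> finv (finv f) = f"
  by (simp add: bij_in inv_inv_eq)

lemma finv_comp [simp]: "f \<in> \<Gamma> \<Longrightarrow> h \<in> \<Gamma> \<Longrightarrow> finv (f \<circ> h) = finv h \<circ> finv f"
  by (simp add: bij_in o_inv_distrib)

lemma finv_o [simp]: "f \<in> \<Gamma> \<Longrightarrow> finv f \<circ> f = id" "f \<in> \<Gamma> \<Longrightarrow> f \<circ> finv f = id"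
  by (auto simp: fun_eq_iff)

lemma finv_o_assoc [simp]:
  "f \<in> \<Gamma> \<Longrightarrow> finv f \<circ> (f \<circ> h) = h" "f \<in> \<Gamma> \<Longrightarrow> f \<circ> (finv f \<circ> h) = h"
  by (auto simp: fun_eq_iff)

lemma norm_in [simp]:
  "f \<in> \<Gamma> \<Longrightarrow> norm (f z) = 1 \<longleftrightarrow> norm z = 1"
  "f \<in> \<Gamma> \<Longrightarrow> norm (finv f z) = 1 \<longleftrightarrow> norm z = 1"
  "f \<in> \<Gamma> \<Longrightarrow> norm (f z) < 1 \<longleftrightarrow> norm z < 1"
  "f \<in> \<Gamma> \<Longrightarrow> norm (finv f z) < 1 \<longleftrightarrow> norm z < 1"
  "f \<in> \<Gamma> \<Longrightarrow> norm (f z) \<le> 1 \<longleftrightarrow> norm z \<le> 1"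
  using disc_aut_norm aut finv_in by blast+

lemma norm_in_1 [simp]:
  "f \<in> \<Gamma> \<Longrightarrow> norm z = 1 \<Longrightarrow> norm (f z) = 1"
  "f \<in> \<Gamma> \<Longrightarrow> norm z = 1 \<Longrightarrow> norm (finv f z) = 1"
  by simp_all

lemma in_eq_iff: "f \<in> \<Gamma> \<Longrightarrow> f x = f y \<longleftrightarrow> x = y"
  by (metis finv_f(1))

lemma finv_eq_iff: "f \<in> \<Gamma> \<Longrightarrow> finv f x = finv f y \<longleftrightarrow> x = y"
  by (metis finv_f(2))

lemma deriv_pos: "f \<in> \<Gamma> \<Longrightarrow> norm w \<le> 1 \<Longrightarrow> sqrt_deriv f w > 0"
  using sqrt_deriv_pos aut by blast

section \<open>Distances between ends, positions and counting along a geodesic\<close>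

lemma norm_diff_finv:
  assumes "f \<in> \<Gamma>" "norm x \<le> 1" "norm y \<le> 1"
  shows "norm (x - y) = norm (finv f x - finv f y) * sqrt_deriv f x * sqrt_deriv f y"
proof -
  have "norm (finv f x) \<le> 1" "norm (finv f y) \<le> 1"
    using assms norm_in(5)[OF finv_in] by auto
  then show ?thesis
    using disc_aut_diff_norms(1)[OF aut[OF assms(1)], of "finv f x" "finv f y"] assms(1) by simp
qed

text \<open>In the quotient of the two distance formulas the derivative at the common point
  \<open>b\<close> cancels, and the quotient of the derivatives at \<open>c\<close> and
  \<open>a\<close> that is left is a position along the geodesic from \<open>c\<close> to
  \<open>a\<close>.\<close>

lemma three_point:
  assumes "f \<in> \<Gamma>" "norm a = 1" "norm b = 1" "norm c = 1"
  shows "norm (finv f a - finv f b) * norm (c - b)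
       = geo_pos a c f * norm (a - b) * norm (finv f c - finv f b)"
proof -
  have e: "norm (a - b) = norm (finv f a - finv f b) * sqrt_deriv f a * sqrt_deriv f b"
    "norm (c - b) = norm (finv f c - finv f b) * sqrt_deriv f c * sqrt_deriv f b"
    by (rule norm_diff_finv; use assms in simp)+
  have "sqrt_deriv f a > 0" using deriv_pos assms by simp
  then show ?thesis unfolding e geo_pos_def by simp
qed

lemma geo_pos_pos: "f \<in> \<Gamma> \<Longrightarrow> norm x = 1 \<Longrightarrow> norm y = 1 \<Longrightarrow> geo_pos x y f > 0"
  by (simp add: geo_pos_def deriv_pos)

lemma geo_pos_swap: "geo_pos y x f = 1 / geo_pos x y f"
  by (simp add: geo_pos_def)

lemma geo_pos_id [simp]: "geo_pos x y id = 1"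
  by (simp add: geo_pos_def sqrt_deriv_id)

text \<open>A cocycle rule: translation by \<open>h\<close> rescales all positions on a geodesic by
  one common factor, so their order and their ratios are kept.\<close>

lemma geo_pos_comp:
  assumes "f \<in> \<Gamma>" "h \<in> \<Gamma>" "norm x = 1" "norm y = 1"
  shows "geo_pos (h x) (h y) (h \<circ> f) = geo_pos x y f * geo_pos (h x) (h y) h"
  using sqrt_deriv_comp[of f h x] sqrt_deriv_comp[of f h y] assms aut by (simp add: geo_pos_def)

lemma geo_pos_finv:
  assumes "g \<in> \<Gamma>" "norm x = 1" "norm y = 1"
  shows "geo_pos (finv g x) (finv g y) (finv g) = 1 / geo_pos x y g"
  using geo_pos_comp[of g "finv g" x y] assms geo_pos_pos[OF assms] by (simp add: finv_in field_simps)

lemma near_comp: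
  "f \<in> \<Gamma> \<Longrightarrow> h \<in> \<Gamma> \<Longrightarrow> h \<circ> f \<in> near \<delta> (h x) (h y) \<longleftrightarrow> f \<in> near \<delta> x y"
  by (simp add: near_def comp_in)

lemma near_swap: "near \<delta> y x = near \<delta> x y"
  by (simp add: near_def norm_minus_commute)

text \<open>Elements near one geodesic with positions within a factor \<open>K\<close> of each other
  are at bounded distance from each other. Translating one of them to the identity confines all of
  them to the finite set \<open>F\<close>, whose size does not depend on the geodesic. The second
  conclusion makes the radius explicit for geodesics that themselves pass near the origin.\<close>

lemma card_near_le:
  assumes "\<delta> > 0" "K \<ge> 1"
  obtains M :: nat where
    "\<And>x y \<alpha>. norm x = 1 \<Longrightarrow> norm y = 1 \<Longrightarrow> \<alpha> > 0 \<Longrightarrow>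
       finite {f \<in> near \<delta> x y. \<alpha> \<le> geo_pos x y f \<and> geo_pos x y f \<le> \<alpha> * K} \<and>
       card {f \<in> near \<delta> x y. \<alpha> \<le> geo_pos x y f \<and> geo_pos x y f \<le> \<alpha> * K} \<le> M"
    "\<And>x y. norm x = 1 \<Longrightarrow> norm y = 1 \<Longrightarrow> \<delta> \<le> norm (x - y) \<Longrightarrow>
       {f \<in> near \<delta> x y. 1 / K \<le> geo_pos x y f \<and> geo_pos x y f \<le> K}
         \<subseteq> {f \<in> \<Gamma>. norm (f 0) \<le> sqrt (1 - \<delta> ^ 3 / (8 * K))}"
proof -
  \<comment> \<open>With \<open>a\<close>, \<open>b\<close> the derivatives at the ends,
    \<open>a * b\<close> is at most 2 / \<delta> and \<open>a\<close>, \<open>b\<close> agree up to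
    the factor \<open>K\<close>, so (a + b)^2 is at most 8 * K / \<delta>. The radius follows from
    \<delta> being at most (a + b) * sqrt (1 - |h 0|^2).\<close>
  define r where "r = sqrt (1 - \<delta> ^ 3 / (8 * K))"
  have "r < 1" using assms by (simp add: r_def)
  define F where "F = {f \<in> \<Gamma>. norm (f 0) \<le> r}"
  have "finite F" unfolding F_def using proper \<open>r < 1\<close> by blast
  have 2: "h \<in> F" if x: "norm x = 1" "norm y = 1" "\<delta> \<le> norm (x - y)"
    and h: "h \<in> near \<delta> x y" "1 / K \<le> geo_pos x y h" "geo_pos x y h \<le> K" for x y h
  proof -
    have hG: "h \<in> \<Gamma>" "\<delta> \<le> norm (finv h x - finv h y)" using h by (auto simp: near_def)
    define a b where "a = sqrt_deriv h x" and "b = sqrt_deriv h y"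
    have ab: "a > 0" "b > 0" using deriv_pos hG x by (auto simp: a_def b_def)
    have "\<delta> * (a * b) \<le> norm (finv h x - finv h y) * (a * b)"
      using hG(2) ab by (intro mult_right_mono) auto
    also have "\<dots> = norm (x - y)"
      using norm_diff_finv[OF hG(1), of x y] x by (simp add: a_def b_def mult_ac)
    also have "\<dots> \<le> 2" using norm_triangle_ineq4[of x y] x by simp
    finally have prod: "a * b \<le> 2 / \<delta>" using assms by (simp add: field_simps)
    have bK: "b \<le> K * a" "a \<le> K * b"
      using h(2,3) ab assms by (simp_all add: geo_pos_def a_def[symmetric] b_def[symmetric] field_simps)
    have "a * a \<le> a * (K * b)" "b * b \<le> b * (K * a)"
      using bK ab by (intro mult_left_mono; simp)+
    moreover have "K * (a * b) \<le> K * (2 / \<delta>)" using prod assms by (intro mult_left_mono) auto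
    moreover have "a * (K * b) = K * (a * b)" "b * (K * a) = K * (a * b)" by simp_all
    moreover have "(a + b)\<^sup>2 \<le> 2 * (a * a + b * b)"
      using sum_squares_bound[of a b] by (simp add: power2_eq_square algebra_simps)
    ultimately have sq: "(a + b)\<^sup>2 \<le> 8 * K / \<delta>" by simp
    have "norm (h 0) < 1" using hG by simp
    then have h0': "1 - (norm (h 0))\<^sup>2 > 0" by (simp add: abs_square_less_1)
    define s where "s = sqrt (1 - (norm (h 0))\<^sup>2)"
    have s: "s > 0" "s\<^sup>2 = 1 - (norm (h 0))\<^sup>2" using h0' by (auto simp: s_def)
    have "norm (x - h 0) = a * s" "norm (y - h 0) = b * s"
      using x s by (simp_all add: a_def b_def sqrt_deriv_boundary s_def)
    then have "\<delta> \<le> (a + b) * s"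
      using x(3) norm_triangle_ineq4[of "x - h 0" "y - h 0"] by (simp add: algebra_simps)
    then have "\<delta>\<^sup>2 \<le> ((a + b) * s)\<^sup>2" using assms by (intro power_mono) auto
    also have "\<dots> \<le> 8 * K / \<delta> * s\<^sup>2"
      unfolding power_mult_distrib using sq by (rule mult_right_mono) simp
    finally have "\<delta> ^ 3 / (8 * K) \<le> s\<^sup>2"
      using assms by (simp add: field_simps power2_eq_square power3_eq_cube)
    then have "norm (h 0) \<le> r" unfolding r_def s by (intro real_le_rsqrt) simp
    then show ?thesis using hG by (simp add: F_def)
  qed
  have 1: "finite {f \<in> near \<delta> x y. \<alpha> \<le> geo_pos x y f \<and> geo_pos x y f \<le> \<alpha> * K} \<and>
       card {f \<in> near \<delta> x y. \<alpha> \<le> geo_pos x y f \<and> geo_pos x y f \<le> \<alpha> * K} \<le> card F"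
    (is "finite ?A \<and> _") if x: "norm x = 1" "norm y = 1" and "\<alpha> > 0" for x y \<alpha>
  proof (cases "?A = {}")
    case False
    then obtain f0 where f0: "f0 \<in> ?A" by blast
    then have f0G: "f0 \<in> \<Gamma>" by (auto simp: near_def)
    \<comment> \<open>Moving \<open>f0\<close> to the identity makes the ends of the geodesic
      \<delta>-separated, as \<open>f0\<close> is near; this is the situation of fact
      \<open>2\<close>.\<close>
    have inj: "inj_on (\<lambda>f. finv f0 \<circ> f) ?A"
      by (rule inj_on_inverseI[of _ "\<lambda>h. f0 \<circ> h"]) (use f0G in auto)
    have "finv f0 \<circ> f \<in> F" if f: "f \<in> ?A" for f
    proof (rule 2)
      have fG: "f \<in> \<Gamma>" using f by (auto simp: near_def)
      show "norm (finv f0 x) = 1" "norm (finv f0 y) = 1" using x f0G by auto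
      show "\<delta> \<le> norm (finv f0 x - finv f0 y)" using f0 by (auto simp: near_def)
      show "finv f0 \<circ> f \<in> near \<delta> (finv f0 x) (finv f0 y)"
        using near_comp[OF fG finv_in[OF f0G]] f by simp
      have *: "geo_pos (finv f0 x) (finv f0 y) (finv f0 \<circ> f) = geo_pos x y f / geo_pos x y f0"
        using geo_pos_comp[OF fG finv_in[OF f0G] x] geo_pos_finv[OF f0G x] by simp
      have "geo_pos x y f0 > 0" "geo_pos x y f > 0" using geo_pos_pos f0G fG x by auto
      moreover have "geo_pos x y f0 \<le> K * geo_pos x y f" "geo_pos x y f \<le> K * geo_pos x y f0"
      proof -
        have "K * \<alpha> \<le> K * geo_pos x y f" "K * \<alpha> \<le> K * geo_pos x y f0"
          using f f0 assms by (auto intro!: mult_left_mono)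
        then show "geo_pos x y f0 \<le> K * geo_pos x y f" "geo_pos x y f \<le> K * geo_pos x y f0"
          using f f0 by (auto simp: mult.commute)
      qed
      ultimately show "1 / K \<le> geo_pos (finv f0 x) (finv f0 y) (finv f0 \<circ> f)"
        "geo_pos (finv f0 x) (finv f0 y) (finv f0 \<circ> f) \<le> K"
        unfolding * using assms by (simp_all add: field_simps)
    qed
    then have "(\<lambda>f. finv f0 \<circ> f) ` ?A \<subseteq> F" by blast
    then show ?thesis
      using card_inj_on_le[OF inj _ \<open>finite F\<close>] inj_on_finite[OF inj _ \<open>finite F\<close>] by blast
  next
    case True
    then show ?thesis by (metis card.empty finite.emptyI le0)
  qed
  have 3: "{f \<in> near \<delta> x y. 1 / K \<le> geo_pos x y f \<and> geo_pos x y f \<le> K}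
         \<subseteq> {f \<in> \<Gamma>. norm (f 0) \<le> sqrt (1 - \<delta> ^ 3 / (8 * K))}"
    if "norm x = 1" "norm y = 1" "\<delta> \<le> norm (x - y)" for x y
    using 2[OF that] unfolding F_def r_def by blast
  show ?thesis by (rule that[OF 1 3])
qed

lemma finite_near_between:
  assumes "\<delta> > 0" "norm x = 1" "norm y = 1" "a > 0"
  shows "finite {f \<in> near \<delta> x y. a \<le> geo_pos x y f \<and> geo_pos x y f \<le> b}"
proof -
  have K: "max 1 (b / a) \<ge> 1" by simp
  obtain M :: nat where "\<And>x y \<alpha>. norm x = 1 \<Longrightarrow> norm y = 1 \<Longrightarrow> \<alpha> > 0 \<Longrightarrow>
       finite {f \<in> near \<delta> x y. \<alpha> \<le> geo_pos x y f \<and> geo_pos x y f \<le> \<alpha> * max 1 (b / a)}"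
    by (rule card_near_le[OF assms(1) K]) blast
  from this[OF assms(2-4)]
  have fin: "finite {f \<in> near \<delta> x y. a \<le> geo_pos x y f \<and> geo_pos x y f \<le> a * max 1 (b / a)}" .
  have "b \<le> a * max 1 (b / a)" using assms(4) by (auto simp: max_def field_simps)
  then show ?thesis by (intro finite_subset[OF _ fin]) auto
qed

section \<open>Closing long segments of geodesics\<close>

text \<open>If \<open>finv g\<close> moves both ends little and \<open>g\<close> translates far,
  then \<open>g\<close> maps the part of the closed disc within 1 / \<open>geo_pos x y g\<close> of
  \<open>x\<close> into itself. This set is convex, so Brouwer's theorem applies. An interior fixed
  point would make \<open>g\<close> the identity, which has position 1.\<close>

lemma attracting_fixed_point:
  assumes g: "g \<in> \<Gamma>" and xy: "norm x = 1" "norm y = 1" and "\<delta> > 0"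
    and d: "\<delta> \<le> norm (x - y)" "norm (x - finv g x) \<le> \<delta> / 8" "norm (y - finv g y) \<le> \<delta> / 8"
    and R: "8 / \<delta> \<le> geo_pos x y g"
  obtains z where "norm z = 1" "g z = z" "norm (z - x) \<le> 1 / geo_pos x y g"
proof -
  define R where "R = geo_pos x y g"
  have Rpos: "R > 0" "1 / R \<le> \<delta> / 8"
  proof -
    show "R > 0" using R \<open>\<delta> > 0\<close> unfolding R_def by (intro less_le_trans[OF _ R]) simp
    then show "1 / R \<le> \<delta> / 8" using R \<open>\<delta> > 0\<close> unfolding R_def[symmetric] by (simp add: field_simps)
  qed
  define T where "T = cball 0 1 \<inter> cball x (1 / R)"
  have "x \<in> T" using xy Rpos by (simp add: T_def)
  then have T: "compact T" "convex T" "T \<noteq> {}"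
    by (auto simp: T_def intro!: compact_Int convex_Int)
  have cont: "continuous_on T g"
    using disc_aut_continuous[OF aut[OF g]] by (rule continuous_on_subset) (auto simp: T_def)
  have "g w \<in> T" if "w \<in> T" for w
  proof -
    have w: "norm w \<le> 1" "norm (w - x) \<le> 1 / R"
      using that by (auto simp: T_def dist_norm norm_minus_commute)
    have gw: "norm (g w) \<le> 1" using w g by simp
    have J: "sqrt_deriv g (g w) > 0" "sqrt_deriv g x > 0" "sqrt_deriv g y > 0"
      using deriv_pos[OF g] gw xy by auto
    have e: "norm (g w - x) = norm (w - finv g x) * sqrt_deriv g (g w) * sqrt_deriv g x"
       "norm (g w - y) = norm (w - finv g y) * sqrt_deriv g (g w) * sqrt_deriv g y"
      using norm_diff_finv[OF g gw] xy g by auto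
    \<comment> \<open>The unknown derivative at \<open>g w\<close> cancels in the quotient of the
      two formulas in \<open>e\<close>. Of the other factors, two are at most \<delta> / 4 and 2 and
      one is at least \<delta> / 2, so the radius 1 / \<open>R\<close> is reproduced
      exactly.\<close>
    have "norm (g w - x) * norm (w - finv g y) * R = norm (w - finv g x) * norm (g w - y)"
      unfolding R_def geo_pos_def e using J by simp
    moreover have "norm (w - finv g x) \<le> \<delta> / 4"
      using norm_triangle_ineq[of "w - x" "x - finv g x"] order_trans[OF w(2) Rpos(2)] d(2) by simp
    moreover have "norm (g w - y) \<le> 2"
      using norm_triangle_ineq4[of "g w" y] gw xy by simp
    ultimately have "norm (g w - x) * norm (w - finv g y) * R \<le> \<delta> / 4 * 2"
      using mult_mono[of "norm (w - finv g x)" "\<delta> / 4" "norm (g w - y)" 2] \<open>\<delta> > 0\<close> by simp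
    moreover have "norm (w - finv g y) \<ge> \<delta> / 2"
      using norm_triangle_ineq[of "x - w" "w - finv g y"] norm_triangle_ineq[of "x - finv g y" "finv g y - y"]
        order_trans[OF w(2) Rpos(2)] d \<open>\<delta> > 0\<close> by (simp add: norm_minus_commute)
    then have "norm (g w - x) * (\<delta> / 2) * R \<le> norm (g w - x) * norm (w - finv g y) * R"
      using Rpos by (intro mult_right_mono mult_left_mono) auto
    ultimately have "norm (g w - x) * (\<delta> / 2) * R \<le> \<delta> / 4 * 2" by linarith
    then have "norm (g w - x) \<le> 1 / R" using \<open>\<delta> > 0\<close> Rpos by (simp add: field_simps)
    then show ?thesis using gw by (simp add: T_def dist_norm norm_minus_commute)
  qed
  then obtain z where z: "z \<in> T" "g z = z"
    using brouwer[OF T cont] by blast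
  have "norm z = 1"
  proof (rule ccontr)
    assume "norm z \<noteq> 1"
    then have "norm z < 1" using z by (simp add: T_def)
    then have "g = id" using free[OF g] z by blast
    then have "R = 1" by (simp add: R_def)
    moreover have "\<delta> \<le> 2" using d(1) norm_triangle_ineq4[of x y] xy by simp
    ultimately show False using Rpos by simp
  qed
  then show ?thesis
    using that z by (auto simp: T_def R_def dist_norm norm_minus_commute)
qed

text \<open>The second fixed point is the attracting one of \<open>finv g\<close> for the pair
  \<open>finv g y\<close>, \<open>finv g x\<close>. The two translation lengths differ by the factor
  \<open>a / b\<close>; both \<open>a\<close> and \<open>b\<close> are quotients of chords of length
  between \<delta> / 2 and 2, hence lie between \<delta> / 4 and 4 / \<delta>, which gives 16 /
  \<delta>^2.\<close>

lemma closing_fixed_points: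
  assumes g: "g \<in> \<Gamma>" and xy: "norm x = 1" "norm y = 1" and "\<delta> > 0"
    and d: "\<delta> \<le> norm (x - y)" "\<delta> \<le> norm (finv g x - finv g y)"
      "norm (x - finv g x) \<le> \<delta> / 8" "norm (y - finv g y) \<le> \<delta> / 8"
    and R: "8 / \<delta> \<le> geo_pos x y g"
  obtains z w where "norm z = 1" "norm w = 1" "g z = z" "g w = w"
    "norm (z - x) \<le> 1 / geo_pos x y g" "norm (w - y) \<le> \<delta> / 4"
    "geo_pos z w g \<le> 16 / \<delta>\<^sup>2 * geo_pos x y g" "geo_pos x y g \<le> 16 / \<delta>\<^sup>2 * geo_pos z w g"
proof -
  define R where "R = geo_pos x y g"
  have Rpos: "R > 0" "1 / R \<le> \<delta> / 8"
  proof -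
    show "R > 0" using R \<open>\<delta> > 0\<close> unfolding R_def by (intro less_le_trans[OF _ R]) simp
    then show "1 / R \<le> \<delta> / 8" using R \<open>\<delta> > 0\<close> unfolding R_def[symmetric] by (simp add: field_simps)
  qed
  obtain z where z: "norm z = 1" "g z = z" "norm (z - x) \<le> 1 / R"
    using attracting_fixed_point[OF g xy \<open>\<delta> > 0\<close> d(1,3,4) R] R_def by blast
  have "geo_pos (finv g y) (finv g x) (finv g) = R"
    using geo_pos_finv[OF g xy] geo_pos_swap[of "finv g y" "finv g x" "finv g"] Rpos by (simp add: R_def)
  then obtain w where w: "norm w = 1" "finv g w = w" "norm (w - finv g y) \<le> 1 / R"
    using attracting_fixed_point[OF finv_in[OF g], of "finv g y" "finv g x" \<delta>] g xy d R \<open>\<delta> > 0\<close>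
    by (auto simp: norm_minus_commute R_def)
  have gw: "g w = w" using w(2) g by (metis finv_f(2))
  have wy: "norm (w - y) \<le> \<delta> / 4"
    using norm_triangle_ineq[of "w - finv g y" "finv g y - y"] order_trans[OF w(3) Rpos(2)] d(4)
    by (simp add: norm_minus_commute)
  have fz: "finv g z = z" using z(2) g by (metis finv_f(1))
  define a b where "a = sqrt_deriv g x * sqrt_deriv g w" and "b = sqrt_deriv g y * sqrt_deriv g z"
  have J: "sqrt_deriv g x > 0" "sqrt_deriv g y > 0" "sqrt_deriv g z > 0" "sqrt_deriv g w > 0"
    using deriv_pos[OF g] xy z(1) w(1) by auto
  have ab: "a > 0" "b > 0" using J by (auto simp: a_def b_def)
  have e: "norm (x - w) = norm (finv g x - w) * a" "norm (y - z) = norm (finv g y - z) * b"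
    using norm_diff_finv[OF g, of x w] norm_diff_finv[OF g, of y z] xy z w fz
    by (simp_all add: a_def b_def mult_ac)
  have lower: "norm (x - w) \<ge> \<delta> / 2" "norm (y - z) \<ge> \<delta> / 2"
      "norm (finv g x - w) \<ge> \<delta> / 2" "norm (finv g y - z) \<ge> \<delta> / 2"
    using norm_triangle_ineq[of "x - w" "w - y"] norm_triangle_ineq[of "x - z" "z - y"]
      norm_triangle_ineq[of "finv g x - w" "w - finv g y"]
      norm_triangle_ineq[of "x - z" "z - finv g y"] norm_triangle_ineq[of "x - finv g y" "finv g y - y"]
      wy order_trans[OF w(3) Rpos(2)] order_trans[OF z(3) Rpos(2)] d \<open>\<delta> > 0\<close>
    by (simp_all add: norm_minus_commute)
  have upper: "norm (x - w) \<le> 2" "norm (y - z) \<le> 2" "norm (finv g x - w) \<le> 2" "norm (finv g y - z) \<le> 2"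
    using norm_triangle_ineq4[of x w] norm_triangle_ineq4[of y z] norm_triangle_ineq4[of "finv g x" w]
      norm_triangle_ineq4[of "finv g y" z] xy z(1) w(1) g by simp_all
  have bound: "\<delta> / 4 \<le> c \<and> c \<le> 4 / \<delta>"
    if "s = t * c" "s \<le> 2" "\<delta> / 2 \<le> s" "t \<le> 2" "\<delta> / 2 \<le> t" "c > 0" for s t c :: real
  proof -
    have "\<delta> / 2 \<le> 2 * c" using that mult_right_mono[of t 2 c] by linarith
    moreover have "\<delta> / 2 * c \<le> 2" using that mult_right_mono[of "\<delta> / 2" t c] by linarith
    ultimately show ?thesis using \<open>\<delta> > 0\<close> by (simp add: field_simps)
  qed
  have A: "\<delta> / 4 \<le> a \<and> a \<le> 4 / \<delta>" using bound[OF e(1)] lower upper ab by blast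
  have B: "\<delta> / 4 \<le> b \<and> b \<le> 4 / \<delta>" using bound[OF e(2)] lower upper ab by blast
  have q: "geo_pos z w g * b = R * a"
    using J by (simp add: geo_pos_def R_def a_def b_def)
  have lpos: "geo_pos z w g > 0" using geo_pos_pos g z w by blast
  have "geo_pos z w g * (\<delta> / 4) \<le> R * (4 / \<delta>)"
    using q A B lpos Rpos mult_left_mono[of "\<delta> / 4" b "geo_pos z w g"] mult_left_mono[of a "4 / \<delta>" R] by linarith
  moreover have "R * (\<delta> / 4) \<le> geo_pos z w g * (4 / \<delta>)"
    using q A B lpos Rpos mult_left_mono[of "\<delta> / 4" a R] mult_left_mono[of b "4 / \<delta>" "geo_pos z w g"] by linarith
  ultimately have "geo_pos z w g \<le> 16 / \<delta>\<^sup>2 * R" "R \<le> 16 / \<delta>\<^sup>2 * geo_pos z w g"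
    using \<open>\<delta> > 0\<close> by (simp_all add: field_simps power2_eq_square)
  then show ?thesis
    using that z w gw wy by (simp add: R_def)
qed

text \<open>Seen from \<open>f\<close>, the discrepancy of the attracting ends is of order position
  / \<open>R\<close> and that of the repelling ends of order 1 / position, so both are small for
  positions far above 1 and far below \<open>R\<close>. Each bound is given for positions on either
  geodesic, because elements are transferred in both directions.\<close>

lemma shadowing:
  assumes f: "f \<in> \<Gamma>" and n: "norm x = 1" "norm y = 1" "norm z = 1" "norm w = 1"
    and "\<delta> > 0" "R > 0"
    and d: "\<delta> \<le> norm (x - y)" "norm (z - x) \<le> 1 / R" "1 / R \<le> \<delta> / 8" "norm (w - y) \<le> \<delta> / 4"
  shows "norm (finv f x - finv f z) \<le> 4 / \<delta> * geo_pos x y f / R"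
    "norm (finv f x - finv f z) \<le> 4 / \<delta> * geo_pos z w f / R"
    "norm (finv f y - finv f w) \<le> 4 / \<delta> / geo_pos x y f"
    "norm (finv f y - finv f w) \<le> 4 / \<delta> / geo_pos z w f"
    "\<delta> / 2 \<le> norm (finv f x - finv f w) \<Longrightarrow> \<delta> / 2 \<le> norm (finv f y - finv f z) \<Longrightarrow>
       geo_pos z w f \<le> 16 / \<delta>\<^sup>2 * geo_pos x y f \<and> geo_pos x y f \<le> 16 / \<delta>\<^sup>2 * geo_pos z w f"
proof -
  have fn: "norm (finv f v) = 1" if "norm v = 1" for v using that f by simp
  have two: "norm (u - v) \<le> 2" if "norm u = 1" "norm v = 1" for u v :: complex
    using norm_triangle_ineq4[of u v] that by simp
  have lower: "norm (y - z) \<ge> \<delta> / 2" "norm (x - w) \<ge> \<delta> / 2"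
    using norm_triangle_ineq[of "x - w" "w - y"] norm_triangle_ineq[of "x - z" "z - y"]
      d(1,4) order_trans[OF d(2,3)] \<open>\<delta> > 0\<close> by (simp_all add: norm_minus_commute)
  have s: "geo_pos x y f > 0" "geo_pos z w f > 0" using geo_pos_pos f n by auto
  have main: "A \<le> 4 / \<delta> * (S * E)"
    if "A * B = S * E * C" "A \<ge> 0" "\<delta> / 2 \<le> B" "C \<le> 2" "S * E \<ge> 0" for A B C S E :: real
  proof -
    have "A * (\<delta> / 2) \<le> A * B" using that by (intro mult_left_mono) auto
    also have "\<dots> \<le> S * E * 2" unfolding that(1) using that by (intro mult_left_mono) auto
    finally show ?thesis using \<open>\<delta> > 0\<close> by (simp add: field_simps)
  qed
  have xz: "norm (x - z) \<le> 1 / R" using d by (simp add: norm_minus_commute)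
  have yw: "norm (y - w) \<le> 1" using d two[of x y] n by (simp add: norm_minus_commute)
  have "norm (finv f x - finv f z) \<le> 4 / \<delta> * (geo_pos x y f * norm (x - z))"
    using main[OF three_point[OF f n(1,3,2)]] lower two fn n s by auto
  also have "\<dots> \<le> 4 / \<delta> * (geo_pos x y f * (1 / R))"
    using xz s \<open>\<delta> > 0\<close> by (intro mult_left_mono) auto
  finally show "norm (finv f x - finv f z) \<le> 4 / \<delta> * geo_pos x y f / R" by simp
  have "norm (finv f z - finv f x) \<le> 4 / \<delta> * (geo_pos z w f * norm (z - x))"
    using main[OF three_point[OF f n(3,1,4)]] lower two fn n s by (auto simp: norm_minus_commute)
  also have "\<dots> \<le> 4 / \<delta> * (geo_pos z w f * (1 / R))"
    using d s \<open>\<delta> > 0\<close> by (intro mult_left_mono) auto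
  finally show "norm (finv f x - finv f z) \<le> 4 / \<delta> * geo_pos z w f / R"
    by (simp add: norm_minus_commute)
  have s': "geo_pos y x f > 0" "geo_pos w z f > 0" using geo_pos_pos f n by auto
  have "norm (finv f y - finv f w) \<le> 4 / \<delta> * (geo_pos y x f * norm (y - w))"
    using main[OF three_point[OF f n(2,4,1)]] lower two fn n s' by auto
  also have "\<dots> \<le> 4 / \<delta> * (geo_pos y x f * 1)"
    using yw s' \<open>\<delta> > 0\<close> by (intro mult_left_mono) auto
  finally show "norm (finv f y - finv f w) \<le> 4 / \<delta> / geo_pos x y f"
    using geo_pos_swap[of y x f] by simp
  have "norm (finv f w - finv f y) \<le> 4 / \<delta> * (geo_pos w z f * norm (w - y))"
    using main[OF three_point[OF f n(4,2,3)]] lower two fn n s' by (auto simp: norm_minus_commute)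
  also have "\<dots> \<le> 4 / \<delta> * (geo_pos w z f * 1)"
    using yw s' \<open>\<delta> > 0\<close> by (intro mult_left_mono) (auto simp: norm_minus_commute)
  finally show "norm (finv f y - finv f w) \<le> 4 / \<delta> / geo_pos z w f"
    using geo_pos_swap[of w z f] by (simp add: norm_minus_commute)
  assume l: "\<delta> / 2 \<le> norm (finv f x - finv f w)" "\<delta> / 2 \<le> norm (finv f y - finv f z)"
  define a b where "a = sqrt_deriv f x * sqrt_deriv f w" and "b = sqrt_deriv f y * sqrt_deriv f z"
  have J: "sqrt_deriv f x > 0" "sqrt_deriv f y > 0" "sqrt_deriv f z > 0" "sqrt_deriv f w > 0"
    using deriv_pos[OF f] n by auto
  have ab: "a > 0" "b > 0" using J by (auto simp: a_def b_def)
  have e: "norm (x - w) = norm (finv f x - finv f w) * a" "norm (y - z) = norm (finv f y - finv f z) * b"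
    using norm_diff_finv[OF f, of x w] norm_diff_finv[OF f, of y z] n
    by (simp_all add: a_def b_def mult_ac)
  have bound: "\<delta> / 4 \<le> c \<and> c \<le> 4 / \<delta>"
    if "s = t * c" "s \<le> 2" "\<delta> / 2 \<le> s" "t \<le> 2" "\<delta> / 2 \<le> t" "c > 0" for s t c :: real
  proof -
    have "\<delta> / 2 \<le> 2 * c" using that mult_right_mono[of t 2 c] by linarith
    moreover have "\<delta> / 2 * c \<le> 2" using that mult_right_mono[of "\<delta> / 2" t c] by linarith
    ultimately show ?thesis using \<open>\<delta> > 0\<close> by (simp add: field_simps)
  qed
  have A: "\<delta> / 4 \<le> a \<and> a \<le> 4 / \<delta>" using bound[OF e(1)] lower l two fn n ab by blast
  have B: "\<delta> / 4 \<le> b \<and> b \<le> 4 / \<delta>" using bound[OF e(2)] lower l two fn n ab by blast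
  have q: "geo_pos z w f * b = geo_pos x y f * a"
    using J by (simp add: geo_pos_def a_def b_def)
  have "geo_pos z w f * (\<delta> / 4) \<le> geo_pos x y f * (4 / \<delta>)"
    using q A B s mult_left_mono[of "\<delta> / 4" b "geo_pos z w f"] mult_left_mono[of a "4 / \<delta>" "geo_pos x y f"] by linarith
  moreover have "geo_pos x y f * (\<delta> / 4) \<le> geo_pos z w f * (4 / \<delta>)"
    using q A B s mult_left_mono[of "\<delta> / 4" a "geo_pos x y f"] mult_left_mono[of b "4 / \<delta>" "geo_pos z w f"] by linarith
  ultimately show "geo_pos z w f \<le> 16 / \<delta>\<^sup>2 * geo_pos x y f \<and> geo_pos x y f \<le> 16 / \<delta>\<^sup>2 * geo_pos z w f"
    using \<open>\<delta> > 0\<close> by (simp_all add: field_simps power2_eq_square)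
qed

end

section \<open>Ranking with ties, and finitely many types of pairs of ends\<close>

lemma finite_obtain_min:
  fixes p :: "'b \<Rightarrow> real"
  assumes "finite D" "D \<noteq> {}"
  obtains h where "h \<in> D" "\<And>k. k \<in> D \<Longrightarrow> p h \<le> p k"
proof -
  have "Min (p ` D) \<in> p ` D" using assms by (intro Min_in) auto
  then obtain h where h: "Min (p ` D) = p h" "h \<in> D" by (rule imageE)
  have "p h \<le> p k" if "k \<in> D" for k
    using Min_le[of "p ` D" "p k"] assms(1) that h(1) by simp
  then show ?thesis using that h(2) by blast
qed

lemma finite_obtain_max:
  fixes p :: "'b \<Rightarrow> real"
  assumes "finite D" "D \<noteq> {}"
  obtains h where "h \<in> D" "\<And>k. k \<in> D \<Longrightarrow> p k \<le> p h"
  by (rule finite_obtain_min[OF assms, of "\<lambda>k. - p k"]) auto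

text \<open>If at most \<open>N\<close> elements had rank at most \<open>N\<close>, a lowest one of
  the others would have all its predecessors among them and hence rank at most \<open>N\<close> too.
  For the upper bound, a highest element of the set has at most \<open>N\<close> elements below it
  and at most \<open>M\<close> tied with it.\<close>

lemma card_rank_le:
  fixes p :: "'b \<Rightarrow> real"
  assumes fin: "\<And>b. finite {h \<in> U. p h \<le> b}" and unbounded: "\<And>b. \<exists>h\<in>U. b < p h"
    and ties: "\<And>c. card {h \<in> U. p h = c} \<le> M"
  shows "finite {h \<in> U. card {k \<in> U. p k < p h} \<le> N}" (is "finite ?A")
    and "N + 1 \<le> card {h \<in> U. card {k \<in> U. p k < p h} \<le> N}"
    and "card {h \<in> U. card {k \<in> U. p k < p h} \<le> N} \<le> N + M"
proof -
  have finl: "finite {k \<in> U. p k < b}" for b by (rule finite_subset[OF _ fin[of b]]) auto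
  have inf: "infinite U"
  proof
    assume f: "finite U"
    obtain h where "h \<in> U" "Max (p ` U) < p h" using unbounded by blast
    then show False using f by (metis Max_ge finite_imageI image_eqI not_less)
  qed
  show finA: "finite ?A"
  proof -
    obtain T where T: "T \<subseteq> U" "finite T" "card T = N + 1"
      using infinite_arbitrarily_large[OF inf] by blast
    define b where "b = Max (p ` T)"
    have "T \<noteq> {}" using T(3) by auto
    have "p h \<le> b" if "h \<in> ?A" for h
    proof (rule ccontr)
      assume "\<not> p h \<le> b"
      moreover have "p t \<le> b" if "t \<in> T" for t using T(2) that by (simp add: b_def)
      ultimately have "T \<subseteq> {k \<in> U. p k < p h}" using T(1) by force
      then have "N + 1 \<le> card {k \<in> U. p k < p h}" using card_mono[OF finl, of T] T(3) by simp
      then show False using that by simp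
    qed
    then show ?thesis by (intro finite_subset[OF _ fin[of b]]) auto
  qed
  show "N + 1 \<le> card ?A"
  proof (rule ccontr)
    assume "\<not> N + 1 \<le> card ?A"
    then have cA: "card ?A \<le> N" by simp
    obtain h1 where h1: "h1 \<in> U" "h1 \<notin> ?A"
      using infinite_imp_nonempty[OF Diff_infinite_finite[OF finA inf]] by blast
    define D where "D = {k \<in> U. k \<notin> ?A \<and> p k \<le> p h1}"
    have "finite D" unfolding D_def by (rule finite_subset[OF _ fin[of "p h1"]]) blast
    have "D \<noteq> {}" using h1 unfolding D_def by blast
    obtain h where h: "h \<in> D" "\<And>k. k \<in> D \<Longrightarrow> p h \<le> p k"
      using finite_obtain_min[OF \<open>finite D\<close> \<open>D \<noteq> {}\<close>, of p] by metis
    have hD: "h \<in> U" "h \<notin> ?A" "p h \<le> p h1" using h(1) unfolding D_def by blast+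
    have "{k \<in> U. p k < p h} \<subseteq> ?A"
    proof (rule subsetI, rule ccontr)
      fix k assume k: "k \<in> {k \<in> U. p k < p h}" "k \<notin> ?A"
      then have "k \<in> U" "p k < p h" by auto
      moreover from this have "k \<in> D" unfolding D_def using k(2) hD(3) by force
      ultimately show False using h(2)[of k] by linarith
    qed
    then have "card {k \<in> U. p k < p h} \<le> N" using card_mono[OF finA, of "{k \<in> U. p k < p h}"] cA by linarith
    then show False using hD by blast
  qed
  show "card ?A \<le> N + M"
  proof (cases "?A = {}")
    case False
    obtain h where h: "h \<in> ?A" "\<And>k. k \<in> ?A \<Longrightarrow> p k \<le> p h"
      using finite_obtain_max[OF finA False, of p] by blast
    have sub: "?A \<subseteq> {k \<in> U. p k < p h} \<union> {k \<in> U. p k = p h}" using h(2) by force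
    have "finite {k \<in> U. p k = p h}" by (rule finite_subset[OF _ fin[of "p h"]]) auto
    then have "card ?A \<le> card ({k \<in> U. p k < p h} \<union> {k \<in> U. p k = p h})"
      using sub finl by (intro card_mono) auto
    also have "\<dots> \<le> card {k \<in> U. p k < p h} + card {k \<in> U. p k = p h}" by (rule card_Un_le)
    also have "\<dots> \<le> N + M" using h(1) ties[of "p h"] by (intro add_mono) auto
    finally show ?thesis .
  next
    case True
    then show ?thesis by (metis card.empty le0)
  qed
qed

text \<open>The type of a pair records the squares of a grid of mesh \<delta> / 2 in which the two
  points lie; points of the circle meet only finitely many squares.\<close>

lemma finite_types:
  fixes \<delta> :: real
  assumes "\<delta> > 0"
  obtains t :: "complex \<times> complex \<Rightarrow> (int \<times> int) \<times> (int \<times> int)" and T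
  where "finite T" "\<And>x y. norm x = 1 \<Longrightarrow> norm y = 1 \<Longrightarrow> t (x, y) \<in> T"
    "\<And>x y z w. t (x, y) = t (z, w) \<Longrightarrow> norm (x - z) \<le> \<delta> \<and> norm (y - w) \<le> \<delta>"
proof -
  define m where "m = 2 / \<delta>"
  have m: "m > 0" using assms by (simp add: m_def)
  define c where "c x = (\<lfloor>m * Re x\<rfloor>, \<lfloor>m * Im x\<rfloor>)" for x
  define k where "k = \<lceil>m\<rceil> + 1"
  have c1: "c x \<in> {-k..k} \<times> {-k..k}" if "norm x = 1" for x
  proof -
    have *: "- k \<le> \<lfloor>m * v\<rfloor> \<and> \<lfloor>m * v\<rfloor> \<le> k" if "\<bar>v\<bar> \<le> 1" for v
    proof -
      have "\<bar>m * v\<bar> \<le> m" using that m by (simp add: abs_mult mult_left_le)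
      then have "- m \<le> m * v" "m * v \<le> m" by auto
      then show ?thesis unfolding k_def by linarith
    qed
    show ?thesis using *[of "Re x"] *[of "Im x"] abs_Re_le_cmod[of x] abs_Im_le_cmod[of x] that
      by (simp add: c_def)
  qed
  have c2: "norm (x - z) \<le> \<delta>" if "c x = c z" for x z
  proof -
    have *: "\<bar>u - v\<bar> \<le> \<delta> / 2" if "\<lfloor>m * u\<rfloor> = \<lfloor>m * v\<rfloor>" for u v
    proof -
      have "\<bar>m * u - m * v\<bar> \<le> 1" using that by linarith
      then have "m * \<bar>u - v\<bar> \<le> 1" using m by (metis abs_mult abs_of_pos right_diff_distrib)
      then show ?thesis using assms by (simp add: m_def field_simps)
    qed
    have "\<bar>Re (x - z)\<bar> \<le> \<delta> / 2" "\<bar>Im (x - z)\<bar> \<le> \<delta> / 2"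
      using that *[of "Re x" "Re z"] *[of "Im x" "Im z"] by (auto simp: c_def)
    then show ?thesis using cmod_le[of "x - z"] by linarith
  qed
  show ?thesis
  proof (rule that[of "({-k..k} \<times> {-k..k}) \<times> ({-k..k} \<times> {-k..k})" "\<lambda>(x, y). (c x, c y)"])
    show "finite (({-k..k} \<times> {-k..k}) \<times> ({-k..k} \<times> {-k..k}))" by simp
  qed (use c1 c2 in auto)
qed

section \<open>Windows of group elements along a geodesic\<close>

context fuchsian_group begin

text \<open>A point \<open>z\<close> on the radius towards \<open>x\<close>, close to
  \<open>x\<close>, serves as a point near the geodesic and far out on it. Cocompactness provides an
  \<open>f\<close> that brings \<open>z\<close> back to a fixed disc, and the element sought is
  \<open>finv f\<close>.\<close>

lemma unbounded_positions:
  obtains \<delta> where "\<delta> > 0"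
    "\<And>x y T. norm x = 1 \<Longrightarrow> norm y = 1 \<Longrightarrow> x \<noteq> y \<Longrightarrow> \<exists>f\<in>near \<delta> x y. T < geo_pos x y f"
proof -
  obtain r where r: "r < 1" "\<And>z. norm z < 1 \<Longrightarrow> \<exists>f\<in>\<Gamma>. norm (f z) \<le> r" using cocompact by blast
  \<comment> \<open>With \<open>a\<close>, \<open>b\<close>, \<open>c\<close> the derivatives at
    \<open>x\<close>, \<open>y\<close>, \<open>z\<close>, the distance formulas give (1 - r)^2 * a *
    b <= 2 * |x - y|, and |x - y| = |f x - f y| * a * b.\<close>
  define \<delta> where "\<delta> = (1 - r)\<^sup>2 / 2"
  have "\<delta> > 0" using r by (simp add: \<delta>_def)
  have main: "\<exists>f\<in>near \<delta> x y. T < geo_pos x y f"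
    if n: "norm x = 1" "norm y = 1" "x \<noteq> y" for x y T
  proof -
    define D where "D = norm (x - y)"
    have D: "D > 0" "D \<le> 2" using n norm_triangle_ineq4[of x y] by (auto simp: D_def)
    \<comment> \<open>The first bound keeps \<open>z\<close> away from \<open>y\<close>, with |y -
      z| at least \<open>D / 2\<close>; the second forces the quotient \<open>b / a\<close> of the
      derivatives at \<open>y\<close> and \<open>x\<close> to be at least 2 * (|T| + 1).\<close>
    define e where "e = min (D / 2) ((1 - r) * D / (8 * (\<bar>T\<bar> + 1)))"
    have e: "e > 0" "e \<le> D / 2" "e \<le> (1 - r) * D / (8 * (\<bar>T\<bar> + 1))"
    proof -
      show "e > 0" using D r by (simp add: e_def)
    qed (unfold e_def, rule min.cobounded1, rule min.cobounded2)
    then have "e \<le> 1" using D by simp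
    define z where "z = complex_of_real (1 - e) * x"
    have nz: "norm z = 1 - e" using \<open>e \<le> 1\<close> n
      by (simp add: z_def norm_mult del: of_real_diff)
    then obtain f where f: "f \<in> \<Gamma>" "norm (f z) \<le> r" using r(2)[of z] e by auto
    define k where "k = finv f"
    have k: "k \<in> \<Gamma>" "finv k = f" using f by (simp_all add: k_def finv_in)
    have kf: "k (f u) = u" for u using f by (simp add: k_def)
    define a b c where "a = sqrt_deriv k x" and "b = sqrt_deriv k y" and "c = sqrt_deriv k z"
    have abc: "a > 0" "b > 0" "c > 0"
      using deriv_pos[OF k(1)] n nz e by (auto simp: a_def b_def c_def)
    have fz: "norm (f z) < 1" using f(2) r(1) by (rule le_less_trans)
    have lo: "1 - r \<le> norm (1 - cnj (f z) * f u) \<and> norm (1 - cnj (f z) * f u) \<le> 2" if "norm u = 1" for u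
    proof -
      have "norm (cnj (f z) * f u) \<le> r" using f that by (simp add: norm_mult)
      then show ?thesis
        using norm_triangle_ineq2[of 1 "cnj (f z) * f u"] norm_triangle_ineq4[of 1 "cnj (f z) * f u"] r by simp
    qed
    have fx: "norm (f x) \<le> 1" "norm (f y) \<le> 1" "norm (f z) \<le> 1" using f n fz by simp_all
    note eq = disc_aut_diff_norms(2)[OF aut[OF k(1)] fx(3), unfolded kf, folded c_def]
    have xz: "norm (x - z) = e"
    proof -
      have "x - z = complex_of_real e * x" by (simp add: z_def algebra_simps)
      then show ?thesis using e n by (simp add: norm_mult)
    qed
    have ex: "e = norm (1 - cnj (f z) * f x) * c * a"
      using eq[OF fx(1)] unfolding norm_unit_diff_cnj[OF n(1)] kf xz a_def .
    have ey: "norm (y - z) = norm (1 - cnj (f z) * f y) * c * b"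
      using eq[OF fx(2)] unfolding norm_unit_diff_cnj[OF n(2)] kf b_def .
    have ez: "1 - (1 - e)\<^sup>2 = (1 - (norm (f z))\<^sup>2) * c * c"
    proof -
      have "norm z < 1" using nz e by simp
      then show ?thesis
        using eq[OF fx(3)] unfolding kf c_def[symmetric] norm_one_minus_cnj_self[OF fz] by (simp only: norm_one_minus_cnj_self nz)
    qed
    have yz: "D - e \<le> norm (y - z)" "norm (y - z) \<le> D + e"
      using norm_triangle_ineq[of "x - z" "z - y"] norm_triangle_ineq[of "y - x" "x - z"] xz
      by (simp_all add: D_def norm_minus_commute)
    have Dab: "D = norm (f x - f y) * a * b"
      using norm_diff_finv[OF k(1), of x y] n k by (simp add: D_def a_def b_def)
    have 1: "e \<le> 2 * (c * a)" "(1 - r) * (c * a) \<le> e" "(1 - r) * (c * b) \<le> norm (y - z)" "norm (y - z) \<le> 2 * (c * b)"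
      unfolding ex ey using lo[OF n(1)] lo[OF n(2)] abc by (auto simp: mult.assoc intro!: mult_right_mono)
    have geo: "T < geo_pos x y k"
    proof -
      have "D / 2 \<le> 2 * (c * b)" using 1(4) yz e by linarith
      moreover have "c * a * (8 * (\<bar>T\<bar> + 1)) \<le> D"
      proof -
        have "(1 - r) * (c * a) * (8 * (\<bar>T\<bar> + 1)) \<le> e * (8 * (\<bar>T\<bar> + 1))"
          using 1(2) by (intro mult_right_mono) auto
        also have "\<dots> \<le> (1 - r) * D" using e(3) by (simp add: field_simps)
        finally show ?thesis using r by (simp add: mult.assoc)
      qed
      ultimately have "c * a * (8 * (\<bar>T\<bar> + 1)) \<le> 4 * (c * b)" by linarith
      then have "c * (a * (2 * (\<bar>T\<bar> + 1))) \<le> c * b" by (simp add: algebra_simps)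
      then have "a * (2 * (\<bar>T\<bar> + 1)) \<le> b" using abc by simp
      moreover have "a * T < a * (2 * (\<bar>T\<bar> + 1))" using abc by (intro mult_strict_left_mono) auto
      ultimately have "a * T < b" by linarith
      then show ?thesis using abc by (simp add: geo_pos_def a_def[symmetric] b_def[symmetric] field_simps)
    qed
    have near: "\<delta> \<le> norm (f x - f y)"
    proof -
      have cc: "e \<le> c * c"
      proof -
        have "(1 - (norm (f z))\<^sup>2) * (c * c) \<le> 1 * (c * c)" by (intro mult_right_mono) auto
        moreover have "e * e \<le> e * 1" using e \<open>e \<le> 1\<close> by (intro mult_left_mono) auto
        ultimately show ?thesis using ez by (simp add: power2_eq_square algebra_simps)
      qed
      have "(1 - r) * (c * a) * ((1 - r) * (c * b)) \<le> e * norm (y - z)"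
        using 1 r abc e by (intro mult_mono) auto
      also have "\<dots> \<le> e * (2 * D)" using yz e by (intro mult_left_mono) auto
      also have "\<dots> \<le> c * c * (2 * D)" using cc D by (intro mult_right_mono) auto
      finally have "(c * c) * ((1 - r)\<^sup>2 * (a * b)) \<le> (c * c) * (2 * D)"
        by (simp add: power2_eq_square algebra_simps)
      then have "(1 - r)\<^sup>2 * (a * b) \<le> 2 * norm (f x - f y) * (a * b)"
        using abc Dab by (simp add: mult.assoc)
      then show ?thesis using abc by (simp add: \<delta>_def)
    qed
    show ?thesis using geo near k by (auto simp: near_def)
  qed
  show ?thesis using that[OF \<open>\<delta> > 0\<close> main] .
qed

text \<open>Ties in position are harmless because their number is bounded.\<close>

definition gap :: "real \<Rightarrow> complex \<Rightarrow> complex \<Rightarrow> (complex \<Rightarrow> complex) \<Rightarrow> (complex \<Rightarrow> complex) \<Rightarrow> nat" where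
  "gap \<delta> x y f h = card {k \<in> near \<delta> x y.
     geo_pos x y f < geo_pos x y k \<and> geo_pos x y k < geo_pos x y h \<or>
     geo_pos x y h < geo_pos x y k \<and> geo_pos x y k < geo_pos x y f}"

text \<open>The window is centred at the identity; one around another element is a translate, by
  \<open>gap_comp\<close>. Since \<open>gap\<close> uses strict inequalities, elements tied in
  position enter a window together.\<close>

definition window :: "real \<Rightarrow> nat \<Rightarrow> complex \<Rightarrow> complex \<Rightarrow> (complex \<Rightarrow> complex) set" where
  "window \<delta> N x y = {h \<in> near \<delta> x y. gap \<delta> x y id h \<le> N}"

lemma gap_commute: "gap \<delta> x y f h = gap \<delta> x y h f"
  by (simp add: gap_def disj_commute)

lemma gap_eq_0:
  assumes "geo_pos x y f = geo_pos x y h"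
  shows "gap \<delta> x y f h = 0"
proof -
  have "{k \<in> near \<delta> x y. geo_pos x y f < geo_pos x y k \<and> geo_pos x y k < geo_pos x y h \<or>
     geo_pos x y h < geo_pos x y k \<and> geo_pos x y k < geo_pos x y f} = {}"
    using assms by auto
  then show ?thesis unfolding gap_def by (metis card.empty)
qed

lemma gap_swap:
  assumes "norm x = 1" "norm y = 1" "f \<in> \<Gamma>" "h \<in> \<Gamma>"
  shows "gap \<delta> y x f h = gap \<delta> x y f h"
proof -
  have *: "geo_pos y x u < geo_pos y x v \<longleftrightarrow> geo_pos x y v < geo_pos x y u" if "u \<in> \<Gamma>" "v \<in> \<Gamma>" for u v
    using geo_pos_pos[OF that(1) assms(1,2)] geo_pos_pos[OF that(2) assms(1,2)]
    by (simp add: geo_pos_swap[of y x] field_simps)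
  have "{k \<in> near \<delta> y x. geo_pos y x f < geo_pos y x k \<and> geo_pos y x k < geo_pos y x h \<or>
     geo_pos y x h < geo_pos y x k \<and> geo_pos y x k < geo_pos y x f}
   = {k \<in> near \<delta> x y. geo_pos x y f < geo_pos x y k \<and> geo_pos x y k < geo_pos x y h \<or>
     geo_pos x y h < geo_pos x y k \<and> geo_pos x y k < geo_pos x y f}"
    using assms * by (auto simp: near_swap[of \<delta> y x]) (auto simp: near_def)
  then show ?thesis by (simp add: gap_def)
qed

lemma near_image:
  assumes "h \<in> \<Gamma>"
  shows "near \<delta> (h x) (h y) = (\<lambda>f. h \<circ> f) ` near \<delta> x y"
proof (intro equalityI subsetI)
  fix k assume k: "k \<in> near \<delta> (h x) (h y)"
  then have kG: "k \<in> \<Gamma>" by (simp add: near_def)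
  have "finv h \<circ> k \<in> near \<delta> x y"
    using near_comp[of "finv h \<circ> k" h \<delta> x y] k assms kG by (simp add: comp_in finv_in)
  then show "k \<in> (\<lambda>f. h \<circ> f) ` near \<delta> x y"
    using assms by (intro image_eqI[of _ _ "finv h \<circ> k"]) auto
next
  fix k assume "k \<in> (\<lambda>f. h \<circ> f) ` near \<delta> x y"
  then obtain f where f: "f \<in> near \<delta> x y" "k = h \<circ> f" by blast
  then have "f \<in> \<Gamma>" by (simp add: near_def)
  then show "k \<in> near \<delta> (h x) (h y)" using near_comp assms f by blast
qed

lemma inj_comp_left: "h \<in> \<Gamma> \<Longrightarrow> inj_on (\<lambda>f. h \<circ> f) A"
  by (rule inj_on_inverseI[of _ "\<lambda>k. finv h \<circ> k"]) simp

text \<open>Holds because translation multiplies all positions by the same positive factor. It moves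
  the centre of a window: the gap from the identity to \<open>f\<close> on a translated geodesic
  becomes the gap from \<open>finv f\<close> to the identity on the original one.\<close>

lemma gap_comp:
  assumes "norm x = 1" "norm y = 1" "f \<in> \<Gamma>" "h \<in> \<Gamma>" "g \<in> \<Gamma>"
  shows "gap \<delta> (g x) (g y) (g \<circ> f) (g \<circ> h) = gap \<delta> x y f h"
proof -
  have c: "geo_pos (g x) (g y) g > 0" using geo_pos_pos assms by simp
  have *: "geo_pos (g x) (g y) (g \<circ> u) < geo_pos (g x) (g y) (g \<circ> v) \<longleftrightarrow> geo_pos x y u < geo_pos x y v"
    if "u \<in> \<Gamma>" "v \<in> \<Gamma>" for u v
    using geo_pos_comp[OF that(1) assms(5,1,2)] geo_pos_comp[OF that(2) assms(5,1,2)] c by simp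
  let ?S = "{k \<in> near \<delta> x y. geo_pos x y f < geo_pos x y k \<and> geo_pos x y k < geo_pos x y h \<or>
     geo_pos x y h < geo_pos x y k \<and> geo_pos x y k < geo_pos x y f}"
  have "{k \<in> near \<delta> (g x) (g y).
       geo_pos (g x) (g y) (g \<circ> f) < geo_pos (g x) (g y) k \<and> geo_pos (g x) (g y) k < geo_pos (g x) (g y) (g \<circ> h) \<or>
       geo_pos (g x) (g y) (g \<circ> h) < geo_pos (g x) (g y) k \<and> geo_pos (g x) (g y) k < geo_pos (g x) (g y) (g \<circ> f)}
    = (\<lambda>k. g \<circ> k) ` ?S"
    unfolding near_image[OF assms(5)] using * assms(3,4) by (auto simp: near_def)
  then show ?thesis
    unfolding gap_def using card_image[OF inj_comp_left[OF assms(5)], of ?S] by simp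
qed

text \<open>On either side of position 1 the gap from the identity is the rank of
  \<open>card_rank_le\<close>; exchanging the ends reduces the lower side to the upper one. A window
  is an interval of positions because this rank is monotone on each side.\<close>

lemma card_window:
  assumes "\<delta> > 0"
    and unb: "\<And>x y T. norm x = 1 \<Longrightarrow> norm y = 1 \<Longrightarrow> x \<noteq> y \<Longrightarrow> \<exists>f\<in>near \<delta> x y. T < geo_pos x y f"
  obtains M where "\<And>x y N. norm x = 1 \<Longrightarrow> norm y = 1 \<Longrightarrow> \<delta> \<le> norm (x - y) \<Longrightarrow>
      finite (window \<delta> N x y) \<and> 2 * N \<le> card (window \<delta> N x y) \<and> card (window \<delta> N x y) \<le> 2 * N + M"
    "\<And>x y N. norm x = 1 \<Longrightarrow> norm y = 1 \<Longrightarrow> \<delta> \<le> norm (x - y) \<Longrightarrow>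
      \<exists>a b. 0 < a \<and> window \<delta> N x y = {f \<in> near \<delta> x y. a \<le> geo_pos x y f \<and> geo_pos x y f \<le> b}"
proof -
  obtain M :: nat where M: "\<And>x y \<alpha>. norm x = 1 \<Longrightarrow> norm y = 1 \<Longrightarrow> \<alpha> > 0 \<Longrightarrow>
       finite {f \<in> near \<delta> x y. \<alpha> \<le> geo_pos x y f \<and> geo_pos x y f \<le> \<alpha> * 1} \<and>
       card {f \<in> near \<delta> x y. \<alpha> \<le> geo_pos x y f \<and> geo_pos x y f \<le> \<alpha> * 1} \<le> M"
    by (rule card_near_le[OF \<open>\<delta> > 0\<close>, of 1]) auto
  have ties: "finite {f \<in> near \<delta> x y. geo_pos x y f = c} \<and> card {f \<in> near \<delta> x y. geo_pos x y f = c} \<le> M"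
    if "norm x = 1" "norm y = 1" for x y c
  proof (cases "c > 0")
    case True
    have "{f \<in> near \<delta> x y. geo_pos x y f = c} = {f \<in> near \<delta> x y. c \<le> geo_pos x y f \<and> geo_pos x y f \<le> c * 1}"
      by auto
    then show ?thesis using M[OF that True] by metis
  next
    case False
    then have "{f \<in> near \<delta> x y. geo_pos x y f = c} = {}"
      using geo_pos_pos[OF _ that] by (force simp: near_def)
    then show ?thesis by (metis card.empty finite.emptyI le0)
  qed
  have up: "finite {h \<in> near \<delta> x y. 1 < geo_pos x y h \<and> gap \<delta> x y id h \<le> N} \<and>
      N + 1 \<le> card {h \<in> near \<delta> x y. 1 < geo_pos x y h \<and> gap \<delta> x y id h \<le> N} \<and>
      card {h \<in> near \<delta> x y. 1 < geo_pos x y h \<and> gap \<delta> x y id h \<le> N} \<le> N + M"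
    if n: "norm x = 1" "norm y = 1" "\<delta> \<le> norm (x - y)" for x y N
  proof -
    define U where "U = {h \<in> near \<delta> x y. 1 < geo_pos x y h}"
    have eq: "{h \<in> near \<delta> x y. 1 < geo_pos x y h \<and> gap \<delta> x y id h \<le> N}
       = {h \<in> U. card {k \<in> U. geo_pos x y k < geo_pos x y h} \<le> N}"
    proof -
      have "gap \<delta> x y id h = card {k \<in> U. geo_pos x y k < geo_pos x y h}" if "1 < geo_pos x y h" for h
        unfolding gap_def using that by (intro arg_cong[where f = card]) (auto simp: U_def)
      then show ?thesis by (auto simp: U_def)
    qed
    have fin: "finite {h \<in> U. geo_pos x y h \<le> b}" for b
      by (rule finite_subset[OF _ finite_near_between[OF \<open>\<delta> > 0\<close> n(1,2), of 1 b]]) (auto simp: U_def)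
    have unb': "\<exists>h\<in>U. b < geo_pos x y h" for b
    proof -
      have "x \<noteq> y" using n \<open>\<delta> > 0\<close> by auto
      from unb[OF n(1,2) this, of "max 1 b"] show ?thesis by (auto simp: U_def)
    qed
    have t: "card {h \<in> U. geo_pos x y h = c} \<le> M" for c
    proof -
      have "card {h \<in> U. geo_pos x y h = c} \<le> card {f \<in> near \<delta> x y. geo_pos x y f = c}"
        using ties[OF n(1,2)] by (intro card_mono) (auto simp: U_def)
      then show ?thesis using ties[OF n(1,2), of c] by simp
    qed
    show ?thesis unfolding eq using card_rank_le[OF fin unb' t] by blast
  qed
  have down: "finite {h \<in> near \<delta> x y. geo_pos x y h < 1 \<and> gap \<delta> x y id h \<le> N} \<and>
      N + 1 \<le> card {h \<in> near \<delta> x y. geo_pos x y h < 1 \<and> gap \<delta> x y id h \<le> N} \<and>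
      card {h \<in> near \<delta> x y. geo_pos x y h < 1 \<and> gap \<delta> x y id h \<le> N} \<le> N + M"
    if n: "norm x = 1" "norm y = 1" "\<delta> \<le> norm (x - y)" for x y N
  proof -
    have "{h \<in> near \<delta> x y. geo_pos x y h < 1 \<and> gap \<delta> x y id h \<le> N}
      = {h \<in> near \<delta> y x. 1 < geo_pos y x h \<and> gap \<delta> y x id h \<le> N}"
    proof -
      have "geo_pos x y h < 1 \<longleftrightarrow> 1 < geo_pos y x h" "gap \<delta> x y id h = gap \<delta> y x id h" if "h \<in> near \<delta> x y" for h
        using gap_swap[OF n(1,2) id_in, of h \<delta>] geo_pos_pos[OF _ n(1,2), of h] that
        by (auto simp: near_def geo_pos_swap[of y x] field_simps)
      then show ?thesis using near_swap by auto
    qed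
    then show ?thesis using up[of y x N] n by (simp add: norm_minus_commute)
  qed
  have split: "window \<delta> N x y = {h \<in> near \<delta> x y. geo_pos x y h < 1 \<and> gap \<delta> x y id h \<le> N}
     \<union> ({h \<in> near \<delta> x y. 1 < geo_pos x y h \<and> gap \<delta> x y id h \<le> N} \<union> {h \<in> near \<delta> x y. geo_pos x y h = 1})"
    if n: "norm x = 1" "norm y = 1" for x y N
  proof -
    have "gap \<delta> x y id h = 0" if "geo_pos x y h = 1" for h
      using that by (intro gap_eq_0) simp
    then show ?thesis by (auto simp: window_def)
  qed
  \<comment> \<open>Each side holds between N + 1 and N + M elements, and at most M further ones are
    tied with the identity; hence the bound 3 * M.\<close>
  have count: "finite (window \<delta> N x y) \<and> 2 * N \<le> card (window \<delta> N x y) \<and> card (window \<delta> N x y) \<le> 2 * N + 3 * M"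
    if n: "norm x = 1" "norm y = 1" "\<delta> \<le> norm (x - y)" for x y N
  proof -
    let ?A = "{h \<in> near \<delta> x y. geo_pos x y h < 1 \<and> gap \<delta> x y id h \<le> N}"
    let ?B = "{h \<in> near \<delta> x y. 1 < geo_pos x y h \<and> gap \<delta> x y id h \<le> N}"
    let ?C = "{h \<in> near \<delta> x y. geo_pos x y h = 1}"
    have f: "finite ?A" "finite ?B" "finite ?C" using up[OF n] down[OF n] ties[OF n(1,2)] by blast+
    have "card (?A \<union> (?B \<union> ?C)) = card ?A + (card ?B + card ?C)"
    proof -
      have d: "?B \<inter> ?C = {}" "?A \<inter> (?B \<union> ?C) = {}" by auto
      show ?thesis
        using card_Un_disjoint[OF f(2,3) d(1)] card_Un_disjoint[OF f(1) finite_UnI[OF f(2,3)] d(2)] by linarith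
    qed
    moreover have "card ?C \<le> M" using ties[OF n(1,2)] by blast
    moreover have "finite (?A \<union> (?B \<union> ?C))" by (intro finite_UnI f)
    ultimately show ?thesis
      unfolding split[OF n(1,2)] using up[OF n, of N] down[OF n, of N] by linarith
  qed
  have convex: "\<exists>a b. 0 < a \<and> window \<delta> N x y = {f \<in> near \<delta> x y. a \<le> geo_pos x y f \<and> geo_pos x y f \<le> b}"
    if n: "norm x = 1" "norm y = 1" "\<delta> \<le> norm (x - y)" for x y N
  proof -
    define P where "P = geo_pos x y ` window \<delta> N x y"
    have idw: "id \<in> window \<delta> N x y"
    proof -
      have "gap \<delta> x y id id = 0" by (rule gap_eq_0) simp
      then show ?thesis using n id_in by (simp add: window_def near_def)
    qed
    have P: "finite P" "P \<noteq> {}" using count[OF n] idw by (auto simp: P_def)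
    obtain u where u: "u \<in> window \<delta> N x y" "geo_pos x y u = Min P" using Min_in[OF P] by (auto simp: P_def)
    obtain v where v: "v \<in> window \<delta> N x y" "geo_pos x y v = Max P" using Max_in[OF P] by (auto simp: P_def)
    have "1 \<in> P" unfolding P_def using idw by (rule image_eqI[rotated]) simp
    then have one: "Min P \<le> 1" "1 \<le> Max P" using P by auto
    have uG: "u \<in> \<Gamma>" using u by (simp add: window_def near_def)
    have finbt: "finite {k \<in> near \<delta> x y. geo_pos x y u < geo_pos x y k \<and> geo_pos x y k < geo_pos x y v}"
      by (rule finite_subset[OF _ finite_near_between[OF \<open>\<delta> > 0\<close> n(1,2) geo_pos_pos[OF uG n(1,2)], of "geo_pos x y v"]]) auto
    have "f \<in> window \<delta> N x y" if f: "f \<in> near \<delta> x y" "Min P \<le> geo_pos x y f" "geo_pos x y f \<le> Max P" for f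
    proof (cases "geo_pos x y f \<ge> 1")
      case True
      have "gap \<delta> x y id f \<le> gap \<delta> x y id v"
        unfolding gap_def using True f v(2) u(2) one
        by (intro card_mono finite_subset[OF _ finbt]) auto
      then show ?thesis using v f by (simp add: window_def)
    next
      case False
      have "gap \<delta> x y id f \<le> gap \<delta> x y id u"
        unfolding gap_def using False f v(2) u(2) one
        by (intro card_mono finite_subset[OF _ finbt]) auto
      then show ?thesis using u f by (simp add: window_def)
    qed
    moreover have "f \<in> near \<delta> x y \<and> Min P \<le> geo_pos x y f \<and> geo_pos x y f \<le> Max P" if "f \<in> window \<delta> N x y" for f
      using that P by (auto simp: window_def P_def)
    ultimately have "window \<delta> N x y = {f \<in> near \<delta> x y. Min P \<le> geo_pos x y f \<and> geo_pos x y f \<le> Max P}" by blast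
    moreover have "0 < Min P" using geo_pos_pos[OF uG n(1,2)] u(2) by simp
    ultimately show ?thesis by blast
  qed
  show ?thesis by (rule that[OF count convex])
qed

end

text \<open>\<Phi> stands for a test function written on ordered pairs of ends. Its support starts
  at \<open>2 * \<delta>\<close> while nearness is measured by \<delta>: an element with a nonzero
  value on one geodesic is then still \<delta>-near to any geodesic whose pulled back ends differ
  little. \<open>periodic\<close> is nonnegativity of the sum over one period of a closed
  geodesic.\<close>

locale closing_function = fuchsian_group \<Gamma>
  for \<Gamma> :: "(complex \<Rightarrow> complex) set" +
  fixes \<Phi> :: "complex \<Rightarrow> complex \<Rightarrow> real" and \<delta> b :: real
  assumes \<delta>_pos: "\<delta> > 0"
    and unbounded: "norm x = 1 \<Longrightarrow> norm y = 1 \<Longrightarrow> x \<noteq> y \<Longrightarrow> \<exists>f\<in>near \<delta> x y. T < geo_pos x y f"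
    and bounded: "norm x = 1 \<Longrightarrow> norm y = 1 \<Longrightarrow> \<bar>\<Phi> x y\<bar> \<le> b"
    and support: "norm x = 1 \<Longrightarrow> norm y = 1 \<Longrightarrow> norm (x - y) < 2 * \<delta> \<Longrightarrow> \<Phi> x y = 0"
    and uniform: "\<epsilon> > 0 \<Longrightarrow> \<exists>\<theta>>0. \<forall>x y z w. norm x = 1 \<longrightarrow> norm y = 1 \<longrightarrow> norm z = 1 \<longrightarrow> norm w = 1 \<longrightarrow>
        \<delta> \<le> norm (x - y) \<longrightarrow> norm (x - z) \<le> \<theta> \<longrightarrow> norm (y - w) \<le> \<theta> \<longrightarrow> \<bar>\<Phi> x y - \<Phi> z w\<bar> \<le> \<epsilon>"
    and periodic: "g \<in> \<Gamma> \<Longrightarrow> norm x = 1 \<Longrightarrow> norm y = 1 \<Longrightarrow> x \<noteq> y \<Longrightarrow> g x = x \<Longrightarrow> g y = y \<Longrightarrow> 1 < geo_pos x y g \<Longrightarrow>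
        0 \<le> (\<Sum>f\<in>{f \<in> near \<delta> x y. 1 \<le> geo_pos x y f \<and> geo_pos x y f < geo_pos x y g}. \<Phi> (finv f x) (finv f y))"
begin

abbreviation translate :: "complex \<Rightarrow> complex \<Rightarrow> (complex \<Rightarrow> complex) \<Rightarrow> real" where
  "translate x y f \<equiv> \<Phi> (finv f x) (finv f y)"

lemma b_nonneg: "b \<ge> 0"
  using bounded[of 1 1] by simp

lemma translate_bounded: "f \<in> \<Gamma> \<Longrightarrow> norm x = 1 \<Longrightarrow> norm y = 1 \<Longrightarrow> \<bar>translate x y f\<bar> \<le> b"
  by (simp add: bounded)

lemma sum_translate_bounded:
  assumes "norm x = 1" "norm y = 1" "A \<subseteq> \<Gamma>" "card A \<le> M"
  shows "\<bar>sum (translate x y) A\<bar> \<le> real M * b"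
proof -
  have "\<bar>sum (translate x y) A\<bar> \<le> (\<Sum>f\<in>A. \<bar>translate x y f\<bar>)" by (rule sum_abs)
  also have "\<dots> \<le> real (card A) * b"
    using translate_bounded assms by (intro sum_bounded_above) auto
  also have "\<dots> \<le> real M * b" using assms b_nonneg by (intro mult_right_mono) auto
  finally show ?thesis .
qed

text \<open>A long segment that nearly closes up is shadowed by the axis of \<open>g\<close>, with
  ends \<open>z\<close> and \<open>w\<close>. Elements far from both ends of the segment see the two
  geodesics almost alike, so their values differ by at most \<epsilon>, and the sum over a full
  period of the axis is nonnegative. The elements left over lie in four position ranges of bounded
  ratio.\<close>

lemma closing_estimate_id:
  fixes \<epsilon> :: real
  assumes "\<epsilon> > 0"
  obtains C where "C \<ge> 0" "\<And>x y g. g \<in> \<Gamma> \<Longrightarrow> norm x = 1 \<Longrightarrow> norm y = 1 \<Longrightarrow> \<delta> \<le> norm (x - y) \<Longrightarrow>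
    \<delta> \<le> norm (finv g x - finv g y) \<Longrightarrow> norm (x - finv g x) \<le> \<delta> / 8 \<Longrightarrow> norm (y - finv g y) \<le> \<delta> / 8 \<Longrightarrow>
    - \<epsilon> * card {f \<in> near \<delta> x y. 1 \<le> geo_pos x y f \<and> geo_pos x y f < geo_pos x y g} - C
      \<le> sum (translate x y) {f \<in> near \<delta> x y. 1 \<le> geo_pos x y f \<and> geo_pos x y f < geo_pos x y g}"
proof -
  obtain \<theta>0 where \<theta>0: "\<theta>0 > 0" "\<And>x y z w. norm x = 1 \<Longrightarrow> norm y = 1 \<Longrightarrow> norm z = 1 \<Longrightarrow> norm w = 1 \<Longrightarrow>
        \<delta> \<le> norm (x - y) \<Longrightarrow> norm (x - z) \<le> \<theta>0 \<Longrightarrow> norm (y - w) \<le> \<theta>0 \<Longrightarrow> \<bar>\<Phi> x y - \<Phi> z w\<bar> \<le> \<epsilon>"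
    using uniform[OF assms] by metis
  define \<theta> where "\<theta> = min \<theta>0 (\<delta> / 8)"
  have \<theta>: "\<theta> > 0" "\<theta> \<le> \<theta>0" "\<theta> \<le> \<delta> / 8"
  proof -
    show "\<theta> > 0" using \<theta>0(1) \<delta>_pos by (simp add: \<theta>_def)
  qed (unfold \<theta>_def, rule min.cobounded1, rule min.cobounded2)
  \<comment> \<open>Bounds the ratio of the positions of one element on the two geodesics, as in
    \<open>closing_fixed_points\<close> and \<open>shadowing\<close>.\<close>
  define q where "q = max 1 (16 / \<delta>\<^sup>2)"
  have q: "q \<ge> 1" "16 / \<delta>\<^sup>2 \<le> q" by (auto simp: q_def)
  \<comment> \<open>Between positions \<open>B\<close> and \<open>R / B\<close> the shadowing bounds
    are at most \<theta>. Exceeding \<open>q\<close> gives \<open>R / B < R / q \<le> L\<close>,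
    which keeps the middle part within one period of the axis.\<close>
  define B where "B = max (q + 1) (4 / (\<delta> * \<theta>))"
  have B: "B > q" "4 / \<delta> / B \<le> \<theta>"
  proof -
    show "B > q" by (simp add: B_def)
    then have "B > 0" using q by simp
    have "4 / (\<delta> * \<theta>) \<le> B" by (simp add: B_def)
    then show "4 / \<delta> / B \<le> \<theta>" using \<open>B > 0\<close> \<delta>_pos \<theta>(1) by (simp add: field_simps)
  qed
  \<comment> \<open>One factor \<open>q\<close> of slack, spent when positions are converted from
    one geodesic to the other.\<close>
  define B' where "B' = q * B"
  have B': "B \<le> B'" "1 < B'" "B' > 0" "B > 0" "B \<ge> 1" "B' \<le> q * B'" "1 \<le> q * B'"
  proof -
    have "1 < B" using B q by linarith
    then show "B \<ge> 1" "B > 0" by auto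
    have "1 * B \<le> q * B" using q \<open>1 < B\<close> by (intro mult_right_mono) auto
    then show "B \<le> B'" by (simp add: B'_def)
    then show "1 < B'" "B' > 0" using \<open>1 < B\<close> by auto
    have "1 * B' \<le> q * B'" using q \<open>1 < B'\<close> by (intro mult_right_mono) auto
    then show "B' \<le> q * B'" "1 \<le> q * B'" using \<open>1 < B'\<close> by linarith+
  qed
  \<comment> \<open>The bound 8 / \<delta> is what closing requires; 2 * q makes the translation
    \<open>L\<close> along the axis exceed 1.\<close>
  define R0 where "R0 = max (max (8 / \<delta>) (2 * q)) 1"
  have R0: "8 / \<delta> \<le> R0" "2 * q \<le> R0" "R0 \<ge> 1" by (auto simp: R0_def)
  \<comment> \<open>Bounds the ratio of every range to be discarded: from 1 to \<open>B'\<close> and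
    from \<open>R / B'\<close> to \<open>R\<close> on the segment, from 1 to \<open>q * B'\<close>
    and from \<open>R / (q * B')\<close> to \<open>L \<le> q * R\<close> on the axis, and all of a
    segment shorter than \<open>R0\<close>.\<close>
  define K where "K = max R0 (q * (q * B'))"
  have K: "K \<ge> 1" "R0 \<le> K" "B' \<le> K" "q * B' \<le> K" "q * (q * B') \<le> K"
  proof -
    have "1 * (q * B') \<le> q * (q * B')" using q B' by (intro mult_right_mono) auto
    moreover show "R0 \<le> K" "q * (q * B') \<le> K"
      unfolding K_def by (rule max.cobounded1, rule max.cobounded2)
    ultimately show "K \<ge> 1" "B' \<le> K" "q * B' \<le> K"
      using R0 B' by linarith+
  qed
  obtain M :: nat where M: "\<And>x y \<alpha>. norm x = 1 \<Longrightarrow> norm y = 1 \<Longrightarrow> \<alpha> > 0 \<Longrightarrow>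
       finite {f \<in> near \<delta> x y. \<alpha> \<le> geo_pos x y f \<and> geo_pos x y f \<le> \<alpha> * K} \<and>
       card {f \<in> near \<delta> x y. \<alpha> \<le> geo_pos x y f \<and> geo_pos x y f \<le> \<alpha> * K} \<le> M"
    by (rule card_near_le[OF \<delta>_pos K(1)]) blast
  have Mcard: "finite A \<and> card A \<le> M"
    if "norm x = 1" "norm y = 1" "\<alpha> > 0" "A \<subseteq> {f \<in> near \<delta> x y. \<alpha> \<le> geo_pos x y f \<and> geo_pos x y f \<le> \<alpha> * K}" for A x y \<alpha>
  proof -
    note m = M[OF that(1-3), THEN conjunct1] M[OF that(1-3), THEN conjunct2]
    show ?thesis using finite_subset[OF that(4) m(1)] order_trans[OF card_mono[OF m(1) that(4)] m(2)] by simp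
  qed
  \<comment> \<open>Four discarded ranges, each with at most \<open>M\<close> elements of absolute
    value at most \<open>b\<close>.\<close>
  define C where "C = 4 * real M * b"
  have "C \<ge> 0" using b_nonneg by (simp add: C_def)
  have main: "- \<epsilon> * card I - C \<le> sum (translate x y) I"
    if g: "g \<in> \<Gamma>" and n: "norm x = 1" "norm y = 1" and d: "\<delta> \<le> norm (x - y)"
    "\<delta> \<le> norm (finv g x - finv g y)" "norm (x - finv g x) \<le> \<delta> / 8" "norm (y - finv g y) \<le> \<delta> / 8"
    and I: "I = {f \<in> near \<delta> x y. 1 \<le> geo_pos x y f \<and> geo_pos x y f < geo_pos x y g}" for x y g I
  proof -
    define R where "R = geo_pos x y g"
    have nearG: "f \<in> \<Gamma>" if "f \<in> near \<delta> u v" for f u v using that by (simp add: near_def)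
    have IG: "I \<subseteq> \<Gamma>" using I nearG by auto
    have eI: "\<epsilon> * card I \<ge> 0" using assms by simp
    show ?thesis
    proof (cases "R < R0")
      case True
      have "I \<subseteq> {f \<in> near \<delta> x y. 1 \<le> geo_pos x y f \<and> geo_pos x y f \<le> 1 * K}"
        using True K(2) by (auto simp: I R_def)
      then have "card I \<le> M" using Mcard[OF n zero_less_one] by blast
      then have "\<bar>sum (translate x y) I\<bar> \<le> real M * b"
        using sum_translate_bounded[OF n IG] by blast
      moreover have "real M * b \<ge> 0" using b_nonneg by simp
      ultimately show ?thesis using eI unfolding C_def by linarith
    next
      case False
      then have R: "R \<ge> R0" by simp
      then have R8: "8 / \<delta> \<le> geo_pos x y g" using R0 by (simp add: R_def)
      have Rpos: "R > 0" using R R0 by simp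
      have R1: "1 / R \<le> \<delta> / 8" using R8 Rpos \<delta>_pos by (simp add: R_def field_simps)
      obtain z w where zw: "norm z = 1" "norm w = 1" "g z = z" "g w = w"
        "norm (z - x) \<le> 1 / R" "norm (w - y) \<le> \<delta> / 4"
        and l: "geo_pos z w g \<le> 16 / \<delta>\<^sup>2 * R" "R \<le> 16 / \<delta>\<^sup>2 * geo_pos z w g"
        using closing_fixed_points[OF g n \<delta>_pos d R8] unfolding R_def by blast
      define L where "L = geo_pos z w g"
      have Lpos: "L > 0" using geo_pos_pos g zw by (simp add: L_def)
      have L: "L \<le> q * R" "R \<le> q * L"
      proof -
        have "16 / \<delta>\<^sup>2 * R \<le> q * R" "16 / \<delta>\<^sup>2 * L \<le> q * L"
          using mult_right_mono[OF q(2), of R] mult_right_mono[OF q(2), of L] Rpos Lpos by linarith+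
        then show "L \<le> q * R" "R \<le> q * L" using l unfolding L_def by linarith+
      qed
      have L1: "1 < L"
      proof -
        have "q * 1 < q * L" using L(2) R R0(2) q(1) by linarith
        then show ?thesis using q(1) by simp
      qed
      have "z \<noteq> w"
      proof
        assume "z = w"
        then have "L = 1" using deriv_pos[OF g, of w] zw(2) by (simp add: L_def geo_pos_def)
        then show False using L1 by simp
      qed
      note sh = shadowing[OF _ n zw(1,2) \<delta>_pos Rpos d(1) zw(5) R1 zw(6)]
      \<comment> \<open>\<open>Mid\<close> is cut out by positions on the segment, \<open>D\<close>
        is one period on the axis. Neither need contain the other, so the sums are compared through
        their intersection.\<close>
      define Mid where "Mid = {f \<in> near \<delta> x y. B' \<le> geo_pos x y f \<and> geo_pos x y f \<le> R / B'}"
      define D where "D = {f \<in> near \<delta> z w. 1 \<le> geo_pos z w f \<and> geo_pos z w f < L}"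
      have D0: "0 \<le> sum (translate z w) D"
        unfolding D_def L_def using periodic[OF g zw(1,2) \<open>z \<noteq> w\<close> zw(3,4)] L1 by (simp add: L_def)
      have finI: "finite I" unfolding I
        by (rule finite_subset[OF _ finite_near_between[OF \<delta>_pos n, of 1 R]]) (auto simp: R_def)
      have finD: "finite D" unfolding D_def
        by (rule finite_subset[OF _ finite_near_between[OF \<delta>_pos zw(1,2), of 1 L]]) auto
      have RB: "R / B' < R" using B' Rpos by (simp add: field_simps)
      have MidI: "Mid \<subseteq> I"
      proof
        fix f assume f: "f \<in> Mid"
        then have "1 \<le> geo_pos x y f" "geo_pos x y f < R"
          using B'(2) RB unfolding Mid_def mem_Collect_eq by linarith+
        then show "f \<in> I" using f by (simp add: I R_def Mid_def)
      qed
      have small1: "4 / \<delta> * s / R \<le> \<theta>" if "s \<le> R / B" for s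
      proof -
        have "4 / \<delta> * s / R \<le> 4 / \<delta> * (R / B) / R"
          using that Rpos \<delta>_pos by (intro divide_right_mono mult_left_mono) auto
        also have "\<dots> = 4 / \<delta> / B" using Rpos by simp
        finally show ?thesis using B(2) by simp
      qed
      have small2: "4 / \<delta> / s \<le> \<theta>" if "B \<le> s" for s
      proof -
        have "4 / \<delta> / s \<le> 4 / \<delta> / B"
          using that B'(4) \<delta>_pos by (intro divide_left_mono) auto
        then show ?thesis using B(2) by simp
      qed
      have RB': "R / B' \<le> R / B" using B' Rpos by (intro divide_left_mono) auto
      \<comment> \<open>An element that is \<delta>-near to the segment may fail to be so for the
        axis; its value on the axis is then 0, because a nonzero value requires separation
        \<open>2 * \<delta>\<close>.\<close>
      have Mid_props: "translate x y f \<ge> translate z w f - \<epsilon> \<and> (translate z w f \<noteq> 0 \<longrightarrow> f \<in> D)"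
        if f: "f \<in> Mid" for f
      proof -
        have fG: "f \<in> \<Gamma>" and fd: "\<delta> \<le> norm (finv f x - finv f y)" using f by (auto simp: Mid_def near_def)
        have s: "B' \<le> geo_pos x y f" "geo_pos x y f \<le> R / B'" using f by (auto simp: Mid_def)
        have 1: "norm (finv f x - finv f z) \<le> \<theta>"
          using order_trans[OF sh(1)[OF fG] small1] s(2) RB' by simp
        have 2: "norm (finv f y - finv f w) \<le> \<theta>"
          using order_trans[OF sh(3)[OF fG] small2] s(1) B'(1) by simp
        have 3: "\<delta> / 2 \<le> norm (finv f x - finv f w)" "\<delta> / 2 \<le> norm (finv f y - finv f z)"
          using norm_triangle_ineq[of "finv f x - finv f w" "finv f w - finv f y"]
            norm_triangle_ineq[of "finv f x - finv f z" "finv f z - finv f y"] 1 2 fd \<theta>(3) \<delta>_pos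
          by (simp_all add: norm_minus_commute)
        have "geo_pos x y f > 0" "geo_pos z w f > 0" using geo_pos_pos fG n zw by auto
        then have ratio: "geo_pos z w f \<le> q * geo_pos x y f" "geo_pos x y f \<le> q * geo_pos z w f"
          using sh(5)[OF fG 3] q(2) mult_right_mono[OF q(2), of "geo_pos x y f"]
            mult_right_mono[OF q(2), of "geo_pos z w f"] by linarith+
        have "geo_pos z w f < L"
        proof -
          have "q * geo_pos x y f \<le> q * (R / B')" using s q by (intro mult_left_mono) auto
          also have "\<dots> = R / B" using q by (simp add: B'_def)
          also have "\<dots> < R / q" using B q Rpos by (intro divide_strict_left_mono) auto
          also have "\<dots> \<le> L" using L(2) q by (simp add: field_simps)
          finally show ?thesis using ratio by simp
        qed
        moreover have "1 \<le> geo_pos z w f"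
        proof -
          have "q * 1 \<le> q * B" using B'(5) q by (intro mult_left_mono) auto
          then have "q * 1 \<le> q * geo_pos z w f" using ratio(2) s(1) unfolding B'_def by linarith
          then show ?thesis using q by simp
        qed
        moreover have "f \<in> near \<delta> z w" if "translate z w f \<noteq> 0"
        proof -
          have "\<not> norm (finv f z - finv f w) < 2 * \<delta>" using support[of "finv f z" "finv f w"] that fG zw by auto
          then show ?thesis using fG \<delta>_pos by (simp add: near_def)
        qed
        moreover have "\<bar>translate x y f - translate z w f\<bar> \<le> \<epsilon>"
          using \<theta>0(2)[of "finv f x" "finv f y" "finv f z" "finv f w"] fG n zw fd 1 2 \<theta>(2) by simp
        ultimately show ?thesis by (auto simp: D_def)
      qed
      define E where "E = {f \<in> D - Mid. translate z w f \<noteq> 0}"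
      \<comment> \<open>Conversely, a nonzero value on the axis means separation
        \<open>2 * \<delta>\<close> there, and two shifts by \<theta> leave at least \<delta> on the
        segment. Hence an element of the period missed by \<open>Mid\<close> sits near an end of the
        period.\<close>
      have Eprop: "geo_pos z w f \<le> q * B' \<or> R / (q * B') \<le> geo_pos z w f" if f: "f \<in> E" for f
      proof (rule ccontr)
        assume "\<not> ?thesis"
        then have s: "q * B' < geo_pos z w f" "geo_pos z w f < R / (q * B')" by auto
        have fG: "f \<in> \<Gamma>" using f by (auto simp: E_def D_def near_def)
        have "R / (q * B') \<le> R / B"
          by (rule divide_left_mono[OF order_trans[OF B'(1,6)]]) (use B' Rpos q in auto)
        then have 1: "norm (finv f x - finv f z) \<le> \<theta>"
          using order_trans[OF sh(2)[OF fG] small1] s(2) by simp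
        have 2: "norm (finv f y - finv f w) \<le> \<theta>"
        proof (rule order_trans[OF sh(4)[OF fG] small2])
          show "B \<le> geo_pos z w f" using s(1) B'(1,6) by linarith
        qed
        have "\<not> norm (finv f z - finv f w) < 2 * \<delta>"
          using support[of "finv f z" "finv f w"] f fG zw by (auto simp: E_def)
        then have d2: "2 * \<delta> \<le> norm (finv f z - finv f w)" by simp
        have 3: "\<delta> / 2 \<le> norm (finv f x - finv f w)" "\<delta> / 2 \<le> norm (finv f y - finv f z)" "\<delta> \<le> norm (finv f x - finv f y)"
          using norm_triangle_ineq[of "finv f z - finv f x" "finv f x - finv f w"]
            norm_triangle_ineq[of "finv f z - finv f y" "finv f y - finv f w"]
            norm_triangle_ineq[of "finv f x - finv f y" "finv f y - finv f w"] 1 2 d2 \<theta>(3) \<delta>_pos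
          by (simp_all add: norm_minus_commute)
        have "geo_pos x y f > 0" "geo_pos z w f > 0" using geo_pos_pos fG n zw by auto
        then have ratio: "geo_pos z w f \<le> q * geo_pos x y f" "geo_pos x y f \<le> q * geo_pos z w f"
          using sh(5)[OF fG 3(1,2)] q(2) mult_right_mono[OF q(2), of "geo_pos x y f"]
            mult_right_mono[OF q(2), of "geo_pos z w f"] by linarith+
        have "q * B' < q * geo_pos x y f" using ratio s by linarith
        then have "B' \<le> geo_pos x y f" using q by simp
        moreover have "geo_pos x y f \<le> R / B'"
        proof -
          have "q * geo_pos z w f \<le> q * (R / (q * B'))" using s q by (intro mult_left_mono) auto
          also have "\<dots> = R / B'" using q by simp
          finally show ?thesis using ratio by simp
        qed
        ultimately have "f \<in> Mid" using fG 3(3) by (simp add: Mid_def near_def)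
        then show False using f by (simp add: E_def)
      qed
      have cardE: "card E \<le> M + M"
      proof -
        let ?E1 = "{f \<in> E. geo_pos z w f \<le> q * B'}" and ?E2 = "{f \<in> E. R / (q * B') \<le> geo_pos z w f}"
        have "?E1 \<subseteq> {f \<in> near \<delta> z w. 1 \<le> geo_pos z w f \<and> geo_pos z w f \<le> 1 * K}"
          using K(4) by (auto simp: E_def D_def)
        then have c1: "card ?E1 \<le> M" using Mcard[OF zw(1,2), of 1] by simp
        have qB: "q * B' > 0" using B'(7) by linarith
        have "L \<le> R / (q * B') * K"
        proof -
          have "R / (q * B') * (q * (q * B')) \<le> R / (q * B') * K"
            using K(5) qB Rpos by (intro mult_left_mono) auto
          moreover have "R / (q * B') * (q * (q * B')) = q * R" using B'(3) q(1) by simp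
          ultimately show ?thesis using L(1) by linarith
        qed
        then have "?E2 \<subseteq> {f \<in> near \<delta> z w. R / (q * B') \<le> geo_pos z w f \<and> geo_pos z w f \<le> R / (q * B') * K}"
          by (auto simp: E_def D_def)
        then have c2: "card ?E2 \<le> M" using Mcard[OF zw(1,2), of "R / (q * B')"] qB Rpos by simp
        have "finite E" using finD by (simp add: E_def)
        have "card E = card (?E1 \<union> ?E2)" using Eprop by (intro arg_cong[where f = card]) blast
        then have "card E \<le> card ?E1 + card ?E2" using card_Un_le[of ?E1 ?E2] by linarith
        then show ?thesis using c1 c2 by linarith
      qed
      have cardI: "card (I - Mid) \<le> M + M"
      proof -
        let ?E1 = "{f \<in> I. geo_pos x y f \<le> B'}" and ?E2 = "{f \<in> I. R / B' \<le> geo_pos x y f}"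
        have "?E1 \<subseteq> {f \<in> near \<delta> x y. 1 \<le> geo_pos x y f \<and> geo_pos x y f \<le> 1 * K}"
          using K(3) by (auto simp: I)
        then have c1: "card ?E1 \<le> M" using Mcard[OF n, of 1] by simp
        have "R \<le> R / B' * K"
        proof -
          have "R / B' * B' \<le> R / B' * K"
            using K(3) B' Rpos by (intro mult_left_mono) auto
          then show ?thesis using B' by simp
        qed
        then have "?E2 \<subseteq> {f \<in> near \<delta> x y. R / B' \<le> geo_pos x y f \<and> geo_pos x y f \<le> R / B' * K}"
          by (auto simp: I R_def)
        then have c2: "card ?E2 \<le> M" using Mcard[OF n, of "R / B'"] B' Rpos by simp
        have "I - Mid \<subseteq> ?E1 \<union> ?E2" by (auto simp: Mid_def I)
        then have "card (I - Mid) \<le> card (?E1 \<union> ?E2)" using finI by (intro card_mono) auto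
        also have "\<dots> \<le> card ?E1 + card ?E2" by (rule card_Un_le)
        finally show ?thesis using c1 c2 by linarith
      qed
      have finMid: "finite Mid" using MidI finI by (rule finite_subset)
      have "sum (translate x y) I = sum (translate x y) Mid + sum (translate x y) (I - Mid)"
        using sum.subset_diff[OF MidI finI, of "translate x y"] by simp
      moreover have "\<bar>sum (translate x y) (I - Mid)\<bar> \<le> real (M + M) * b"
        using sum_translate_bounded[OF n _ cardI] IG by blast
      moreover have "sum (translate x y) Mid \<ge> sum (translate z w) Mid - \<epsilon> * card Mid"
      proof -
        have "sum (translate x y) Mid \<ge> (\<Sum>f\<in>Mid. translate z w f - \<epsilon>)"
          using Mid_props by (intro sum_mono) auto
        then show ?thesis by (simp add: sum_subtractf mult.commute)
      qed
      moreover have "sum (translate z w) Mid = sum (translate z w) (Mid \<inter> D)"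
        using Mid_props finMid by (intro sum.mono_neutral_right) auto
      moreover have "sum (translate z w) D = sum (translate z w) (Mid \<inter> D) + sum (translate z w) E"
      proof -
        have "sum (translate z w) D = sum (translate z w) (D \<inter> Mid) + sum (translate z w) (D - Mid)"
          using sum.Int_Diff[OF finD] .
        moreover have "sum (translate z w) (D - Mid) = sum (translate z w) E"
          using finD by (intro sum.mono_neutral_right) (auto simp: E_def)
        ultimately show ?thesis by (simp add: Int_commute)
      qed
      moreover have "\<bar>sum (translate z w) E\<bar> \<le> real (M + M) * b"
        using sum_translate_bounded[OF zw(1,2) _ cardE] nearG by (auto simp: E_def D_def)
      moreover have "\<epsilon> * card Mid \<le> \<epsilon> * card I"
        using card_mono[OF finI MidI] assms by (intro mult_left_mono) auto
      moreover have "real (M + M) * b = 2 * real M * b" by simp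
      ultimately show ?thesis using D0 unfolding C_def by linarith
    qed
  qed
  show ?thesis by (rule that[OF \<open>C \<ge> 0\<close>]) (rule main[OF _ _ _ _ _ _ _ refl])
qed

text \<open>Translation by \<open>finv f\<close> puts the start of the loop at the identity, and the
  loop is then closed by \<open>g = finv f \<circ> h\<close>. Closeness of the pulled back ends says
  that \<open>g\<close> nearly fixes the ends of the translated geodesic.\<close>

lemma closing_estimate:
  fixes \<epsilon> :: real
  assumes "\<epsilon> > 0"
  obtains C where "C \<ge> 0" "\<And>x y f h. norm x = 1 \<Longrightarrow> norm y = 1 \<Longrightarrow> f \<in> near \<delta> x y \<Longrightarrow> h \<in> near \<delta> x y \<Longrightarrow>
    norm (finv f x - finv h x) \<le> \<delta> / 8 \<Longrightarrow> norm (finv f y - finv h y) \<le> \<delta> / 8 \<Longrightarrow>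
    - \<epsilon> * card {k \<in> near \<delta> x y. geo_pos x y f \<le> geo_pos x y k \<and> geo_pos x y k < geo_pos x y h} - C
      \<le> sum (translate x y) {k \<in> near \<delta> x y. geo_pos x y f \<le> geo_pos x y k \<and> geo_pos x y k < geo_pos x y h}"
proof -
  obtain C where C: "C \<ge> 0" "\<And>x y g. g \<in> \<Gamma> \<Longrightarrow> norm x = 1 \<Longrightarrow> norm y = 1 \<Longrightarrow> \<delta> \<le> norm (x - y) \<Longrightarrow>
    \<delta> \<le> norm (finv g x - finv g y) \<Longrightarrow> norm (x - finv g x) \<le> \<delta> / 8 \<Longrightarrow> norm (y - finv g y) \<le> \<delta> / 8 \<Longrightarrow>
    - \<epsilon> * card {f \<in> near \<delta> x y. 1 \<le> geo_pos x y f \<and> geo_pos x y f < geo_pos x y g} - C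
      \<le> sum (translate x y) {f \<in> near \<delta> x y. 1 \<le> geo_pos x y f \<and> geo_pos x y f < geo_pos x y g}"
    using closing_estimate_id[OF assms] by blast
  show ?thesis
  proof (rule that[OF C(1)])
    fix x y f h
    assume n: "norm x = 1" "norm y = 1" and fh: "f \<in> near \<delta> x y" "h \<in> near \<delta> x y"
      and close: "norm (finv f x - finv h x) \<le> \<delta> / 8" "norm (finv f y - finv h y) \<le> \<delta> / 8"
    have G: "f \<in> \<Gamma>" "h \<in> \<Gamma>" using fh by (auto simp: near_def)
    define u v g where "u = finv f x" and "v = finv f y" and "g = finv f \<circ> h"
    have xy: "x = f u" "y = f v" and hg: "h = f \<circ> g" using G by (simp_all add: u_def v_def g_def)
    have n': "norm u = 1" "norm v = 1" using n G by (auto simp: u_def v_def)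
    have gG: "g \<in> \<Gamma>" using G by (simp add: g_def comp_in finv_in)
    have ginv: "finv g u = finv h x" "finv g v = finv h y" using G gG by (simp_all add: xy hg)
    let ?S = "{k \<in> near \<delta> x y. geo_pos x y f \<le> geo_pos x y k \<and> geo_pos x y k < geo_pos x y h}"
    let ?S' = "{k \<in> near \<delta> u v. 1 \<le> geo_pos u v k \<and> geo_pos u v k < geo_pos u v g}"
    have pf: "geo_pos x y f > 0" using geo_pos_pos G n by blast
    have p: "geo_pos x y (f \<circ> k) = geo_pos u v k * geo_pos x y f" if "k \<in> \<Gamma>" for k
      unfolding xy using geo_pos_comp[OF that G(1) n'] .
    have "?S = (\<lambda>k. f \<circ> k) ` ?S'"
    proof -
      have "geo_pos x y f \<le> geo_pos x y (f \<circ> k) \<longleftrightarrow> 1 \<le> geo_pos u v k"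
        "geo_pos x y (f \<circ> k) < geo_pos x y h \<longleftrightarrow> geo_pos u v k < geo_pos u v g" if "k \<in> near \<delta> u v" for k
      proof -
        have "k \<in> \<Gamma>" using that by (simp add: near_def)
        then show "geo_pos x y f \<le> geo_pos x y (f \<circ> k) \<longleftrightarrow> 1 \<le> geo_pos u v k"
          "geo_pos x y (f \<circ> k) < geo_pos x y h \<longleftrightarrow> geo_pos u v k < geo_pos u v g"
          using p pf gG unfolding hg by auto
      qed
      moreover have "near \<delta> x y = (\<lambda>k. f \<circ> k) ` near \<delta> u v" unfolding xy by (rule near_image[OF G(1)])
      ultimately show ?thesis by auto
    qed
    moreover have "inj_on (\<lambda>k. f \<circ> k) ?S'" using inj_comp_left G by blast
    moreover have "translate x y (f \<circ> k) = translate u v k" if "k \<in> ?S'" for k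
      using that G by (simp add: near_def xy)
    ultimately have "sum (translate x y) ?S = sum (translate u v) ?S'" "card ?S = card ?S'"
      by (simp_all add: sum.reindex card_image)
    then show "- \<epsilon> * card ?S - C \<le> sum (translate x y) ?S"
      using C(2)[OF gG n'] fh close unfolding ginv by (simp add: u_def v_def near_def)
  qed
qed

text \<open>A segment decomposes into boundedly many loops, each from the first to the last visit to a
  type, and each loop is closed up by the previous lemma.\<close>

lemma segment_estimate:
  fixes \<epsilon> :: real
  assumes "\<epsilon> > 0"
  obtains C where "\<And>x y l r. norm x = 1 \<Longrightarrow> norm y = 1 \<Longrightarrow> 0 < l \<Longrightarrow>
    - \<epsilon> * card {f \<in> near \<delta> x y. l \<le> geo_pos x y f \<and> geo_pos x y f \<le> r} - C
      \<le> sum (translate x y) {f \<in> near \<delta> x y. l \<le> geo_pos x y f \<and> geo_pos x y f \<le> r}"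
proof -
  obtain C1 where C1: "C1 \<ge> 0" "\<And>x y f h. norm x = 1 \<Longrightarrow> norm y = 1 \<Longrightarrow> f \<in> near \<delta> x y \<Longrightarrow> h \<in> near \<delta> x y \<Longrightarrow>
    norm (finv f x - finv h x) \<le> \<delta> / 8 \<Longrightarrow> norm (finv f y - finv h y) \<le> \<delta> / 8 \<Longrightarrow>
    - \<epsilon> * card {k \<in> near \<delta> x y. geo_pos x y f \<le> geo_pos x y k \<and> geo_pos x y k < geo_pos x y h} - C1
      \<le> sum (translate x y) {k \<in> near \<delta> x y. geo_pos x y f \<le> geo_pos x y k \<and> geo_pos x y k < geo_pos x y h}"
    using closing_estimate[OF assms] by blast
  obtain t :: "complex \<times> complex \<Rightarrow> (int \<times> int) \<times> (int \<times> int)" and T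
    where T: "finite T" "\<And>x y. norm x = 1 \<Longrightarrow> norm y = 1 \<Longrightarrow> t (x, y) \<in> T"
    "\<And>x y z w. t (x, y) = t (z, w) \<Longrightarrow> norm (x - z) \<le> \<delta> / 8 \<and> norm (y - w) \<le> \<delta> / 8"
    by (rule finite_types[of "\<delta> / 8"]) (use \<delta>_pos in simp, blast)
  obtain M :: nat where M: "\<And>x y \<alpha>. norm x = 1 \<Longrightarrow> norm y = 1 \<Longrightarrow> \<alpha> > 0 \<Longrightarrow>
       finite {f \<in> near \<delta> x y. \<alpha> \<le> geo_pos x y f \<and> geo_pos x y f \<le> \<alpha> * 1} \<and>
       card {f \<in> near \<delta> x y. \<alpha> \<le> geo_pos x y f \<and> geo_pos x y f \<le> \<alpha> * 1} \<le> M"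
    by (rule card_near_le[OF \<delta>_pos, of 1]) auto
  \<comment> \<open>The cost of one type: closing its loop, plus the elements tied in position with
    its last visit.\<close>
  define C2 where "C2 = C1 + real M * b"
  have C2: "C2 \<ge> 0" using C1 b_nonneg by (simp add: C2_def)
  \<comment> \<open>Induction on the number of types still occurring in \<open>W\<close>. Closure of
    \<open>W\<close> under larger positions up to \<open>r\<close> makes the remainder after a loop
    a set of the same form.\<close>
  have main: "- \<epsilon> * card W - real N * C2 \<le> sum (translate x y) W"
    if n: "norm x = 1" "norm y = 1"
      and "finite W" "W \<subseteq> near \<delta> x y" "card ((\<lambda>f. t (finv f x, finv f y)) ` W) \<le> N"
      "\<And>f k. f \<in> W \<Longrightarrow> k \<in> near \<delta> x y \<Longrightarrow> geo_pos x y f \<le> geo_pos x y k \<Longrightarrow> geo_pos x y k \<le> r \<Longrightarrow> k \<in> W"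
      "\<And>f. f \<in> W \<Longrightarrow> geo_pos x y f \<le> r"
    for x y W N r
    using that(3-)
  proof (induction N arbitrary: W)
    case 0
    then have "W = {}" by simp
    then show ?case by simp
  next
    case (Suc N)
    let ?t = "\<lambda>f. t (finv f x, finv f y)"
    show ?case
    proof (cases "W = {}")
      case True
      then show ?thesis using C2 by simp
    next
      case False
      obtain f where f: "f \<in> W" "\<And>k. k \<in> W \<Longrightarrow> geo_pos x y f \<le> geo_pos x y k"
        using finite_obtain_min[OF Suc.prems(1) False, of "geo_pos x y"] by blast
      define V where "V = {k \<in> W. ?t k = ?t f}"
      have V: "finite V" "V \<noteq> {}" using Suc.prems(1) f by (auto simp: V_def)
      obtain h where h: "h \<in> V" "\<And>k. k \<in> V \<Longrightarrow> geo_pos x y k \<le> geo_pos x y h"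
        using finite_obtain_max[OF V, of "geo_pos x y"] by blast
      have hW: "h \<in> W" and th: "?t f = ?t h" using h(1) by (auto simp: V_def)
      define A where "A = {k \<in> near \<delta> x y. geo_pos x y f \<le> geo_pos x y k \<and> geo_pos x y k < geo_pos x y h}"
      \<comment> \<open>The loop estimate excludes the position of \<open>h\<close>, so the elements
        there are accounted for separately.\<close>
      define B where "B = {k \<in> near \<delta> x y. geo_pos x y k = geo_pos x y h}"
      define W' where "W' = {k \<in> W. geo_pos x y h < geo_pos x y k}"
      have hr: "geo_pos x y h \<le> r" using Suc.prems(5) hW by blast
      have fn: "f \<in> near \<delta> x y" "h \<in> near \<delta> x y" using f hW Suc.prems(2) by auto
      have AW: "A \<subseteq> W"
        using Suc.prems(4)[OF f(1)] hr unfolding A_def by force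
      have BW: "B \<subseteq> W" using Suc.prems(4)[OF hW] hr unfolding B_def by force
      have W: "W = A \<union> (B \<union> W')"
      proof
        show "W \<subseteq> A \<union> (B \<union> W')"
          using f(2) Suc.prems(2) unfolding A_def B_def W'_def by force
        show "A \<union> (B \<union> W') \<subseteq> W" using AW BW by (auto simp: W'_def)
      qed
      have disj: "A \<inter> (B \<union> W') = {}" "B \<inter> W' = {}" by (auto simp: A_def B_def W'_def)
      have fin: "finite A" "finite B" "finite W'" "finite (B \<union> W')"
        using Suc.prems(1) W by (metis finite_Un)+
      have hpos: "geo_pos x y h > 0" using geo_pos_pos[OF _ n] fn by (simp add: near_def)
      have sA: "- \<epsilon> * card A - C1 \<le> sum (translate x y) A"
        unfolding A_def using C1(2)[OF n fn] T(3)[OF th] by blast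
      have sB: "- (real M * b) \<le> sum (translate x y) B"
      proof -
        have "B = {f \<in> near \<delta> x y. geo_pos x y h \<le> geo_pos x y f \<and> geo_pos x y f \<le> geo_pos x y h * 1}"
          by (auto simp: B_def)
        then have "card B \<le> M" using M[OF n hpos] by metis
        moreover have "B \<subseteq> \<Gamma>" by (auto simp: B_def near_def)
        ultimately have "\<bar>sum (translate x y) B\<bar> \<le> real M * b" by (intro sum_translate_bounded[OF n])
        then show ?thesis by linarith
      qed
      \<comment> \<open>Everything in \<open>W'\<close> lies beyond the last visit to the type of
        \<open>f\<close>, so that type no longer occurs.\<close>
      have sW': "- \<epsilon> * card W' - real N * C2 \<le> sum (translate x y) W'"
      proof (rule Suc.IH)
        have "?t ` W' \<subseteq> ?t ` W - {?t f}"
        proof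
          fix c assume "c \<in> ?t ` W'"
          then obtain k where k: "k \<in> W'" "c = ?t k" by blast
          have "k \<notin> V" using h(2)[of k] k(1) unfolding W'_def by force
          then show "c \<in> ?t ` W - {?t f}" using k by (auto simp: V_def W'_def)
        qed
        then have "card (?t ` W') \<le> card (?t ` W - {?t f})"
          using Suc.prems(1) by (intro card_mono) auto
        also have "\<dots> \<le> N" using Suc.prems(1,3) f(1) by (simp add: card_Diff_singleton)
        finally show "card (?t ` W') \<le> N" .
        show "finite W'" by (rule fin)
        show "W' \<subseteq> near \<delta> x y" using Suc.prems(2) by (auto simp: W'_def)
        show "geo_pos x y k \<le> r" if "k \<in> W'" for k using Suc.prems(5) that by (auto simp: W'_def)
        show "k \<in> W'" if "u \<in> W'" "k \<in> near \<delta> x y" "geo_pos x y u \<le> geo_pos x y k" "geo_pos x y k \<le> r" for u k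
          using Suc.prems(4)[of u k] that by (auto simp: W'_def)
      qed
      have c: "card W = card A + (card B + card W')"
        unfolding W using card_Un_disjoint[OF fin(1,4) disj(1)] card_Un_disjoint[OF fin(2,3) disj(2)] by linarith
      have "sum (translate x y) W = sum (translate x y) A + (sum (translate x y) B + sum (translate x y) W')"
        unfolding W using sum.union_disjoint[OF fin(1,4) disj(1), of "translate x y"]
          sum.union_disjoint[OF fin(2,3) disj(2), of "translate x y"] by linarith
      moreover have "\<epsilon> * card W = \<epsilon> * card A + (\<epsilon> * card B + \<epsilon> * card W')"
        by (simp add: c algebra_simps)
      moreover have "\<epsilon> * card B \<ge> 0" using assms by simp
      moreover have "real (Suc N) * C2 = real N * C2 + C1 + real M * b" by (simp add: C2_def algebra_simps)
      ultimately show ?thesis using sA sB sW' by linarith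
    qed
  qed
  show ?thesis
  proof (rule that)
    fix x y :: complex and l r :: real
    assume n: "norm x = 1" "norm y = 1" and l: "0 < l"
    let ?W = "{f \<in> near \<delta> x y. l \<le> geo_pos x y f \<and> geo_pos x y f \<le> r}"
    have "(\<lambda>f. t (finv f x, finv f y)) ` ?W \<subseteq> T" using T(2) n by (auto simp: near_def)
    then have "card ((\<lambda>f. t (finv f x, finv f y)) ` ?W) \<le> card T" using T(1) by (rule card_mono[rotated])
    then show "- \<epsilon> * card ?W - real (card T) * C2 \<le> sum (translate x y) ?W"
      by (intro main[OF n, of _ _ r] finite_near_between[OF \<delta>_pos n l]) auto
  qed
qed

lemma window_estimate:
  fixes \<epsilon> :: real
  assumes "\<epsilon> > 0"
  obtains C where "\<And>x y N. norm x = 1 \<Longrightarrow> norm y = 1 \<Longrightarrow> \<delta> \<le> norm (x - y) \<Longrightarrow>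
    - \<epsilon> * card (window \<delta> N x y) - C \<le> sum (translate x y) (window \<delta> N x y)"
proof -
  obtain C where C: "\<And>x y l r. norm x = 1 \<Longrightarrow> norm y = 1 \<Longrightarrow> 0 < l \<Longrightarrow>
    - \<epsilon> * card {f \<in> near \<delta> x y. l \<le> geo_pos x y f \<and> geo_pos x y f \<le> r} - C
      \<le> sum (translate x y) {f \<in> near \<delta> x y. l \<le> geo_pos x y f \<and> geo_pos x y f \<le> r}"
    using segment_estimate[OF assms] by blast
  have M: "\<exists>a b. 0 < a \<and> window \<delta> N x y = {f \<in> near \<delta> x y. a \<le> geo_pos x y f \<and> geo_pos x y f \<le> b}"
    if "norm x = 1" "norm y = 1" "\<delta> \<le> norm (x - y)" for x y :: complex and N
    by (rule card_window[OF \<delta>_pos unbounded]) (use that in blast)+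
  show ?thesis
  proof (rule that)
    fix x y :: complex and N assume n: "norm x = 1" "norm y = 1" "\<delta> \<le> norm (x - y)"
    obtain l r where "0 < l" "window \<delta> N x y = {f \<in> near \<delta> x y. l \<le> geo_pos x y f \<and> geo_pos x y f \<le> r}"
      using M[OF n] by blast
    then show "- \<epsilon> * card (window \<delta> N x y) - C \<le> sum (translate x y) (window \<delta> N x y)"
      using C[OF n(1,2)] by simp
  qed
qed

end

section \<open>Sums over closed geodesics\<close>

context fuchsian_group begin

text \<open>Integer powers are taken in the group of elements under composition; bringing an element
  back into a given period takes negative powers as well.\<close>

definition gpow :: "(complex \<Rightarrow> complex) \<Rightarrow> int \<Rightarrow> complex \<Rightarrow> complex" where
  "gpow g n = g [^]\<^bsub>\<lparr>carrier = \<Gamma>, monoid.mult = (\<circ>), one = id\<rparr>\<^esub> n"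

lemma gpow:
  assumes "g \<in> \<Gamma>"
  shows "gpow g n \<in> \<Gamma>" "gpow g (m + n) = gpow g m \<circ> gpow g n" "gpow g 0 = id" "gpow g 1 = g"
proof -
  interpret G: group "\<lparr>carrier = \<Gamma>, monoid.mult = (\<circ>), one = id\<rparr>"
  proof (rule groupI)
    show "\<exists>h\<in>carrier \<lparr>carrier = \<Gamma>, monoid.mult = (\<circ>), one = id\<rparr>.
        h \<otimes>\<^bsub>\<lparr>carrier = \<Gamma>, monoid.mult = (\<circ>), one = id\<rparr>\<^esub> f = \<one>\<^bsub>\<lparr>carrier = \<Gamma>, monoid.mult = (\<circ>), one = id\<rparr>\<^esub>"
      if "f \<in> carrier \<lparr>carrier = \<Gamma>, monoid.mult = (\<circ>), one = id\<rparr>" for f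
      using that finv_in[of f] by (auto intro: bexI[of _ "finv f"])
  qed (auto simp: comp_in id_in comp_assoc)
  show "gpow g n \<in> \<Gamma>" using G.int_pow_closed[of g n] assms by (simp add: gpow_def)
  show "gpow g (m + n) = gpow g m \<circ> gpow g n" using G.int_pow_mult[of g m n] assms by (simp add: gpow_def)
  show "gpow g 0 = id" by (simp add: gpow_def)
  show "gpow g 1 = g" using G.int_pow_1[of g] assms by (simp add: gpow_def)
qed

lemma gpow_fixed:
  assumes "g \<in> \<Gamma>" "g x = x"
  shows "gpow g n x = x"
proof (induction n rule: int_induct[of _ 0])
  case base
  then show ?case using gpow(3) assms by simp
next
  case (step1 i)
  then show ?case using gpow(2)[OF assms(1), of i 1] gpow(4) assms by simp
next
  case (step2 i)
  have "gpow g i x = gpow g (i - 1) (g x)"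
    using gpow(2)[OF assms(1), of "i - 1" 1] gpow(4)[OF assms(1)] by (simp add: fun_eq_iff)
  then show ?case using step2 assms by simp
qed

lemma geo_pos_gpow:
  assumes "g \<in> \<Gamma>" "norm x = 1" "norm y = 1" "g x = x" "g y = y"
  shows "geo_pos x y (gpow g n) = geo_pos x y g powr n"
proof -
  have pos: "geo_pos x y g > 0" using geo_pos_pos assms by simp
  have step: "geo_pos x y (gpow g (i + 1)) = geo_pos x y g * geo_pos x y (gpow g i)" for i
    using gpow(2)[OF assms(1), of i 1] gpow(4)[OF assms(1)] gpow_fixed[OF assms(1)] assms
      geo_pos_comp[OF assms(1) gpow(1)[OF assms(1), of i] assms(2,3)] by simp
  show ?thesis
  proof (induction n rule: int_induct[of _ 0])
    case base
    have "geo_pos x y (gpow g 0) = 1" by (simp only: gpow(3)[OF assms(1)] geo_pos_id)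
    then show ?case using pos by simp
  next
    case (step1 i)
    then show ?case using step[of i] pos by (simp add: powr_add)
  next
    case (step2 i)
    then show ?case using step[of "i - 1"] pos by (simp add: powr_diff field_simps)
  qed
qed

text \<open>\<open>D\<close> represents the elements near the axis modulo left multiplication by
  powers of \<open>g\<close>. Sending \<open>f\<close> to the axis pulled back by \<open>f\<close>
  maps \<open>D\<close> onto the \<delta>-separated geodesics of the orbit. Its fibres correspond to
  the stabiliser of the axis modulo powers of \<open>g\<close>, so all have the same size
  \<open>m\<close>.\<close>

lemma periodic_sum:
  assumes "\<delta> > 0" and g: "g \<in> \<Gamma>" and n: "norm x = 1" "norm y = 1" and fixed: "g x = x" "g y = y"
    and one: "1 < geo_pos x y g"
  defines "D \<equiv> {f \<in> near \<delta> x y. 1 \<le> geo_pos x y f \<and> geo_pos x y f < geo_pos x y g}"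
  obtains m :: nat where "\<And>\<phi> :: complex set \<Rightarrow> real.
      (\<Sum>f\<in>D. \<phi> (finv f ` {x, y})) = m * (\<Sum>G\<in>{h ` {x, y} | h. h \<in> \<Gamma> \<and> \<delta> \<le> norm (h x - h y)}. \<phi> G)"
    "finite {h ` {x, y} | h. h \<in> \<Gamma> \<and> \<delta> \<le> norm (h x - h y)}"
proof -
  define l where "l = geo_pos x y g"
  define \<O> where "\<O> = {h ` {x, y} | h. h \<in> \<Gamma> \<and> \<delta> \<le> norm (h x - h y)}"
  have DG: "f \<in> \<Gamma>" if "f \<in> near \<delta> x y" for f using that by (simp add: near_def)
  have finD: "finite D" unfolding D_def
    by (rule finite_subset[OF _ finite_near_between[OF \<open>\<delta> > 0\<close> n, of 1 l]]) (auto simp: l_def)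
  have pz: "geo_pos x y (gpow g k \<circ> f) = l powr k * geo_pos x y f" if "f \<in> \<Gamma>" for k f
    using geo_pos_comp[OF that gpow(1)[OF g, of k] n] gpow_fixed[OF g] fixed geo_pos_gpow[OF g n fixed, of k]
    by (simp add: l_def)
  have fz: "finv (gpow g k \<circ> f) ` {x, y} = finv f ` {x, y}" if "f \<in> \<Gamma>" for k f
  proof -
    have "finv (gpow g k) x = x" "finv (gpow g k) y = y"
      using gpow_fixed[OF g fixed(1), of k] gpow_fixed[OF g fixed(2), of k] gpow(1)[OF g, of k]
      by (metis finv_f(1))+
    then show ?thesis using finv_comp[OF gpow(1)[OF g, of k] that] by simp
  qed
  have rep: "\<exists>k. gpow g k \<circ> f \<in> D" if f: "f \<in> near \<delta> x y" for f
  proof -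
    define p where "p = geo_pos x y f"
    have p: "p > 0" using geo_pos_pos DG[OF f] n by (simp add: p_def)
    \<comment> \<open>This power of \<open>g\<close> moves the logarithm of the position to base
      \<open>l\<close> into the half-open unit interval.\<close>
    define k where "k = - \<lfloor>log l p\<rfloor>"
    have L1: "l > 1" using one by (simp add: l_def)
    have "1 \<le> l powr k * p \<and> l powr k * p < l"
    proof -
      have "l powr k * p = l powr (k + log l p)"
        using L1 p by (simp add: powr_add)
      moreover have "0 \<le> k + log l p" "k + log l p < 1" unfolding k_def by linarith+
      ultimately show ?thesis
        using L1 powr_mono[of 0 "k + log l p" l] powr_less_mono[of "k + log l p" 1 l] by simp
    qed
    moreover have "gpow g k \<circ> f \<in> near \<delta> x y"
      using near_comp[OF DG[OF f] gpow(1)[OF g, of k], of \<delta> x y] gpow_fixed[OF g] fixed f by simp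
    ultimately have "gpow g k \<circ> f \<in> D"
      unfolding D_def using pz[OF DG[OF f], of k] by (simp add: p_def l_def)
    then show ?thesis ..
  qed
  have unique: "f = h" if f: "f \<in> D" and h: "h \<in> D" and e: "f = gpow g k \<circ> h" for f h k
  proof -
    have hG: "h \<in> \<Gamma>" using h DG by (simp add: D_def)
    have L1: "l > 1" using one by (simp add: l_def)
    have "geo_pos x y f = l powr k * geo_pos x y h" unfolding e by (rule pz[OF hG])
    moreover have r: "1 \<le> geo_pos x y f" "geo_pos x y f < l" "1 \<le> geo_pos x y h" "geo_pos x y h < l"
      using f h by (auto simp: D_def l_def)
    ultimately have 1: "l powr k < l powr 1" "l powr (-1) < l powr k"
    proof -
      assume a: "geo_pos x y f = l powr k * geo_pos x y h"
      have "l powr k * 1 \<le> l powr k * geo_pos x y h" using r(3) by (intro mult_left_mono) auto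
      then show "l powr k < l powr 1" using a r L1 by (simp only: powr_one)
      have "l powr k * geo_pos x y h < l powr k * l" using r(4) L1 by (intro mult_strict_left_mono) auto
      then have "1 < l powr k * l" using a r(1) by linarith
      then show "l powr (-1) < l powr k" using L1 by (simp add: powr_minus field_simps)
    qed
    have "real_of_int k < 1" "-1 < real_of_int k"
      using 1 by (simp_all only: powr_less_cancel_iff[OF L1])
    then have "k = 0" by linarith
    then show ?thesis using e gpow(3)[OF g] by simp
  qed
  have image: "(\<lambda>f. finv f ` {x, y}) ` D = \<O>"
  proof (intro equalityI subsetI)
    fix G assume "G \<in> (\<lambda>f. finv f ` {x, y}) ` D"
    then obtain f where f: "f \<in> D" "G = finv f ` {x, y}" by blast
    then have "f \<in> \<Gamma>" "\<delta> \<le> norm (finv f x - finv f y)" by (auto simp: D_def near_def)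
    then show "G \<in> \<O>" unfolding \<O>_def using f(2) finv_in by blast
  next
    fix G assume "G \<in> \<O>"
    then obtain h where h: "h \<in> \<Gamma>" "\<delta> \<le> norm (h x - h y)" "G = h ` {x, y}" unfolding \<O>_def by blast
    then have "finv h \<in> near \<delta> x y" by (simp add: near_def finv_in)
    then obtain k where "gpow g k \<circ> finv h \<in> D" using rep by blast
    moreover have "finv (gpow g k \<circ> finv h) ` {x, y} = G" using fz[OF finv_in[OF h(1)], of k] h by simp
    ultimately show "G \<in> (\<lambda>f. finv f ` {x, y}) ` D" by blast
  qed
  define F where "F G = {f \<in> D. finv f ` {x, y} = G}" for G
  have fib_le: "card (F G) \<le> card (F H)" if GH: "G \<in> \<O>" "H \<in> \<O>" for G H
  proof -
    obtain u v where u: "u \<in> D" "finv u ` {x, y} = G" and v: "v \<in> D" "finv v ` {x, y} = H"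
      using GH unfolding image[symmetric] by blast
    have uv: "u \<in> \<Gamma>" "v \<in> \<Gamma>" using u v DG by (auto simp: D_def)
    \<comment> \<open>Right multiplication by \<open>finv u \<circ> v\<close> carries the fibre over
      \<open>G\<close> to elements over \<open>H\<close>, and a power of \<open>g\<close> returns
      the result to \<open>D\<close>. This stays injective because distinct elements of
      \<open>D\<close> do not differ by a power of \<open>g\<close>.\<close>
    define T where "T f = f \<circ> finv u \<circ> v" for f :: "complex \<Rightarrow> complex"
    have TG: "T f \<in> \<Gamma>" if "f \<in> \<Gamma>" for f unfolding T_def using that uv by (intro comp_in finv_in)
    have T: "T f \<in> near \<delta> x y \<and> finv (T f) ` {x, y} = H" if f: "f \<in> F G" for f
    proof -
      have fG: "f \<in> \<Gamma>" using f DG by (auto simp: F_def D_def)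
      have "finv (T f) = finv v \<circ> (u \<circ> finv f)"
        unfolding T_def using fG uv by (simp add: comp_in finv_in)
      then have "finv (T f) ` {x, y} = finv v ` (u ` (finv f ` {x, y}))" by (simp add: image_comp)
      also have "finv f ` {x, y} = finv u ` {x, y}" using f u by (simp add: F_def)
      also have "finv v ` (u ` (finv u ` {x, y})) = finv v ` {x, y}" using uv by simp
      finally have eq: "finv (T f) ` {x, y} = finv v ` {x, y}" .
      have "norm (finv (T f) x - finv (T f) y) = norm (finv v x - finv v y)"
        using eq by (auto simp: doubleton_eq_iff norm_minus_commute)
      then show ?thesis using eq v TG[OF fG] by (simp add: D_def near_def)
    qed
    have "\<forall>f\<in>F G. \<exists>k. gpow g k \<circ> T f \<in> D" using rep T by blast
    then obtain k where k: "\<And>f. f \<in> F G \<Longrightarrow> gpow g (k f) \<circ> T f \<in> D" by metis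
    have "inj_on (\<lambda>f. gpow g (k f) \<circ> T f) (F G)"
    proof
      fix f h assume f: "f \<in> F G" and h: "h \<in> F G" and e: "gpow g (k f) \<circ> T f = gpow g (k h) \<circ> T h"
      have "gpow g (k f) \<circ> f = gpow g (k h) \<circ> h"
      proof -
        have "(gpow g (k f) \<circ> T f) \<circ> (finv v \<circ> u) = (gpow g (k h) \<circ> T h) \<circ> (finv v \<circ> u)" using e by simp
        then show ?thesis using uv by (simp add: T_def comp_assoc)
      qed
      then have "gpow g (- k f) \<circ> (gpow g (k f) \<circ> f) = gpow g (- k f) \<circ> (gpow g (k h) \<circ> h)" by simp
      then have "f = gpow g (- k f + k h) \<circ> h"
        using gpow(2)[OF g, of "- k f" "k f"] gpow(2)[OF g, of "- k f" "k h"] gpow(3)[OF g]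
        by (simp add: comp_assoc[symmetric])
      moreover have "f \<in> D" "h \<in> D" using f h unfolding F_def by blast+
      ultimately show "f = h" using unique by blast
    qed
    moreover have "(\<lambda>f. gpow g (k f) \<circ> T f) ` F G \<subseteq> F H"
    proof
      fix w assume "w \<in> (\<lambda>f. gpow g (k f) \<circ> T f) ` F G"
      then obtain f where f: "f \<in> F G" "w = gpow g (k f) \<circ> T f" by blast
      have "T f \<in> \<Gamma>" using T[OF f(1)] DG by blast
      then show "w \<in> F H" using k[OF f(1)] T[OF f(1)] fz[of "T f" "k f"] f(2) unfolding F_def by blast
    qed
    moreover have "finite (F H)" using finD by (simp add: F_def)
    ultimately show ?thesis by (rule card_inj_on_le)
  qed
  \<comment> \<open>If no geodesic of the orbit is \<delta>-separated, then \<open>D\<close> is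
    empty as well and 0 serves as the multiplicity.\<close>
  define m where "m = (if \<O> = {} then 0 else card (F (SOME G. G \<in> \<O>)))"
  have m: "card (F G) = m" if "G \<in> \<O>" for G
  proof -
    have s: "(SOME G. G \<in> \<O>) \<in> \<O>" using that by (rule someI)
    have "\<O> \<noteq> {}" using that by blast
    then show ?thesis using fib_le[OF that s] fib_le[OF s that] by (simp add: m_def)
  qed
  have "finite \<O>" using finD image[symmetric] by simp
  have "(\<Sum>f\<in>D. \<phi> (finv f ` {x, y})) = m * sum \<phi> \<O>" for \<phi> :: "complex set \<Rightarrow> real"
  proof -
    have "(\<Sum>f\<in>D. \<phi> (finv f ` {x, y})) = (\<Sum>G\<in>\<O>. \<Sum>f\<in>F G. \<phi> (finv f ` {x, y}))"
      using sum.image_gen[OF finD, of "\<lambda>f. \<phi> (finv f ` {x, y})" "\<lambda>f. finv f ` {x, y}"] image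
      by (simp add: F_def)
    also have "\<dots> = (\<Sum>G\<in>\<O>. m * \<phi> G)"
    proof (rule sum.cong[OF refl])
      fix G assume "G \<in> \<O>"
      have "(\<Sum>f\<in>F G. \<phi> (finv f ` {x, y})) = (\<Sum>f\<in>F G. \<phi> G)" by (rule sum.cong) (auto simp: F_def)
      then show "(\<Sum>f\<in>F G. \<phi> (finv f ` {x, y})) = m * \<phi> G" using m[OF \<open>G \<in> \<O>\<close>] by simp
    qed
    finally show ?thesis by (simp add: sum_distrib_left)
  qed
  then show ?thesis using that \<open>finite \<O>\<close> unfolding \<O>_def by blast
qed

text \<open>For two distinct fixed points on the circle the distance formula says that the product
  of their derivatives is 1. A third fixed point would thus force equal derivatives at
  \<open>x\<close> and \<open>y\<close>, that is, position 1.\<close>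

lemma hyperbolic_fixed_points:
  assumes g: "g \<in> \<Gamma>" and n: "norm x = 1" "norm y = 1" and fixed: "g x = x" "g y = y"
    and one: "1 < geo_pos x y g"
  shows "{z. norm z = 1 \<and> g z = z} = {x, y}"
proof -
  have "z = x \<or> z = y" if z: "norm z = 1" "g z = z" for z
  proof (rule ccontr)
    assume ne: "\<not> (z = x \<or> z = y)"
    have f: "finv g x = x" "finv g y = y" "finv g z = z" using fixed z g by (metis finv_f(1))+
    have J: "sqrt_deriv g x > 0" "sqrt_deriv g y > 0" "sqrt_deriv g z > 0"
      using deriv_pos[OF g] n z by auto
    have "norm (x - z) = norm (x - z) * sqrt_deriv g x * sqrt_deriv g z"
      "norm (y - z) = norm (y - z) * sqrt_deriv g y * sqrt_deriv g z"
      using norm_diff_finv[OF g, of x z] norm_diff_finv[OF g, of y z] f n z by simp_all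
    then have "sqrt_deriv g x * sqrt_deriv g z = sqrt_deriv g y * sqrt_deriv g z"
    proof -
      have "norm (x - z) \<noteq> 0" "norm (y - z) \<noteq> 0" using ne by auto
      then show ?thesis
        using \<open>norm (x - z) = _\<close> \<open>norm (y - z) = _\<close> by (metis mult.assoc mult_cancel_left1)
    qed
    then have "sqrt_deriv g x = sqrt_deriv g y" using J by simp
    then show False using one J by (simp add: geo_pos_def)
  qed
  then show ?thesis using n fixed by auto
qed

text \<open>Needed for the maximum in \<open>root_exponent\<close>. A root \<open>h\<close> commutes
  with \<open>g\<close>, hence permutes \<open>x\<close> and \<open>y\<close>. If it fixes them, its
  first \<open>k\<close> powers are distinct elements near the axis with positions up to that of
  \<open>g\<close>, and these are finitely many. If it exchanges them, \<open>h \<circ> h\<close>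
  has position 1 and so has \<open>g \<circ> g\<close>, a contradiction.\<close>

lemma finite_roots:
  assumes g: "g \<in> \<Gamma>" and n: "norm x = 1" "norm y = 1" and fixed: "g x = x" "g y = y"
    and one: "1 < geo_pos x y g"
  shows "finite {k. \<exists>h\<in>\<Gamma>. g = h ^^ k}"
proof -
  define d where "d = norm (x - y)"
  have "x \<noteq> y"
  proof
    assume "x = y"
    then have "geo_pos x y g = 1" using deriv_pos[OF g, of y] n by (simp add: geo_pos_def)
    then show False using one by simp
  qed
  then have d: "d > 0" by (simp add: d_def)
  define F where "F = {f \<in> near d x y. 1 \<le> geo_pos x y f \<and> geo_pos x y f \<le> geo_pos x y g}"
  have finF: "finite F" unfolding F_def by (rule finite_near_between[OF d n]) simp
  have pow_in: "h ^^ k \<in> \<Gamma>" if "h \<in> \<Gamma>" for h k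
    using that by (induction k) (auto simp: id_in comp_in simp flip: id_def)
  have pow_fix: "(h ^^ k) z = z" if "h z = z" for h k and z :: complex
    using that by (induction k) auto
  have pow_pos: "geo_pos x y (h ^^ k) = geo_pos x y h ^ k" if h: "h \<in> \<Gamma>" "h x = x" "h y = y" for h k
  proof (induction k)
    case 0
    then show ?case using geo_pos_id by (simp flip: id_def)
  next
    case (Suc k)
    have "geo_pos x y (h \<circ> h ^^ k) = geo_pos x y (h ^^ k) * geo_pos x y h"
      using geo_pos_comp[OF pow_in[OF h(1), of k] h(1) n] h by simp
    then show ?case using Suc by (simp only: funpow.simps power_Suc mult.commute)
  qed
  have "k \<le> card F" if "h \<in> \<Gamma>" "g = h ^^ k" for h k
  proof -
    have comm: "h (g z) = g (h z)" for z using that(2) by (simp add: funpow_swap1)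
    have "h x \<in> {x, y}" "h y \<in> {x, y}"
      using hyperbolic_fixed_points[OF g n fixed one] comm[of x] comm[of y] fixed n that(1)
      by (metis (mono_tags, lifting) mem_Collect_eq norm_in_1(1))+
    moreover have "h x \<noteq> h y" using in_eq_iff[OF that(1)] \<open>x \<noteq> y\<close> by blast
    ultimately consider "h x = x" "h y = y" | "h x = y" "h y = x" by auto
    then show ?thesis
    proof cases
      case 1
      have gk: "geo_pos x y h ^ k = geo_pos x y g" using pow_pos[OF that(1) 1, of k] that(2) by simp
      have pos: "geo_pos x y h > 0" using geo_pos_pos that(1) n by blast
      have h1: "geo_pos x y h > 1"
      proof (rule ccontr)
        assume "\<not> ?thesis"
        then have "geo_pos x y h ^ k \<le> 1" using pos by (simp add: power_le_one)
        then show False using gk one by simp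
      qed
      have "(\<lambda>j. h ^^ j) ` {1..k} \<subseteq> F"
      proof
        fix f assume "f \<in> (\<lambda>j. h ^^ j) ` {1..k}"
        then obtain j where j: "j \<le> k" "f = h ^^ j" by auto
        have fG: "f \<in> \<Gamma>" using pow_in that j by simp
        have "f x = x" "f y = y" using pow_fix 1 j by auto
        then have "finv f x = x" "finv f y = y" using fG by (metis finv_f(1))+
        moreover have "1 \<le> geo_pos x y h ^ j" "geo_pos x y h ^ j \<le> geo_pos x y h ^ k"
          using h1 j by (auto intro: one_le_power power_increasing)
        ultimately show "f \<in> F"
          using fG pow_pos[OF that(1) 1, of j] j gk by (simp add: F_def near_def d_def)
      qed
      moreover have "inj_on (\<lambda>j. h ^^ j) {1..k}"
      proof
        fix i j assume "h ^^ i = h ^^ j"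
        then have "geo_pos x y h ^ i = geo_pos x y h ^ j" using pow_pos[OF that(1) 1] by metis
        then show "i = j" using h1 by (simp add: power_inject_exp)
      qed
      ultimately have "card {1..k} \<le> card F" using finF by (intro card_inj_on_le)
      then show ?thesis by simp
    next
      case 2
      have hh: "h \<circ> h \<in> \<Gamma>" "(h \<circ> h) x = x" "(h \<circ> h) y = y" using 2 that comp_in by auto
      have "geo_pos x y (h \<circ> h) = geo_pos y x h * geo_pos x y h"
        using geo_pos_comp[OF that(1) that(1) n(2,1)] 2 by simp
      also have "\<dots> = 1" using geo_pos_swap[of y x h] geo_pos_pos[OF that(1) n] by simp
      finally have hh1: "geo_pos x y (h \<circ> h) = 1" .
      have "geo_pos x y ((h \<circ> h) ^^ k) = 1" by (simp only: pow_pos[OF hh, of k] hh1 power_one)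
      moreover have "(h \<circ> h) ^^ k = g \<circ> g"
      proof -
        have "(h \<circ> h) ^^ j = h ^^ j \<circ> h ^^ j" for j
          by (induction j) (auto simp: fun_eq_iff funpow_swap1)
        then show ?thesis using that(2) by simp
      qed
      moreover have "geo_pos x y (g \<circ> g) = geo_pos x y g * geo_pos x y g"
        using geo_pos_comp[OF g g n] fixed by simp
      moreover have "geo_pos x y g * geo_pos x y g > 1 * 1" using one by (intro mult_strict_mono) auto
      ultimately show ?thesis by simp
    qed
  qed
  then have "{k. \<exists>h\<in>\<Gamma>. g = h ^^ k} \<subseteq> {..card F}" by auto
  then show ?thesis using finite_subset by blast
qed

end

section \<open>The deck group\<close>

definition ext :: "(complex \<Rightarrow> complex) \<Rightarrow> complex \<Rightarrow> complex" where
  "ext g z = (if norm z \<le> 1 then g z else z)"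

definition deck_auts :: "(complex \<Rightarrow> 'a) \<Rightarrow> (complex \<Rightarrow> complex) set" where
  "deck_auts p = {f. disc_aut f \<and> (\<forall>z\<in>ball 0 1. p (f z) = p z)}"

lemma disc_map_scale:
  assumes "s \<noteq> 0"
  shows "disc_map (complex_of_real s * a) (complex_of_real s * b) z = disc_map a b z"
proof -
  have "disc_map (complex_of_real s * a) (complex_of_real s * b) z
    = (complex_of_real s * (a * z + b)) / (complex_of_real s * (cnj b * z + cnj a))"
    by (simp add: disc_map_def algebra_simps)
  then show ?thesis using assms by (simp add: disc_map_def)
qed

lemma disc_aut_ext:
  assumes "g \<in> disc_isometries"
  shows "disc_aut (ext g)"
proof -
  obtain a b where g: "g = disc_map a b" and ab: "norm b < norm a"
    using assms unfolding disc_isometries_def by blast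
  have "(norm b)\<^sup>2 < (norm a)\<^sup>2" using power_strict_mono[OF ab, of 2] by simp
  then have pos: "(norm a)\<^sup>2 - (norm b)\<^sup>2 > 0" by simp
  define d where "d = (norm a)\<^sup>2 - (norm b)\<^sup>2"
  define s where "s = 1 / sqrt d"
  have "d > 0" using pos by (simp only: d_def)
  then have s: "s \<noteq> 0" "s\<^sup>2 * d = 1" by (simp_all add: s_def power_divide)
  have "(norm (complex_of_real s * a))\<^sup>2 - (norm (complex_of_real s * b))\<^sup>2 = 1"
    using s(2) by (simp add: d_def norm_mult power_mult_distrib right_diff_distrib)
  then show ?thesis
    unfolding disc_aut_def unit_det_iff ext_def g
    by (intro exI[of _ "complex_of_real s * a"] exI[of _ "complex_of_real s * b"])
      (simp add: disc_map_scale s)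
qed

lemma deck_auts_eq: "deck_auts p = ext ` deck_group p"
proof (intro equalityI subsetI)
  fix f assume f: "f \<in> deck_auts p"
  then obtain a b where ab: "a * cnj a - b * cnj b = 1" and fe: "\<forall>z. f z = (if norm z \<le> 1 then disc_map a b z else z)"
    by (auto simp: deck_auts_def disc_aut_def)
  have "norm b < norm a"
    using ab unfolding unit_det_iff by (smt (verit) norm_ge_zero power_mono)
  then have "disc_map a b \<in> disc_isometries" unfolding disc_isometries_def by blast
  moreover have "p (disc_map a b z) = p z" if "z \<in> ball 0 1" for z
    using f fe that by (auto simp: deck_auts_def)
  ultimately have "disc_map a b \<in> deck_group p" by (simp add: deck_group_def)
  moreover have "f = ext (disc_map a b)" using fe by (auto simp: ext_def)
  ultimately show "f \<in> ext ` deck_group p" by blast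
next
  fix f assume "f \<in> ext ` deck_group p"
  then obtain g where g: "g \<in> deck_group p" "f = ext g" by blast
  then show "f \<in> deck_auts p"
    using disc_aut_ext[of g] by (auto simp: deck_auts_def deck_group_def ext_def)
qed

lemma ext_image: "(\<And>z. z \<in> A \<Longrightarrow> norm z \<le> 1) \<Longrightarrow> ext g ` A = g ` A"
  by (auto simp: ext_def)

text \<open>Both maps are lifts of \<open>p\<close> through \<open>p\<close> itself, so agreement at
  one point spreads over the open disc by uniqueness of lifts and to the circle by continuity; off
  the closed disc both are the identity.\<close>

lemma deck_auts_free:
  assumes cov: "covering_space (ball 0 1) p S"
    and f: "f \<in> deck_auts p" and h: "h \<in> deck_auts p" and z: "norm z < 1" "f z = h z"
  shows "f = h"
proof -
  have a: "disc_aut f" "disc_aut h" using f h by (auto simp: deck_auts_def)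
  have c: "continuous_on (cball 0 1) f" "continuous_on (cball 0 1) h" using disc_aut_continuous a by auto
  have m: "f \<in> ball 0 1 \<rightarrow> ball 0 1" "h \<in> ball 0 1 \<rightarrow> ball 0 1" using disc_aut_norm(1)[OF a(1)] disc_aut_norm(1)[OF a(2)] by auto
  have pc: "continuous_on (ball 0 1) p" "p \<in> ball 0 1 \<rightarrow> S"
    using covering_space_imp_continuous[OF cov] covering_space_imp_surjective[OF cov] by auto
  have ball: "f w = h w" if "w \<in> ball 0 1" for w
    by (rule covering_space_lift_unique[OF cov z(2) pc _ m(1) _ _ m(2) _ _ _ that])
      (use f h z in \<open>auto simp: deck_auts_def intro!: continuous_on_subset[OF c(1)] continuous_on_subset[OF c(2)]\<close>)
  have "f w - h w = 0" if "norm w \<le> 1" for w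
  proof (rule continuous_constant_on_closure[of "ball 0 1" "\<lambda>w. f w - h w" 0 w])
    show "continuous_on (closure (ball 0 1)) (\<lambda>w. f w - h w)"
      using c by (simp add: continuous_on_diff)
  qed (use ball that in auto)
  moreover have "f w = w" "h w = w" if "\<not> norm w \<le> 1" for w using a that by (auto simp: disc_aut_def)
  ultimately show ?thesis by (metis eq_iff_diff_eq_0 ext)
qed

text \<open>Discreteness: an accumulation point of the orbit of 0 in the disc would have a
  neighbourhood on which \<open>p\<close> is injective, although \<open>p\<close> is constant on the
  orbit. Cocompactness: every point of \<open>S\<close> has a neighbourhood covered by the image of
  a disc of radius below 1, and finitely many such neighbourhoods suffice.\<close>

lemma fuchsian_deck_auts:
  assumes S: "compact S" and hyp: "hyperbolic_structure S p"
  shows "fuchsian_group (deck_auts p)"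
proof
  have cov: "covering_space (ball 0 1) p S" using hyp by (simp add: hyperbolic_structure_def)
  have id: "id \<in> deck_auts p" by (simp add: deck_auts_def disc_aut_id)
  then show "id \<in> deck_auts p" .
  show "disc_aut f" if "f \<in> deck_auts p" for f using that by (simp add: deck_auts_def)
  show "f \<circ> h \<in> deck_auts p" if "f \<in> deck_auts p" "h \<in> deck_auts p" for f h
    using that disc_aut_comp disc_aut_norm(1)[of h] by (auto simp: deck_auts_def)
  show "finv f \<in> deck_auts p" if f: "f \<in> deck_auts p" for f
  proof -
    have a: "disc_aut f" "bij f" "disc_aut (finv f)" using f disc_aut_inverse by (auto simp: deck_auts_def)
    have "p (finv f z) = p z" if "z \<in> ball 0 1" for z
    proof -
      have "finv f z \<in> ball 0 1" using disc_aut_norm(1)[OF a(3)] that by simp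
      then have "p (f (finv f z)) = p (finv f z)" using f by (simp add: deck_auts_def)
      then show ?thesis using a(2) by (simp add: bij_is_surj surj_f_inv_f)
    qed
    then show ?thesis using a by (simp add: deck_auts_def)
  qed
  show "f = id" if "f \<in> deck_auts p" "norm z < 1" "f z = z" for f z
    using deck_auts_free[OF cov that(1) id that(2)] that(3) by simp
  show "finite {f \<in> deck_auts p. norm (f 0) \<le> r}" (is "finite ?F") if r: "r < 1" for r
  proof (rule ccontr)
    assume inf: "infinite ?F"
    have "inj_on (\<lambda>f. f 0) ?F"
      using deck_auts_free[OF cov] by (intro inj_onI) (auto intro: deck_auts_free[OF cov, of _ _ 0])
    then have "infinite ((\<lambda>f. f 0) ` ?F)" using inf finite_imageD by blast
    moreover have "(\<lambda>f. f 0) ` ?F \<subseteq> cball 0 r" by auto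
    ultimately obtain w where w: "w \<in> cball 0 r" "w islimpt ((\<lambda>f. f 0) ` ?F)"
      using compact_cball[of "0::complex" r] unfolding compact_eq_Bolzano_Weierstrass by blast
    have "w \<in> ball 0 1" using w(1) r by auto
    then obtain T u q where T: "w \<in> T" "openin (top_of_set (ball 0 1)) T" "homeomorphism T u p q"
      using covering_space_local_homeomorphism[OF cov] by metis
    have "open T" using T(2) by (metis open_ball openin_open_eq)
    define X where "X = T \<inter> (\<lambda>f. f 0) ` ?F"
    have X: "infinite X"
      using w(2) T(1) \<open>open T\<close> unfolding X_def islimpt_eq_acc_point by blast
    obtain a where a: "a \<in> X" using infinite_imp_nonempty[OF X] by blast
    obtain b where b: "b \<in> X - {a}" using infinite_imp_nonempty[OF infinite_remove[OF X]] by blast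
    have ab: "a \<in> T" "b \<in> T" "a \<in> (\<lambda>f. f 0) ` ?F" "b \<in> (\<lambda>f. f 0) ` ?F" "a \<noteq> b"
      using a b unfolding X_def by blast+
    have "p a = p 0" "p b = p 0" using ab by (auto simp: deck_auts_def)
    then have "a = b" using homeomorphism_apply1[OF T(3), of a] homeomorphism_apply1[OF T(3), of b] ab by auto
    then show False using ab by simp
  qed
  show "\<exists>r<1. \<forall>z. norm z < 1 \<longrightarrow> (\<exists>f\<in>deck_auts p. norm (f z) \<le> r)"
  proof -
    have "\<exists>r U. r < 1 \<and> openin (top_of_set S) U \<and> x \<in> U \<and> U \<subseteq> p ` (ball 0 1 \<inter> cball 0 r)" if x: "x \<in> S" for x
    proof -
      obtain z where z: "z \<in> ball 0 1" "p z = x"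
        using x covering_space_imp_surjective[OF cov] by blast
      obtain T u q where T: "z \<in> T" "openin (top_of_set (ball 0 1)) T" "p z \<in> u" "openin (top_of_set S) u" "homeomorphism T u p q"
        using covering_space_local_homeomorphism[OF cov z(1)] .
      define r where "r = (1 + norm z) / 2"
      have r: "norm z < r" "r < 1" using z by (auto simp: r_def)
      have "openin (top_of_set T) (T \<inter> ball 0 r)" by (simp add: openin_open_Int)
      then have "openin (top_of_set u) (p ` (T \<inter> ball 0 r))"
        using homeomorphism_imp_open_map[OF T(5)] by blast
      then have "openin (top_of_set S) (p ` (T \<inter> ball 0 r))" using T(4) openin_trans by blast
      moreover have "p ` (T \<inter> ball 0 r) \<subseteq> p ` (ball 0 1 \<inter> cball 0 r)"
        using openin_imp_subset[OF T(2)] by auto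
      moreover have "x \<in> p ` (T \<inter> ball 0 r)" using T(1) r(1) z(2) by auto
      ultimately show ?thesis using r(2) by blast
    qed
    then obtain r U where rU: "\<And>x. x \<in> S \<Longrightarrow> r x < 1" "\<And>x. x \<in> S \<Longrightarrow> openin (top_of_set S) (U x)"
      "\<And>x. x \<in> S \<Longrightarrow> x \<in> U x" "\<And>x. x \<in> S \<Longrightarrow> U x \<subseteq> p ` (ball 0 1 \<inter> cball 0 (r x))"
      by metis
    have "compactin (top_of_set S) S" using S by (simp add: compactin_subtopology)
    moreover have "openin (top_of_set S) V" if "V \<in> U ` S" for V using that rU(2) by blast
    moreover have "S \<subseteq> \<Union>(U ` S)" using rU(3) by blast
    ultimately have "\<exists>\<F>. finite \<F> \<and> \<F> \<subseteq> U ` S \<and> S \<subseteq> \<Union>\<F>" by (rule compactinD)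
    then obtain \<F> where F: "finite \<F>" "\<F> \<subseteq> U ` S" "S \<subseteq> \<Union>\<F>" by blast
    obtain T where T: "T \<subseteq> S" "finite T" "\<F> = U ` T" using finite_subset_image[OF F(1,2)] by blast
    \<comment> \<open>The inserted 0 keeps the maximum defined for an empty subcover.\<close>
    define \<rho> where "\<rho> = Max (insert 0 (r ` T))"
    have "\<rho> < 1" unfolding \<rho>_def using T rU(1) by (subst Max_less_iff) auto
    have "\<exists>f\<in>deck_auts p. norm (f z) \<le> \<rho>" if z: "norm z < 1" for z
    proof -
      have "p z \<in> S" using z covering_space_imp_surjective[OF cov] by auto
      then obtain x where x: "x \<in> T" "p z \<in> U x" using F T by blast
      then have "p z \<in> p ` (ball 0 1 \<inter> cball 0 (r x))" using rU(4)[of x] T by blast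
      then obtain w where w0: "p z = p w" "w \<in> ball 0 1 \<inter> cball 0 (r x)" by (rule imageE)
      then have w: "w \<in> ball 0 1" "norm w \<le> r x" by auto
      obtain g where g: "g \<in> deck_group p" "g z = w"
        using hyp w(1) w0(1) z unfolding hyperbolic_structure_def by (metis dist_0_norm mem_ball)
      have "r x \<le> \<rho>" unfolding \<rho>_def using T x by (intro Max_ge) auto
      moreover have "ext g z = w" using g z by (simp add: ext_def)
      moreover have "ext g \<in> deck_auts p" using g deck_auts_eq by blast
      ultimately show ?thesis using w(2) by (intro bexI[of _ "ext g"]) auto
    qed
    then show ?thesis using \<open>\<rho> < 1\<close> by blast
  qed
qed

text \<open>The curve is the projection of the segment from 0 to \<open>g 0\<close>. As
  \<open>holonomy\<close> is a choice, it returns only some conjugate of \<open>g\<close>;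
  conjugation moves the axis within its orbit and preserves the translation along it, which suffices
  for the conclusions.\<close>

lemma closed_curve_of_hyperbolic:
  assumes S: "compact S" and hyp: "hyperbolic_structure S p"
    and g: "g \<in> deck_auts p" and n: "norm x = 1" "norm y = 1" and fixed: "g x = x" "g y = y"
    and one: "1 < geo_pos x y g"
  obtains c where "closed_curve S c" "holonomy p c \<noteq> id" "1 \<le> root_exponent p (holonomy p c)"
    "{f ` axis_ends (holonomy p c) | f. f \<in> deck_group p} = {h ` {x, y} | h. h \<in> deck_auts p}"
proof -
  interpret fuchsian_group "deck_auts p" by (rule fuchsian_deck_auts[OF S hyp])
  have cov: "covering_space (ball 0 1) p S" using hyp by (simp add: hyperbolic_structure_def)
  have pc: "continuous_on (ball 0 1) p" and pS: "p ` ball 0 1 = S"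
    using covering_space_imp_continuous[OF cov] covering_space_imp_surjective[OF cov] by auto
  define l where "l = linepath 0 (g 0)"
  have g0: "g 0 \<in> ball 0 1" using norm_in(3)[OF g, of 0] by simp
  have pl: "path l" "path_image l \<subseteq> ball 0 1" "pathstart l = 0" "pathfinish l = g 0"
    using closed_segment_subset[OF _ g0, of 0] by (auto simp: l_def)
  define c where "c = p \<circ> l"
  have cc: "closed_curve S c"
  proof -
    have "path c" unfolding c_def
      by (rule path_continuous_image[OF pl(1) continuous_on_subset[OF pc pl(2)]])
    moreover have "path_image c \<subseteq> S" unfolding c_def path_image_compose using pl(2) pS by blast
    moreover have "p (g 0) = p 0" using g by (simp add: deck_auts_def)
    then have "pathfinish c = pathstart c" unfolding c_def pathfinish_compose pathstart_compose pl by simp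
    ultimately show ?thesis by (simp add: closed_curve_def)
  qed
  define P where "P g' \<longleftrightarrow> g' \<in> deck_group p \<and>
     (\<exists>c'. path c' \<and> path_image c' \<subseteq> ball 0 1 \<and> (\<forall>t\<in>{0..1}. p (c' t) = c t) \<and>
        g' (pathstart c') = pathfinish c')" for g'
  obtain g1 where g1: "g1 \<in> deck_group p" "g = ext g1" using g deck_auts_eq by blast
  have "g1 0 = g 0" by (simp add: g1 ext_def)
  then have "P g1" unfolding P_def using g1 pl by (auto simp: c_def intro!: exI[of _ l])
  moreover define k where "k = holonomy p c"
  have "k = (SOME g'. P g')" unfolding k_def holonomy_def P_def ..
  ultimately have "P k" by (metis someI)
  then obtain c' where k: "k \<in> deck_group p" and c': "path c'" "path_image c' \<subseteq> ball 0 1"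
     "\<And>t. t \<in> {0..1} \<Longrightarrow> p (c' t) = c t" "k (pathstart c') = pathfinish c'"
    unfolding P_def by blast
  have c01: "c' 0 \<in> ball 0 1" "c' 1 \<in> ball 0 1" using subsetD[OF c'(2)] unfolding path_image_def by force+
  have "p (c' 0) = p 0" using c'(3)[of 0] pl(3) by (simp add: c_def pathstart_def)
  then obtain f0 where f0: "f0 \<in> deck_group p" "f0 0 = c' 0"
    using hyp c01 unfolding hyperbolic_structure_def by (metis centre_in_ball zero_less_one)
  define f where "f = ext f0"
  have f: "f \<in> deck_auts p" "f 0 = c' 0" using f0 deck_auts_eq by (auto simp: f_def ext_def)
  \<comment> \<open>The lift behind the chosen holonomy starts over \<open>p 0\<close>, so it is the
    translate of the segment by a deck element \<open>f\<close>, and the chosen element is the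
    conjugate of \<open>g\<close> by \<open>f\<close>.\<close>
  have fl: "(f \<circ> l) t = c' t" if "t \<in> {0..1}" for t
  proof (rule covering_space_lift_unique[OF cov, of "f \<circ> l" 0 c' "{0..1}" c t])
    show "(f \<circ> l) 0 = c' 0" using pl(3) f(2) by (simp add: pathstart_def)
    show "continuous_on {0..1} c" using cc by (simp add: closed_curve_def path_def)
    show "c \<in> {0..1} \<rightarrow> S" using cc by (auto simp: closed_curve_def path_image_def)
    have sub: "l ` {0..1} \<subseteq> ball 0 1" using pl(2) by (simp add: path_image_def)
    show "continuous_on {0..1} (f \<circ> l)"
    proof (rule continuous_on_compose)
      show "continuous_on {0..1} l" using pl(1) by (simp add: path_def)
      show "continuous_on (l ` {0..1}) f"
        by (rule continuous_on_subset[OF disc_aut_continuous[OF aut[OF f(1)]]])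
          (use sub ball_subset_cball in blast)
    qed
    show "f \<circ> l \<in> {0..1} \<rightarrow> ball 0 1" using sub norm_in(3)[OF f(1)] by auto
    show "c s = p ((f \<circ> l) s)" if "s \<in> {0..1}" for s
    proof -
      have "l s \<in> ball 0 1" using sub that by blast
      then have "p (f (l s)) = p (l s)" using f(1) unfolding deck_auts_def by blast
      then show ?thesis by (simp add: c_def)
    qed
    show "continuous_on {0..1} c'" using c'(1) by (simp add: path_def)
    show "c' \<in> {0..1} \<rightarrow> ball 0 1" using c'(2) by (auto simp: path_image_def)
    show "c s = p (c' s)" if "s \<in> {0..1}" for s using c'(3) that by simp
  qed (use that in auto)
  define K where "K = ext k"
  have K: "K \<in> deck_auts p" using k deck_auts_eq by (auto simp: K_def)
  have "K \<circ> f = f \<circ> g"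
  proof (rule deck_auts_free[OF cov comp_in[OF K f(1)] comp_in[OF f(1) g], of 0])
    have "c' 1 = f (g 0)" using fl[of 1] pl(4) by (simp add: pathfinish_def)
    moreover have "K (c' 0) = c' 1" using c'(4) c01 by (simp add: K_def ext_def pathstart_def pathfinish_def)
    ultimately show "(K \<circ> f) 0 = (f \<circ> g) 0" using f(2) by simp
  qed simp
  then have Kf: "K (f z) = f (g z)" for z by (metis comp_apply)
  define u v where "u = f x" and "v = f y"
  have uv: "norm u = 1" "norm v = 1" "K u = u" "K v = v"
    using n f(1) Kf fixed by (simp_all add: u_def v_def)
  have pos: "geo_pos u v K = geo_pos x y g"
  proof -
    have "geo_pos u v (K \<circ> f) = geo_pos u v f * geo_pos u v K"
      using geo_pos_comp[OF f(1) K uv(1,2)] uv by simp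
    moreover have "geo_pos u v (f \<circ> g) = geo_pos x y g * geo_pos u v f"
      using geo_pos_comp[OF g f(1) n] by (simp add: u_def v_def)
    moreover have "geo_pos u v f > 0" using geo_pos_pos f uv by blast
    ultimately show ?thesis using \<open>K \<circ> f = f \<circ> g\<close> by simp
  qed
  have "axis_ends k = {z. norm z = 1 \<and> K z = z}"
    by (auto simp: axis_ends_def K_def ext_def)
  then have axis: "axis_ends k = {u, v}"
    using hyperbolic_fixed_points[OF K uv] pos one by simp
  have "k \<noteq> id"
  proof
    assume "k = id"
    then have "K = id" by (auto simp: K_def ext_def)
    then have "geo_pos u v K = 1" by simp
    then show False using pos one by simp
  qed
  moreover have "1 \<le> root_exponent p k"
  proof -
    define R where "R = {j. \<exists>h\<in>deck_group p. \<forall>z\<in>ball 0 1. k z = (h ^^ j) z}"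
    have "R \<subseteq> {j. \<exists>h\<in>deck_auts p. K = h ^^ j}"
    proof
      fix j assume "j \<in> R"
      then obtain h where h: "h \<in> deck_group p" "\<And>z. z \<in> ball 0 1 \<Longrightarrow> k z = (h ^^ j) z"
        unfolding R_def by blast
      define H where "H = ext h"
      have H: "H \<in> deck_auts p" using h deck_auts_eq by (auto simp: H_def)
      have pow: "H ^^ i \<in> deck_auts p" for i
        using H by (induction i) (auto simp: id_in comp_in simp flip: id_def)
      \<comment> \<open>Comparing powers at the origin is enough, since freeness turns agreement at
        one point into equality.\<close>
      have "(H ^^ i) 0 = (h ^^ i) 0" for i
      proof (induction i)
        case (Suc i)
        have "norm ((H ^^ i) 0) < 1" using norm_in(3)[OF pow, of i 0] by simp
        then have "H ((H ^^ i) 0) = h ((H ^^ i) 0)" by (simp add: H_def ext_def)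
        then show ?case using Suc by simp
      qed simp
      then have "K 0 = (H ^^ j) 0" using h(2)[of 0] by (simp add: K_def ext_def)
      then have "K = H ^^ j" using deck_auts_free[OF cov K pow, of 0] by simp
      then show "j \<in> {j. \<exists>h\<in>deck_auts p. K = h ^^ j}" using H by blast
    qed
    then have "finite R" using finite_roots[OF K uv] pos one finite_subset by simp
    moreover have "1 \<in> R" unfolding R_def using k by auto
    ultimately have "1 \<le> Max R" by simp
    then show ?thesis by (simp add: root_exponent_def R_def)
  qed
  moreover have "{f ` axis_ends k | f. f \<in> deck_group p} = {h ` {x, y} | h. h \<in> deck_auts p}"
  proof -
    have "{f ` axis_ends k | f. f \<in> deck_group p} = {h ` {u, v} | h. h \<in> deck_auts p}"
      unfolding deck_auts_eq axis using uv by (auto simp: ext_def) (metis ext_def order_refl image_eqI)+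
    also have "\<dots> = {h ` {x, y} | h. h \<in> deck_auts p}"
    proof (intro equalityI subsetI)
      fix G assume "G \<in> {h ` {u, v} | h. h \<in> deck_auts p}"
      then obtain h where "h \<in> deck_auts p" "G = h ` {u, v}" by blast
      then have "G = (h \<circ> f) ` {x, y}" "h \<circ> f \<in> deck_auts p" using f(1) comp_in by (auto simp: u_def v_def)
      then show "G \<in> {h ` {x, y} | h. h \<in> deck_auts p}" by blast
    next
      fix G assume "G \<in> {h ` {x, y} | h. h \<in> deck_auts p}"
      then obtain h where "h \<in> deck_auts p" "G = h ` {x, y}" by blast
      then have "G = (h \<circ> finv f) ` {u, v}" "h \<circ> finv f \<in> deck_auts p"
        using f(1) comp_in finv_in by (auto simp: u_def v_def)
      then show "G \<in> {h ` {u, v} | h. h \<in> deck_auts p}" by blast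
    qed
    finally show ?thesis .
  qed
  ultimately show ?thesis using that cc unfolding k_def by blast
qed

section \<open>The space of geodesics\<close>

lemma geodesicI: "norm x = 1 \<Longrightarrow> norm y = 1 \<Longrightarrow> x \<noteq> y \<Longrightarrow> {x, y} \<in> geodesics"
  unfolding geodesics_def ordered_ends_def by blast

lemma geodesicE:
  assumes "G \<in> geodesics"
  obtains x y where "G = {x, y}" "norm x = 1" "norm y = 1" "x \<noteq> y"
  using assms unfolding geodesics_def ordered_ends_def by blast

lemma space_geodesic_borel [simp]: "space geodesic_borel = geodesics"
  unfolding geodesic_borel_def
  by (rule space_measure_of) (metis mem_Collect_eq openin_subset subsetI PowI topspace_geodesic_topology)

lemma openin_sets_geodesic_borel: "openin geodesic_topology U \<Longrightarrow> U \<in> sets geodesic_borel"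
proof -
  assume U: "openin geodesic_topology U"
  have "{U. openin geodesic_topology U} \<subseteq> Pow geodesics"
    by (metis mem_Collect_eq openin_subset subsetI PowI topspace_geodesic_topology)
  then show ?thesis unfolding geodesic_borel_def using U by (auto simp: sets_measure_of)
qed

lemma continuous_map_geodesicI:
  fixes h :: "complex set \<Rightarrow> 'b::topological_space"
  assumes "continuous_on ordered_ends (\<lambda>z. h {fst z, snd z})"
  shows "continuous_map geodesic_topology euclidean h"
  unfolding continuous_map_def
proof (intro conjI allI impI)
  show "h \<in> topspace geodesic_topology \<rightarrow> topspace euclidean" by simp
  fix U :: "'b set" assume "openin euclidean U"
  then have "open U" by simp
  then have "openin (top_of_set ordered_ends) (ordered_ends \<inter> (\<lambda>z. h {fst z, snd z}) -` U)"
    using assms continuous_openin_preimage_gen by blast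
  moreover have "ordered_ends \<inter> (\<lambda>z. h {fst z, snd z}) -` U
     = {(x, y) \<in> ordered_ends. {x, y} \<in> {G \<in> geodesics. h G \<in> U}}"
    by (auto simp: geodesics_def)
  ultimately show "openin geodesic_topology {x \<in> topspace geodesic_topology. h x \<in> U}"
    unfolding openin_geodesic_topology topspace_geodesic_topology by auto
qed

lemma quotient_map_ends:
  "continuous_map (top_of_set ordered_ends) geodesic_topology (\<lambda>z. {fst z, snd z})"
  unfolding continuous_map_def
proof (intro conjI allI impI)
  show "(\<lambda>z. {fst z, snd z}) \<in> topspace (top_of_set ordered_ends) \<rightarrow> topspace geodesic_topology"
    unfolding topspace_geodesic_topology geodesics_def by fastforce
  fix U assume "openin geodesic_topology U"
  then have "openin (top_of_set ordered_ends) {(x, y) \<in> ordered_ends. {x, y} \<in> U}"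
    by (simp add: openin_geodesic_topology)
  moreover have "{(x, y) \<in> ordered_ends. {x, y} \<in> U} = {z \<in> topspace (top_of_set ordered_ends). {fst z, snd z} \<in> U}"
    by auto
  ultimately show "openin (top_of_set ordered_ends) {z \<in> topspace (top_of_set ordered_ends). {fst z, snd z} \<in> U}"
    by simp
qed

lemma continuous_map_geodesicD:
  fixes h :: "complex set \<Rightarrow> 'b::topological_space"
  assumes "continuous_map geodesic_topology euclidean h"
  shows "continuous_on ordered_ends (\<lambda>z. h {fst z, snd z})"
  using continuous_map_compose[OF quotient_map_ends assms] by (simp add: o_def)

lemma continuous_map_geodesic_measurable:
  fixes h :: "complex set \<Rightarrow> 'b::topological_space"
  assumes "continuous_map geodesic_topology euclidean h"
  shows "h \<in> borel_measurable geodesic_borel"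
proof (rule borel_measurableI)
  fix U :: "'b set" assume "open U"
  then have "openin geodesic_topology {G \<in> topspace geodesic_topology. h G \<in> U}"
    using assms by (auto simp: continuous_map_def)
  then show "h -` U \<inter> space geodesic_borel \<in> sets geodesic_borel"
    by (intro openin_sets_geodesic_borel) (simp add: topspace_geodesic_topology Int_def conj_commute)
qed

text \<open>The two endpoints are the roots of the polynomial with coefficients the sum and the product of
  the endpoints; this gives a measurable choice of an order on them.\<close>

definition end1 :: "complex set \<Rightarrow> complex" where
  "end1 G = (\<Sum>G + csqrt ((\<Sum>G)\<^sup>2 - 4 * \<Prod>G)) / 2"

definition end2 :: "complex set \<Rightarrow> complex" where
  "end2 G = (\<Sum>G - csqrt ((\<Sum>G)\<^sup>2 - 4 * \<Prod>G)) / 2"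

text \<open>A gauge of compactness: a set of geodesics lies in a compact set if and only if
  \<open>separation\<close> is bounded below on it by a positive number
  (\<open>compactin_separation\<close>, \<open>compactin_separated\<close>).\<close>

definition separation :: "complex set \<Rightarrow> real" where
  "separation G = norm (end1 G - end2 G)"

lemma ends_doubleton:
  assumes "x \<noteq> y"
  shows "end1 {x, y} = x \<and> end2 {x, y} = y \<or> end1 {x, y} = y \<and> end2 {x, y} = x"
proof -
  have s: "\<Sum>{x, y} = x + y" "\<Prod>{x, y} = x * y" using assms by auto
  have "(\<Sum>{x, y})\<^sup>2 - 4 * \<Prod>{x, y} = (x - y)\<^sup>2"
    unfolding s by (simp add: power2_eq_square algebra_simps)
  moreover have "csqrt ((x - y)\<^sup>2) = x - y \<or> csqrt ((x - y)\<^sup>2) = - (x - y)"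
    by (metis power2_csqrt power2_eq_iff)
  ultimately show ?thesis unfolding end1_def end2_def s by auto
qed

lemma geodesic_ends:
  assumes "G \<in> geodesics"
  shows "G = {end1 G, end2 G}" "norm (end1 G) = 1" "norm (end2 G) = 1" "end1 G \<noteq> end2 G"
proof -
  obtain x y where "G = {x, y}" "norm x = 1" "norm y = 1" "x \<noteq> y" using assms by (rule geodesicE)
  then show "G = {end1 G, end2 G}" "norm (end1 G) = 1" "norm (end2 G) = 1" "end1 G \<noteq> end2 G"
    using ends_doubleton[of x y] by auto
qed

lemma separation_doubleton: "x \<noteq> y \<Longrightarrow> separation {x, y} = norm (x - y)"
  using ends_doubleton[of x y] by (auto simp: separation_def norm_minus_commute)

lemma continuous_on_ends_sym:
  "continuous_map geodesic_topology euclidean (\<lambda>G. \<Sum>G :: complex)"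
  "continuous_map geodesic_topology euclidean (\<lambda>G. \<Prod>G :: complex)"
  "continuous_map geodesic_topology euclidean separation"
proof -
  have "continuous_on ordered_ends (\<lambda>z. fst z + snd z :: complex)" by (intro continuous_intros)
  then have "continuous_on ordered_ends (\<lambda>z. \<Sum>{fst z, snd z} :: complex)"
    by (rule continuous_on_eq) (auto simp: ordered_ends_def)
  then show "continuous_map geodesic_topology euclidean (\<lambda>G. \<Sum>G :: complex)" by (rule continuous_map_geodesicI)
  have "continuous_on ordered_ends (\<lambda>z. fst z * snd z :: complex)" by (intro continuous_intros)
  then have "continuous_on ordered_ends (\<lambda>z. \<Prod>{fst z, snd z} :: complex)"
    by (rule continuous_on_eq) (auto simp: ordered_ends_def)
  then show "continuous_map geodesic_topology euclidean (\<lambda>G. \<Prod>G :: complex)" by (rule continuous_map_geodesicI)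
  have "continuous_on ordered_ends (\<lambda>z. norm (fst z - snd z))" by (intro continuous_intros)
  then have "continuous_on ordered_ends (\<lambda>z. separation {fst z, snd z})"
    by (rule continuous_on_eq) (auto simp: ordered_ends_def separation_doubleton)
  then show "continuous_map geodesic_topology euclidean separation" by (rule continuous_map_geodesicI)
qed

text \<open>\<open>csqrt\<close> jumps across the negative real axis, so measurability is read off
  from the formulas for the real and imaginary parts.\<close>

lemma measurable_csqrt: "csqrt \<in> borel_measurable borel"
proof -
  have "(\<lambda>z. Re (csqrt z)) \<in> borel_measurable borel" "(\<lambda>z. Im (csqrt z)) \<in> borel_measurable borel"
    unfolding csqrt.simps sgn_real_def by measurable
  then show ?thesis unfolding borel_measurable_complex_iff by simp
qed

lemma measurable_ends [measurable]:
  "end1 \<in> borel_measurable geodesic_borel" "end2 \<in> borel_measurable geodesic_borel"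
  "separation \<in> borel_measurable geodesic_borel"
proof -
  note [measurable] = measurable_csqrt continuous_on_ends_sym[THEN continuous_map_geodesic_measurable]
  show "end1 \<in> borel_measurable geodesic_borel" unfolding end1_def[abs_def] by measurable
  show "end2 \<in> borel_measurable geodesic_borel" unfolding end2_def[abs_def] by measurable
  show "separation \<in> borel_measurable geodesic_borel" by measurable
qed

lemma compactin_separation:
  assumes "\<delta> > 0"
  shows "compactin geodesic_topology {G \<in> geodesics. \<delta> \<le> separation G}"
proof -
  define K where "K = {z :: complex \<times> complex. norm (fst z) = 1 \<and> norm (snd z) = 1 \<and> \<delta> \<le> norm (fst z - snd z)}"
  have "closed K"
    unfolding K_def by (intro closed_Collect_conj closed_Collect_eq closed_Collect_le continuous_intros)
  moreover have "bounded K"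
  proof -
    have "K \<subseteq> cball 0 1 \<times> cball 0 1" by (auto simp: K_def)
    then show ?thesis by (metis bounded_Times bounded_cball bounded_subset)
  qed
  ultimately have "compact K" by (simp add: compact_eq_bounded_closed)
  moreover have "K \<subseteq> ordered_ends" using assms by (auto simp: K_def ordered_ends_def)
  ultimately have "compactin (top_of_set ordered_ends) K" by (simp add: compactin_subtopology)
  then have "compactin geodesic_topology ((\<lambda>z. {fst z, snd z}) ` K)"
    using quotient_map_ends by (rule image_compactin)
  moreover have "(\<lambda>z. {fst z, snd z}) ` K = {G \<in> geodesics. \<delta> \<le> separation G}"
  proof (intro equalityI subsetI)
    fix G assume "G \<in> (\<lambda>z. {fst z, snd z}) ` K"
    then obtain z where z: "z \<in> K" "G = {fst z, snd z}" by blast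
    then have "fst z \<noteq> snd z" using assms by (auto simp: K_def)
    then show "G \<in> {G \<in> geodesics. \<delta> \<le> separation G}"
      using z by (auto simp: K_def separation_doubleton intro: geodesicI)
  next
    fix G assume G: "G \<in> {G \<in> geodesics. \<delta> \<le> separation G}"
    then obtain x y where "G = {x, y}" "norm x = 1" "norm y = 1" "x \<noteq> y" using geodesicE by blast
    then show "G \<in> (\<lambda>z. {fst z, snd z}) ` K"
      using G by (intro image_eqI[of _ _ "(x, y)"]) (auto simp: K_def separation_doubleton)
  qed
  ultimately show ?thesis by simp
qed

lemma compactin_separated:
  assumes "compactin geodesic_topology K"
  obtains \<delta> where "\<delta> > 0" "\<And>G. G \<in> K \<Longrightarrow> \<delta> \<le> separation G"
proof (cases "K = {}")
  case True
  then show ?thesis using that[of 1] by simp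
next
  case False
  have KG: "K \<subseteq> geodesics" using compactin_subset_topspace[OF assms] topspace_geodesic_topology by simp
  have "compactin euclidean (separation ` K)"
    using image_compactin[OF assms continuous_on_ends_sym(3)] .
  then have "compact (separation ` K)" by simp
  then obtain G where G: "G \<in> K" "\<And>H. H \<in> K \<Longrightarrow> separation G \<le> separation H"
    using False compact_attains_inf[of "separation ` K"] by force
  then have "separation G > 0" using KG geodesic_ends(4)[of G] by (auto simp: separation_def)
  then show ?thesis using that G by blast
qed

section \<open>Uniform bounds for test functions\<close>

lemma test_function_support:
  assumes "\<phi> \<in> test_functions"
  obtains \<delta> where "\<delta> > 0" "\<And>G. G \<in> geodesics \<Longrightarrow> separation G < \<delta> \<Longrightarrow> \<phi> G = 0"
proof -
  obtain K where K: "compactin geodesic_topology K" "\<And>G. G \<in> geodesics - K \<Longrightarrow> \<phi> G = 0"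
    using assms unfolding test_functions_def by blast
  obtain \<delta> where "\<delta> > 0" "\<And>G. G \<in> K \<Longrightarrow> \<delta> \<le> separation G" using compactin_separated[OF K(1)] by blast
  then show ?thesis using that[of \<delta>] K(2) by force
qed

lemma test_function_pairs:
  assumes "\<phi> \<in> test_functions" and "\<delta> > 0"
  defines "P \<equiv> {z :: complex \<times> complex. norm (fst z) = 1 \<and> norm (snd z) = 1 \<and> \<delta> \<le> norm (fst z - snd z)}"
  shows "compact P" "continuous_on P (\<lambda>z. \<phi> {fst z, snd z})"
proof -
  have "closed P"
    unfolding P_def by (intro closed_Collect_conj closed_Collect_eq closed_Collect_le continuous_intros)
  moreover have "bounded P"
  proof -
    have "P \<subseteq> cball 0 1 \<times> cball 0 1" by (auto simp: P_def)
    then show ?thesis by (metis bounded_Times bounded_cball bounded_subset)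
  qed
  ultimately show "compact P" by (simp add: compact_eq_bounded_closed)
  have "P \<subseteq> ordered_ends" using assms(2) by (auto simp: P_def ordered_ends_def)
  then show "continuous_on P (\<lambda>z. \<phi> {fst z, snd z})"
    using assms(1) continuous_map_geodesicD continuous_on_subset unfolding test_functions_def by blast
qed

lemma test_function_bounded:
  assumes "\<phi> \<in> test_functions"
  obtains b where "\<And>G. G \<in> geodesics \<Longrightarrow> \<bar>\<phi> G\<bar> \<le> b"
proof -
  obtain \<delta> where d: "\<delta> > 0" "\<And>G. G \<in> geodesics \<Longrightarrow> separation G < \<delta> \<Longrightarrow> \<phi> G = 0"
    using test_function_support[OF assms] by blast
  define P where "P = {z :: complex \<times> complex. norm (fst z) = 1 \<and> norm (snd z) = 1 \<and> \<delta> \<le> norm (fst z - snd z)}"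
  have "compact ((\<lambda>z. \<phi> {fst z, snd z}) ` P)"
    using test_function_pairs[OF assms d(1)] unfolding P_def by (intro compact_continuous_image)
  then have "bounded ((\<lambda>z. \<phi> {fst z, snd z}) ` P)" by (rule compact_imp_bounded)
  then obtain b where b0: "\<forall>v\<in>(\<lambda>z. \<phi> {fst z, snd z}) ` P. norm v \<le> b" unfolding bounded_iff by blast
  have b: "\<bar>\<phi> {fst z, snd z}\<bar> \<le> b" if "z \<in> P" for z using bspec[OF b0 imageI[OF that]] by simp
  have "\<bar>\<phi> G\<bar> \<le> max 0 b" if G: "G \<in> geodesics" for G
  proof (cases "separation G < \<delta>")
    case True
    then show ?thesis using d(2)[OF G] by simp
  next
    case False
    have "(end1 G, end2 G) \<in> P" using False geodesic_ends[OF G] by (simp add: P_def separation_def)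
    from b[OF this] show ?thesis using geodesic_ends(1)[OF G] by simp
  qed
  then show ?thesis by (rule that)
qed

lemma test_function_uniform:
  assumes "\<phi> \<in> test_functions" and "\<delta> > 0" and "\<epsilon> > 0"
  obtains \<theta> where "\<theta> > 0" "\<And>x y z w. norm x = 1 \<Longrightarrow> norm y = 1 \<Longrightarrow> norm z = 1 \<Longrightarrow> norm w = 1 \<Longrightarrow>
      \<delta> \<le> norm (x - y) \<Longrightarrow> norm (x - z) \<le> \<theta> \<Longrightarrow> norm (y - w) \<le> \<theta> \<Longrightarrow> z \<noteq> w \<and> \<bar>\<phi> {x, y} - \<phi> {z, w}\<bar> \<le> \<epsilon>"
proof -
  \<comment> \<open>Separation \<delta> / 2 is what remains for the perturbed pair, so both pairs
    lie in one compact set.\<close>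
  define P where "P = {z :: complex \<times> complex. norm (fst z) = 1 \<and> norm (snd z) = 1 \<and> \<delta> / 2 \<le> norm (fst z - snd z)}"
  have "uniformly_continuous_on P (\<lambda>z. \<phi> {fst z, snd z})"
    using test_function_pairs[OF assms(1), of "\<delta> / 2"] assms(2) unfolding P_def
    by (intro compact_uniformly_continuous) auto
  then obtain d where d: "d > 0" "\<And>u v. u \<in> P \<Longrightarrow> v \<in> P \<Longrightarrow> dist v u < d \<Longrightarrow> \<bar>\<phi> {fst v, snd v} - \<phi> {fst u, snd u}\<bar> < \<epsilon>"
    using assms(3) unfolding uniformly_continuous_on_def dist_real_def by metis
  define \<theta> where "\<theta> = min (d / 4) (\<delta> / 4)"
  have t: "\<theta> > 0" "\<theta> \<le> d / 4" "\<theta> \<le> \<delta> / 4"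
    using d(1) assms(2) min.cobounded1[of "d / 4" "\<delta> / 4"] min.cobounded2[of "d / 4" "\<delta> / 4"]
    by (simp add: \<theta>_def, unfold \<theta>_def)
  have "z \<noteq> w \<and> \<bar>\<phi> {x, y} - \<phi> {z, w}\<bar> \<le> \<epsilon>"
    if n: "norm x = 1" "norm y = 1" "norm z = 1" "norm w = 1"
      and c: "\<delta> \<le> norm (x - y)" "norm (x - z) \<le> \<theta>" "norm (y - w) \<le> \<theta>" for x y z w
  proof -
    have "norm (x - y) \<le> norm (x - z) + norm (z - w) + norm (y - w)"
      using norm_triangle_ineq[of "x - z" "z - w"] norm_triangle_ineq[of "x - w" "w - y"]
      by (simp add: norm_minus_commute)
    then have zw: "\<delta> / 2 \<le> norm (z - w)" using c t by linarith
    have "dist (x, y) (z, w) \<le> dist x z + dist y w"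
      unfolding dist_Pair_Pair by (rule sqrt_sum_squares_le_sum) auto
    then have "dist (x, y) (z, w) \<le> norm (x - z) + norm (y - w)" by (simp only: dist_norm)
    then have "dist (x, y) (z, w) < d" using c t d(1) by linarith
    moreover have "(x, y) \<in> P" "(z, w) \<in> P" using n c zw assms(2) by (auto simp: P_def)
    ultimately have "\<bar>\<phi> {x, y} - \<phi> {z, w}\<bar> < \<epsilon>" using d(2)[of "(z, w)" "(x, y)"] by simp
    moreover have "z \<noteq> w" using zw assms(2) by auto
    ultimately show ?thesis by simp
  qed
  then show ?thesis by (rule that[OF t(1)])
qed

lemma test_function_measurable:
  assumes "\<phi> \<in> test_functions"
  shows "\<phi> \<in> borel_measurable geodesic_borel"
  using assms continuous_map_geodesic_measurable unfolding test_functions_def by blast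

section \<open>Currents and mass transport\<close>

lemma disc_aut_measurable:
  assumes "disc_aut f"
  shows "f \<in> borel_measurable borel"
proof -
  obtain a b where f: "f = (\<lambda>z. if norm z \<le> 1 then disc_map a b z else z)"
    using assms unfolding disc_aut_def by blast
  show ?thesis unfolding f disc_map_def by measurable
qed

lemma disc_aut_image_geodesic:
  assumes "disc_aut f" "G \<in> geodesics"
  shows "f ` G \<in> geodesics"
proof -
  obtain x y where "G = {x, y}" "norm x = 1" "norm y = 1" "x \<noteq> y" using assms(2) by (rule geodesicE)
  moreover have "inj f" using disc_aut_inverse(1)[OF assms(1)] bij_is_inj by blast
  ultimately show ?thesis
    using geodesicI[of "f x" "f y"] disc_aut_norm(2)[OF assms(1)] by (auto simp: inj_def)
qed

lemma disc_aut_image_measurable: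
  assumes "disc_aut f"
  shows "(\<lambda>G. f ` G) \<in> measurable geodesic_borel geodesic_borel"
proof (rule measurable_sigma_sets)
  show "sets geodesic_borel = sigma_sets geodesics {U. openin geodesic_topology U}"
    unfolding geodesic_borel_def
    by (rule sets_measure_of) (metis mem_Collect_eq openin_subset subsetI PowI topspace_geodesic_topology)
  show "{U. openin geodesic_topology U} \<subseteq> Pow geodesics"
    by (metis mem_Collect_eq openin_subset subsetI PowI topspace_geodesic_topology)
  show "(\<lambda>G. f ` G) \<in> space geodesic_borel \<rightarrow> geodesics" using disc_aut_image_geodesic[OF assms] by simp
  fix U assume "U \<in> {U. openin geodesic_topology U}"
  then have U: "openin (top_of_set ordered_ends) {(x, y) \<in> ordered_ends. {x, y} \<in> U}" "U \<subseteq> geodesics"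
    by (auto simp: openin_geodesic_topology)
  have c: "continuous_on {z. norm z = 1} f"
    by (rule continuous_on_subset[OF disc_aut_continuous[OF assms]]) auto
  have "continuous_on ordered_ends (\<lambda>z. (f (fst z), f (snd z)))"
    by (intro continuous_on_Pair continuous_on_compose2[OF c] continuous_intros) (auto simp: ordered_ends_def)
  moreover have "(\<lambda>z. (f (fst z), f (snd z))) \<in> ordered_ends \<rightarrow> ordered_ends"
    using disc_aut_norm(2)[OF assms] bij_is_inj[OF disc_aut_inverse(1)[OF assms]]
    by (auto simp: ordered_ends_def inj_def)
  ultimately have "openin (top_of_set ordered_ends)
      (ordered_ends \<inter> (\<lambda>z. (f (fst z), f (snd z))) -` {(x, y) \<in> ordered_ends. {x, y} \<in> U})"
    using U(1) by (rule continuous_openin_preimage)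
  moreover have "ordered_ends \<inter> (\<lambda>z. (f (fst z), f (snd z))) -` {(x, y) \<in> ordered_ends. {x, y} \<in> U}
     = {(x, y) \<in> ordered_ends. {x, y} \<in> {G \<in> geodesics. f ` G \<in> U}}"
    using U(2) disc_aut_norm(2)[OF assms] bij_is_inj[OF disc_aut_inverse(1)[OF assms]]
    by (auto simp: geodesics_def ordered_ends_def inj_def)
  ultimately have "openin geodesic_topology {G \<in> geodesics. f ` G \<in> U}"
    by (auto simp: openin_geodesic_topology)
  moreover have "(\<lambda>G. f ` G) -` U \<inter> space geodesic_borel = {G \<in> geodesics. f ` G \<in> U}" by auto
  ultimately show "(\<lambda>G. f ` G) -` U \<inter> space geodesic_borel \<in> sets geodesic_borel"
    using openin_sets_geodesic_borel by simp
qed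

lemma current_sets: "\<mu> \<in> currents p \<Longrightarrow> sets \<mu> = sets geodesic_borel"
  by (simp add: currents_def)

lemma current_space: "\<mu> \<in> currents p \<Longrightarrow> space \<mu> = geodesics"
  using sets_eq_imp_space_eq[OF current_sets] by simp

lemma current_measurable: "\<mu> \<in> currents p \<Longrightarrow> borel_measurable \<mu> = borel_measurable geodesic_borel"
  by (rule measurable_cong_sets[OF current_sets refl])

lemma separated_sets: "{G \<in> geodesics. \<delta> \<le> separation G} \<in> sets geodesic_borel"
proof -
  have "{G \<in> space geodesic_borel. \<delta> \<le> separation G} \<in> sets geodesic_borel" by measurable
  then show ?thesis by simp
qed

lemma current_finite:
  assumes "\<mu> \<in> currents p" "\<delta> > 0"
  shows "emeasure \<mu> {G \<in> geodesics. \<delta> \<le> separation G} < \<infinity>"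
  using assms compactin_separation[OF assms(2)] unfolding currents_def by blast

lemma nn_integral_test_function_finite:
  assumes "\<mu> \<in> currents p" "\<phi> \<in> test_functions"
  shows "(\<integral>\<^sup>+G. ennreal \<bar>\<phi> G\<bar> \<partial>\<mu>) < \<infinity>"
proof -
  obtain \<delta> where d: "\<delta> > 0" "\<And>G. G \<in> geodesics \<Longrightarrow> separation G < \<delta> \<Longrightarrow> \<phi> G = 0"
    using test_function_support[OF assms(2)] by blast
  obtain b where b: "\<And>G. G \<in> geodesics \<Longrightarrow> \<bar>\<phi> G\<bar> \<le> b" using test_function_bounded[OF assms(2)] by blast
  let ?A = "{G \<in> geodesics. \<delta> \<le> separation G}"
  have "(\<integral>\<^sup>+G. ennreal \<bar>\<phi> G\<bar> \<partial>\<mu>) \<le> (\<integral>\<^sup>+G. ennreal b * indicator ?A G \<partial>\<mu>)"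
    using b d(2) by (intro nn_integral_mono) (auto simp: current_space[OF assms(1)] indicator_def not_le intro: ennreal_leI)
  also have "\<dots> = ennreal b * emeasure \<mu> ?A"
    using separated_sets by (simp add: nn_integral_cmult_indicator current_sets[OF assms(1)])
  also have "\<dots> < \<infinity>" using current_finite[OF assms(1) d(1)] by (simp add: ennreal_mult_less_top)
  finally show ?thesis .
qed

lemma integrable_test_function:
  assumes "\<mu> \<in> currents p" "\<phi> \<in> test_functions"
  shows "integrable \<mu> \<phi>"
  using nn_integral_test_function_finite[OF assms] test_function_measurable[OF assms(2)]
  by (simp add: integrable_iff_bounded current_measurable[OF assms(1)])

text \<open>Invariance on sets says that the push-forward of the current under \<open>f\<close> is
  the current itself.\<close>

lemma nn_integral_current_translate:
  assumes \<mu>: "\<mu> \<in> currents p" and f: "f \<in> deck_auts p" and h: "h \<in> borel_measurable geodesic_borel"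
  shows "(\<integral>\<^sup>+G. h (f ` G) \<partial>\<mu>) = (\<integral>\<^sup>+G. h G \<partial>\<mu>)"
proof -
  have a: "disc_aut f" using f by (simp add: deck_auts_def)
  have m: "(\<lambda>G. f ` G) \<in> measurable \<mu> geodesic_borel"
    using disc_aut_image_measurable[OF a] by (simp add: measurable_cong_sets[OF current_sets[OF \<mu>] refl])
  have inv: "disc_aut (finv f)" "bij f" using disc_aut_inverse[OF a] by auto
  have "distr \<mu> geodesic_borel (\<lambda>G. f ` G) = \<mu>"
  proof (rule measure_eqI)
    show "sets (distr \<mu> geodesic_borel (\<lambda>G. f ` G)) = sets \<mu>" by (simp add: current_sets[OF \<mu>])
    fix B assume "B \<in> sets (distr \<mu> geodesic_borel (\<lambda>G. f ` G))"
    then have B: "B \<in> sets geodesic_borel" by simp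
    obtain g where g: "g \<in> deck_group p" "f = ext g" using f deck_auts_eq by blast
    define B' where "B' = (\<lambda>G. f ` G) -` B \<inter> geodesics"
    have B': "B' \<in> sets geodesic_borel"
      using measurable_sets[OF disc_aut_image_measurable[OF a] B] by (simp add: B'_def)
    have "(`) f ` B' = B"
    proof (intro equalityI subsetI)
      fix G assume "G \<in> (`) f ` B'"
      then show "G \<in> B" by (auto simp: B'_def)
    next
      fix G assume G: "G \<in> B"
      then have GG: "G \<in> geodesics" using sets.sets_into_space[OF B] by auto
      have "f ` (finv f ` G) = G" using inv(2) by (simp add: bij_is_surj image_f_inv_f)
      then show "G \<in> (`) f ` B'"
        using G disc_aut_image_geodesic[OF inv(1) GG] by (intro image_eqI[of _ _ "finv f ` G"]) (auto simp: B'_def)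
    qed
    moreover have "(`) f ` B' = (`) g ` B'"
    proof (rule image_cong[OF refl])
      fix G assume "G \<in> B'"
      then have "G \<in> geodesics" by (simp add: B'_def)
      then show "f ` G = g ` G" unfolding g(2)
        by (intro ext_image) (metis geodesicE insertE order_refl singletonD)
    qed
    ultimately have "emeasure \<mu> B = emeasure \<mu> B'"
      using \<mu> g(1) B' unfolding currents_def by force
    then show "emeasure (distr \<mu> geodesic_borel (\<lambda>G. f ` G)) B = emeasure \<mu> B"
      using B m by (simp add: emeasure_distr B'_def current_space[OF \<mu>])
  qed
  then show ?thesis using nn_integral_distr[OF m, of h] h by (simp add: current_measurable[OF \<mu>])
qed

section \<open>The mass transport identity\<close>

context fuchsian_group begin

text \<open>The window relation with the group element held fixed; a sum over windows under the
  integral becomes a sum over the group of integrals over these sets.\<close>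

definition linked :: "real \<Rightarrow> nat \<Rightarrow> (complex \<Rightarrow> complex) \<Rightarrow> complex set set" where
  "linked \<delta> N f = {G \<in> geodesics. \<delta> \<le> separation G \<and> f \<in> window \<delta> N (end1 G) (end2 G)}"

lemma window_swap:
  assumes "norm x = 1" "norm y = 1"
  shows "window \<delta> N y x = window \<delta> N x y"
proof -
  have "gap \<delta> y x id h = gap \<delta> x y id h" if "h \<in> near \<delta> x y" for h
    using gap_swap[OF assms id_in] that by (simp add: near_def)
  then show ?thesis unfolding window_def near_swap[of \<delta> y x] by auto
qed

lemma linked_doubleton:
  assumes "norm x = 1" "norm y = 1" "x \<noteq> y"
  shows "{x, y} \<in> linked \<delta> N f \<longleftrightarrow> \<delta> \<le> norm (x - y) \<and> f \<in> window \<delta> N x y"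
  using ends_doubleton[OF assms(3)] window_swap[OF assms(1,2)] geodesicI[OF assms]
  by (auto simp: linked_def separation_doubleton[OF assms(3)])

text \<open>The symmetry behind transport: passing from the translate by \<open>f\<close> back to
  \<open>G\<close> exchanges the two separation conditions, on the geodesic and on its pull-back,
  and turns the gap from the identity to \<open>f\<close> into that from \<open>finv f\<close> to
  the identity.\<close>

lemma linked_inverse:
  assumes f: "f \<in> \<Gamma>" and G: "G \<in> geodesics"
  shows "f ` G \<in> linked \<delta> N f \<longleftrightarrow> G \<in> linked \<delta> N (finv f)"
proof -
  obtain x y where xy: "G = {x, y}" "norm x = 1" "norm y = 1" "x \<noteq> y" using G by (rule geodesicE)
  have n: "norm (f x) = 1" "norm (f y) = 1" "f x \<noteq> f y" using xy f in_eq_iff by auto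
  have "gap \<delta> (f x) (f y) id f = gap \<delta> x y id (finv f)"
    using gap_comp[OF xy(2,3) finv_in[OF f] id_in f, of \<delta>] gap_commute f by simp
  then show ?thesis
    using linked_doubleton[OF n] linked_doubleton[OF xy(2-4)] f
    by (auto simp: xy(1) window_def near_def finv_in)
qed

text \<open>\<open>gap\<close> counts in an infinite set that varies with the geodesic. For fixed
  \<open>f\<close> the positions in question lie between bounds depending on \<open>f\<close> alone,
  so only elements of a fixed finite set \<open>F\<close> contribute and the count is a finite sum
  of measurable indicators.\<close>

lemma linked_sets:
  assumes "\<delta> > 0" and f: "f \<in> \<Gamma>"
  shows "linked \<delta> N f \<in> sets geodesic_borel"
proof -
  define c where "c = norm (f 0)"
  have c: "c < 1" "c \<ge> 0" using norm_in(3)[OF f, of 0] by (auto simp: c_def)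
  \<comment> \<open>A Harnack bound: \<open>geo_pos x y f\<close> is the quotient of the distances
    of \<open>f 0\<close> from \<open>y\<close> and from \<open>x\<close>, and these lie between 1 -
    c and 1 + c.\<close>
  define K where "K = (1 + c) / (1 - c)"
  have K: "K \<ge> 1" using c by (simp add: K_def field_simps)
  have pos: "1 / K \<le> geo_pos x y f \<and> geo_pos x y f \<le> K" if n: "norm x = 1" "norm y = 1" for x y
  proof -
    have b: "1 - c \<le> norm (1 - cnj (f 0) * w) \<and> norm (1 - cnj (f 0) * w) \<le> 1 + c" if "norm w = 1" for w
      using norm_triangle_ineq2[of 1 "cnj (f 0) * w"] norm_triangle_ineq4[of 1 "cnj (f 0) * w"] that
      by (simp add: norm_mult c_def)
    have "sqrt (1 - c\<^sup>2) > 0" using c by (simp add: abs_square_less_1)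
    then have e: "geo_pos x y f = norm (1 - cnj (f 0) * y) / norm (1 - cnj (f 0) * x)"
      by (simp add: geo_pos_def sqrt_deriv_def c_def)
    show ?thesis
    proof
      have "(1 - c) / (1 + c) \<le> norm (1 - cnj (f 0) * y) / norm (1 - cnj (f 0) * x)"
        using b[OF n(1)] b[OF n(2)] c by (intro frac_le) auto
      then show "1 / K \<le> geo_pos x y f" unfolding e K_def by simp
      show "geo_pos x y f \<le> K"
        unfolding e K_def using b[OF n(1)] b[OF n(2)] c by (intro frac_le) auto
    qed
  qed
  define r where "r = sqrt (1 - \<delta> ^ 3 / (8 * K))"
  have r: "r < 1" using assms K by (simp add: r_def)
  define F where "F = {h \<in> \<Gamma>. norm (h 0) \<le> r}"
  have finF: "finite F" unfolding F_def using proper r by blast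
  have sub: "{h \<in> near \<delta> x y. 1 / K \<le> geo_pos x y h \<and> geo_pos x y h \<le> K} \<subseteq> F"
    if "norm x = 1" "norm y = 1" "\<delta> \<le> norm (x - y)" for x y
    unfolding F_def r_def by (rule card_near_le[OF \<open>\<delta> > 0\<close> K]) (use that in blast)
  define Q where "Q h G \<longleftrightarrow> h \<in> near \<delta> (end1 G) (end2 G) \<and>
     (1 < geo_pos (end1 G) (end2 G) h \<and> geo_pos (end1 G) (end2 G) h < geo_pos (end1 G) (end2 G) f \<or>
      geo_pos (end1 G) (end2 G) f < geo_pos (end1 G) (end2 G) h \<and> geo_pos (end1 G) (end2 G) h < 1)" for h G
  have gap: "gap \<delta> (end1 G) (end2 G) id f = card {h \<in> F. Q h G}" if G: "G \<in> geodesics" "\<delta> \<le> separation G" for G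
  proof -
    have n: "norm (end1 G) = 1" "norm (end2 G) = 1" "\<delta> \<le> norm (end1 G - end2 G)"
      using geodesic_ends[OF G(1)] G(2) by (auto simp: separation_def)
    have "1 / K \<le> 1" using K by simp
    have "h \<in> F" if "Q h G" for h
    proof (rule subsetD[OF sub[OF n]])
      show "h \<in> {h \<in> near \<delta> (end1 G) (end2 G). 1 / K \<le> geo_pos (end1 G) (end2 G) h \<and> geo_pos (end1 G) (end2 G) h \<le> K}"
        using that pos[OF n(1,2)] K \<open>1 / K \<le> 1\<close> unfolding Q_def mem_Collect_eq by linarith
    qed
    then show ?thesis unfolding gap_def Q_def by (intro arg_cong[where f = card]) auto
  qed
  have mf: "finv h \<in> borel_measurable borel" if "h \<in> \<Gamma>" for h
    using disc_aut_measurable[OF aut[OF finv_in[OF that]]] .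
  have mn: "{G \<in> space geodesic_borel. h \<in> near \<delta> (end1 G) (end2 G)} \<in> sets geodesic_borel" if "h \<in> \<Gamma>" for h
  proof -
    note [measurable] = mf[OF that]
    have "{G \<in> space geodesic_borel. \<delta> \<le> norm (finv h (end1 G) - finv h (end2 G))} \<in> sets geodesic_borel"
      by measurable
    then show ?thesis using that by (simp add: near_def)
  qed
  have mp [measurable]: "(\<lambda>G. geo_pos (end1 G) (end2 G) h) \<in> borel_measurable geodesic_borel" for h
    unfolding geo_pos_def sqrt_deriv_def by measurable
  have mQ: "{G \<in> space geodesic_borel. Q h G} \<in> sets geodesic_borel" if "h \<in> \<Gamma>" for h
  proof -
    define S where "S = {G \<in> space geodesic_borel.
     (1 < geo_pos (end1 G) (end2 G) h \<and> geo_pos (end1 G) (end2 G) h < geo_pos (end1 G) (end2 G) f \<or>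
      geo_pos (end1 G) (end2 G) f < geo_pos (end1 G) (end2 G) h \<and> geo_pos (end1 G) (end2 G) h < 1)}"
    have S: "S \<in> sets geodesic_borel" unfolding S_def by measurable
    have "{G \<in> space geodesic_borel. Q h G} = {G \<in> space geodesic_borel. h \<in> near \<delta> (end1 G) (end2 G)} \<inter> S"
      unfolding Q_def S_def by blast
    then show ?thesis using sets.Int[OF mn[OF that] S] by metis
  qed
  have "{G \<in> space geodesic_borel. (\<Sum>h\<in>F. if Q h G then 1 else 0 :: real) \<le> real N} \<in> sets geodesic_borel"
  proof -
    have "(\<lambda>G. \<Sum>h\<in>F. if Q h G then 1 else 0 :: real) \<in> borel_measurable geodesic_borel"
      using mQ by (intro borel_measurable_sum measurable_If) (auto simp: F_def)
    then show ?thesis by measurable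
  qed
  then have mc: "{G \<in> space geodesic_borel. card {h \<in> F. Q h G} \<le> N} \<in> sets geodesic_borel"
  proof -
    have "(\<Sum>h\<in>F. if Q h G then 1 else 0 :: real) = real (card {h \<in> F. Q h G})" for G
      using finF by (simp add: sum.If_cases Int_def)
    then show ?thesis
      using \<open>{G \<in> space geodesic_borel. (\<Sum>h\<in>F. if Q h G then 1 else 0 :: real) \<le> real N} \<in> sets geodesic_borel\<close> by simp
  qed
  have "linked \<delta> N f = {G \<in> geodesics. \<delta> \<le> separation G} \<inter>
      ({G \<in> space geodesic_borel. f \<in> near \<delta> (end1 G) (end2 G)} \<inter> {G \<in> space geodesic_borel. card {h \<in> F. Q h G} \<le> N})"
    using gap by (auto simp: linked_def window_def)
  then show ?thesis using sets.Int[OF separated_sets sets.Int[OF mn[OF f] mc]] by simp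
qed

lemma countable_group: "countable \<Gamma>"
proof -
  have "\<Gamma> \<subseteq> (\<Union>n::nat. {f \<in> \<Gamma>. norm (f 0) \<le> 1 - 1 / real (Suc n)})"
  proof
    fix f assume f: "f \<in> \<Gamma>"
    then have "norm (f 0) < 1" by simp
    then obtain n where "1 / real (Suc n) < 1 - norm (f 0)"
      using reals_Archimedean[of "1 - norm (f 0)"] by (auto simp: inverse_eq_divide)
    then show "f \<in> (\<Union>n::nat. {f \<in> \<Gamma>. norm (f 0) \<le> 1 - 1 / real (Suc n)})"
      using f by (intro UN_I[of n]) auto
  qed
  moreover have "countable (\<Union>n::nat. {f \<in> \<Gamma>. norm (f 0) \<le> 1 - 1 / real (Suc n)})"
  proof (rule countable_UN)
    show "countable {f \<in> \<Gamma>. norm (f 0) \<le> 1 - 1 / real (Suc n)}" for n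
      by (rule countable_finite, rule proper) simp
  qed simp
  ultimately show ?thesis by (rule countable_subset)
qed

text \<open>The window sum is written as a sum over the countable group and exchanged with the
  integral. Invariance replaces \<open>G\<close> by its translate under \<open>f\<close>, which
  turns the condition on \<open>f\<close> into the one on \<open>finv f\<close>, and inversion
  permutes the group.\<close>

lemma mass_transport:
  assumes \<Gamma>: "\<Gamma> = deck_auts p" and \<mu>: "\<mu> \<in> currents p" and "\<delta> > 0"
    and fin: "\<And>x y. norm x = 1 \<Longrightarrow> norm y = 1 \<Longrightarrow> \<delta> \<le> norm (x - y) \<Longrightarrow> finite (window \<delta> N x y)"
    and \<psi>: "\<psi> \<in> borel_measurable geodesic_borel"
  defines "A \<equiv> {G \<in> geodesics. \<delta> \<le> separation G}" and "W \<equiv> \<lambda>G. window \<delta> N (end1 G) (end2 G)"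
  shows "(\<integral>\<^sup>+G. (\<Sum>f\<in>W G. \<psi> (finv f ` G)) * indicator A G \<partial>\<mu>)
       = (\<integral>\<^sup>+G. \<psi> G * of_nat (card (W G)) * indicator A G \<partial>\<mu>)"
proof -
  have WG: "W G \<subseteq> \<Gamma>" for G by (auto simp: W_def window_def near_def)
  have finW: "finite (W G)" if "G \<in> A" for G
    using fin geodesic_ends that unfolding A_def W_def separation_def by blast
  have lk: "indicator (linked \<delta> N f) G = (indicator (W G) f * indicator A G :: ennreal)" if "G \<in> geodesics" for f G
    using that by (auto simp: linked_def W_def A_def indicator_def)
  have expand: "(\<Sum>f\<in>W G. u f) * indicator A G = (\<integral>\<^sup>+f. u f * indicator (linked \<delta> N f) G \<partial>count_space \<Gamma>)"
    if G: "G \<in> geodesics" for u :: "(complex \<Rightarrow> complex) \<Rightarrow> ennreal" and G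
  proof (cases "G \<in> A")
    case True
    have "(\<integral>\<^sup>+f. u f * indicator (linked \<delta> N f) G \<partial>count_space \<Gamma>) = (\<Sum>f\<in>W G. u f * indicator (linked \<delta> N f) G)"
      using finW[OF True] WG by (intro nn_integral_count_space') (auto simp: lk[OF G])
    also have "\<dots> = (\<Sum>f\<in>W G. u f)" using True by (intro sum.cong) (auto simp: lk[OF G])
    finally show ?thesis using True by simp
  next
    case False
    then show ?thesis by (simp add: lk[OF G])
  qed
  have m [measurable]: "(\<lambda>G. \<psi> (finv f ` G)) \<in> borel_measurable geodesic_borel" if "f \<in> \<Gamma>" for f
    using measurable_compose[OF disc_aut_image_measurable[OF aut[OF finv_in[OF that]]] \<psi>] .
  have li: "(\<lambda>G. indicator (linked \<delta> N f) G :: ennreal) \<in> borel_measurable geodesic_borel" if "f \<in> \<Gamma>" for f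
    using linked_sets[OF \<open>\<delta> > 0\<close> that] by simp
  have bm: "borel_measurable \<mu> = borel_measurable geodesic_borel" by (rule current_measurable[OF \<mu>])
  have "(\<integral>\<^sup>+G. (\<Sum>f\<in>W G. \<psi> (finv f ` G)) * indicator A G \<partial>\<mu>)
      = (\<integral>\<^sup>+G. (\<integral>\<^sup>+f. \<psi> (finv f ` G) * indicator (linked \<delta> N f) G \<partial>count_space \<Gamma>) \<partial>\<mu>)"
    using expand by (intro nn_integral_cong) (simp add: current_space[OF \<mu>])
  also have "\<dots> = (\<integral>\<^sup>+f. (\<integral>\<^sup>+G. \<psi> (finv f ` G) * indicator (linked \<delta> N f) G \<partial>\<mu>) \<partial>count_space \<Gamma>)"
    using m li by (intro nn_integral_count_space_nn_integral countable_group) (auto simp: bm intro!: borel_measurable_times_ennreal)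
  also have "\<dots> = (\<integral>\<^sup>+f. (\<integral>\<^sup>+G. \<psi> G * indicator (linked \<delta> N (finv f)) G \<partial>\<mu>) \<partial>count_space \<Gamma>)"
  proof (rule nn_integral_cong)
    fix f assume "f \<in> space (count_space \<Gamma>)"
    then have f: "f \<in> \<Gamma>" by simp
    have "(\<integral>\<^sup>+G. \<psi> (finv f ` G) * indicator (linked \<delta> N f) G \<partial>\<mu>)
       = (\<integral>\<^sup>+G. \<psi> (finv f ` (f ` G)) * indicator (linked \<delta> N f) (f ` G) \<partial>\<mu>)"
      using nn_integral_current_translate[OF \<mu>, of f "\<lambda>G. \<psi> (finv f ` G) * indicator (linked \<delta> N f) G"]
        f \<Gamma> borel_measurable_times_ennreal[OF m[OF f] li[OF f]] by simp
    also have "\<dots> = (\<integral>\<^sup>+G. \<psi> G * indicator (linked \<delta> N (finv f)) G \<partial>\<mu>)"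
    proof (rule nn_integral_cong)
      fix G assume "G \<in> space \<mu>"
      then have G: "G \<in> geodesics" by (simp add: current_space[OF \<mu>])
      have "finv f ` (f ` G) = G" using f by (simp add: image_comp)
      moreover have "indicator (linked \<delta> N f) (f ` G) = (indicator (linked \<delta> N (finv f)) G :: ennreal)"
        using linked_inverse[OF f G] by (simp add: indicator_def)
      ultimately show "\<psi> (finv f ` (f ` G)) * indicator (linked \<delta> N f) (f ` G) = \<psi> G * indicator (linked \<delta> N (finv f)) G"
        by simp
    qed
    finally show "(\<integral>\<^sup>+G. \<psi> (finv f ` G) * indicator (linked \<delta> N f) G \<partial>\<mu>)
       = (\<integral>\<^sup>+G. \<psi> G * indicator (linked \<delta> N (finv f)) G \<partial>\<mu>)" .
  qed
  also have "\<dots> = (\<integral>\<^sup>+f. (\<integral>\<^sup>+G. \<psi> G * indicator (linked \<delta> N f) G \<partial>\<mu>) \<partial>count_space \<Gamma>)"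
  proof (rule nn_integral_bij_count_space)
    show "bij_betw finv \<Gamma> \<Gamma>"
      by (rule bij_betw_byWitness[of _ finv]) (auto simp: finv_in)
  qed
  also have "\<dots> = (\<integral>\<^sup>+G. (\<integral>\<^sup>+f. \<psi> G * indicator (linked \<delta> N f) G \<partial>count_space \<Gamma>) \<partial>\<mu>)"
    using \<psi> li by (intro nn_integral_count_space_nn_integral[symmetric] countable_group) (auto simp: bm intro!: borel_measurable_times_ennreal)
  also have "\<dots> = (\<integral>\<^sup>+G. \<psi> G * of_nat (card (W G)) * indicator A G \<partial>\<mu>)"
  proof (rule nn_integral_cong)
    fix G assume "G \<in> space \<mu>"
    then have "G \<in> geodesics" by (simp add: current_space[OF \<mu>])
    from expand[OF this, of "\<lambda>f. \<psi> G"]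
    show "(\<integral>\<^sup>+f. \<psi> G * indicator (linked \<delta> N f) G \<partial>count_space \<Gamma>) = \<psi> G * of_nat (card (W G)) * indicator A G"
      by (simp add: mult.commute)
  qed
  finally show ?thesis .
qed

end

text \<open>Transport applies to nonnegative functions, so the positive and negative parts of \<phi>
  are compared window by window: on each window the negative part exceeds the positive part by at
  most \<epsilon> per element and a constant. As window sizes lie between \<open>2 * N\<close> and
  \<open>2 * N + M\<close>, dividing by \<open>2 * N\<close> and letting \<open>N\<close> grow
  leaves only \<epsilon> times the mass of \<open>A\<close>.\<close>

lemma (in fuchsian_group) current_positive:
  assumes \<Gamma>: "\<Gamma> = deck_auts p" and \<mu>: "\<mu> \<in> currents p" and \<phi>: "\<phi> \<in> test_functions"
    and closed: "\<And>g x y. g \<in> \<Gamma> \<Longrightarrow> norm x = 1 \<Longrightarrow> norm y = 1 \<Longrightarrow> g x = x \<Longrightarrow> g y = y \<Longrightarrow> 1 < geo_pos x y g \<Longrightarrow>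
       0 \<le> (\<Sum>G\<in>{G \<in> {h ` {x, y} | h. h \<in> \<Gamma>}. \<phi> G \<noteq> 0}. \<phi> G)"
  shows "0 \<le> (\<integral>G. \<phi> G \<partial>\<mu>)"
proof -
  obtain \<delta>1 where \<delta>1: "\<delta>1 > 0" "\<And>G. G \<in> geodesics \<Longrightarrow> separation G < \<delta>1 \<Longrightarrow> \<phi> G = 0"
    using test_function_support[OF \<phi>] by blast
  obtain \<delta>2 where \<delta>2: "\<delta>2 > 0"
    "\<And>x y T. norm x = 1 \<Longrightarrow> norm y = 1 \<Longrightarrow> x \<noteq> y \<Longrightarrow> \<exists>f\<in>near \<delta>2 x y. T < geo_pos x y f"
    using unbounded_positions by blast
  \<comment> \<open>Halving provides the support condition at \<open>2 * \<delta>\<close>;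
    decreasing \<delta> enlarges \<open>near\<close>, so positions stay unbounded.\<close>
  define \<delta> where "\<delta> = min (\<delta>1 / 2) \<delta>2"
  have \<delta>: "\<delta> > 0" "2 * \<delta> \<le> \<delta>1" "\<delta> \<le> \<delta>2"
    using \<delta>1(1) \<delta>2(1) min.cobounded1[of "\<delta>1 / 2" \<delta>2] min.cobounded2[of "\<delta>1 / 2" \<delta>2]
    unfolding \<delta>_def by auto
  obtain b where b: "\<And>G. G \<in> geodesics \<Longrightarrow> \<bar>\<phi> G\<bar> \<le> b" using test_function_bounded[OF \<phi>] by blast
  \<comment> \<open>On the diagonal the pair is a singleton and no geodesic, so \<phi> is
    unconstrained there; 0 fits the support condition.\<close>
  define \<Phi> where "\<Phi> x y = (if x = y then 0 else \<phi> {x, y})" for x y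
  have small: "\<phi> {x, y} = 0" if "norm x = 1" "norm y = 1" "x \<noteq> y" "norm (x - y) < 2 * \<delta>" for x y
    using \<delta>1(2)[OF geodesicI[OF that(1-3)]] that \<delta>(2) by (simp add: separation_doubleton)
  interpret closing_function \<Gamma> \<Phi> \<delta> "max 0 b"
  proof unfold_locales
    show "\<delta> > 0" by (rule \<delta>)
    show "\<exists>f\<in>near \<delta> x y. T < geo_pos x y f" if n: "norm x = 1" "norm y = 1" "x \<noteq> y" for x y T
    proof -
      obtain f where "f \<in> near \<delta>2 x y" "T < geo_pos x y f" using \<delta>2(2)[OF n] by blast
      then show ?thesis using \<delta>(3) by (intro bexI[of _ f]) (auto simp: near_def)
    qed
    show "\<bar>\<Phi> x y\<bar> \<le> max 0 b" if "norm x = 1" "norm y = 1" for x y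
      using b[OF geodesicI[OF that]] unfolding \<Phi>_def by fastforce
    show "\<Phi> x y = 0" if "norm x = 1" "norm y = 1" "norm (x - y) < 2 * \<delta>" for x y
      using small[OF that(1,2) _ that(3)] by (simp add: \<Phi>_def)
    show "\<exists>\<theta>>0. \<forall>x y z w. norm x = 1 \<longrightarrow> norm y = 1 \<longrightarrow> norm z = 1 \<longrightarrow> norm w = 1 \<longrightarrow>
        \<delta> \<le> norm (x - y) \<longrightarrow> norm (x - z) \<le> \<theta> \<longrightarrow> norm (y - w) \<le> \<theta> \<longrightarrow> \<bar>\<Phi> x y - \<Phi> z w\<bar> \<le> \<epsilon>"
      if \<epsilon>: "\<epsilon> > 0" for \<epsilon> :: real
    proof -
      obtain \<theta> where t: "\<theta> > 0" "\<And>x y z w. norm x = 1 \<Longrightarrow> norm y = 1 \<Longrightarrow> norm z = 1 \<Longrightarrow> norm w = 1 \<Longrightarrow>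
        \<delta> \<le> norm (x - y) \<Longrightarrow> norm (x - z) \<le> \<theta> \<Longrightarrow> norm (y - w) \<le> \<theta> \<Longrightarrow> z \<noteq> w \<and> \<bar>\<phi> {x, y} - \<phi> {z, w}\<bar> \<le> \<epsilon>"
        using test_function_uniform[OF \<phi> \<delta>(1) \<epsilon>] by blast
      have "\<bar>\<Phi> x y - \<Phi> z w\<bar> \<le> \<epsilon>"
        if "norm x = 1" "norm y = 1" "norm z = 1" "norm w = 1"
          "\<delta> \<le> norm (x - y)" "norm (x - z) \<le> \<theta>" "norm (y - w) \<le> \<theta>" for x y z w
      proof -
        have "x \<noteq> y" using that(5) \<delta>(1) by auto
        then show ?thesis using t(2)[OF that] by (simp add: \<Phi>_def)
      qed
      then show ?thesis using t(1) by blast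
    qed
    show "0 \<le> (\<Sum>f\<in>{f \<in> near \<delta> x y. 1 \<le> geo_pos x y f \<and> geo_pos x y f < geo_pos x y g}. \<Phi> (finv f x) (finv f y))"
      if g: "g \<in> \<Gamma>" "norm x = 1" "norm y = 1" "x \<noteq> y" "g x = x" "g y = y" "1 < geo_pos x y g" for g x y
    proof -
      let ?D = "{f \<in> near \<delta> x y. 1 \<le> geo_pos x y f \<and> geo_pos x y f < geo_pos x y g}"
      let ?O = "{h ` {x, y} | h. h \<in> \<Gamma> \<and> \<delta> \<le> norm (h x - h y)}"
      obtain m :: nat where m: "(\<Sum>f\<in>?D. \<phi> (finv f ` {x, y})) = m * sum \<phi> ?O" "finite ?O"
        by (rule periodic_sum[OF \<delta>(1) g(1-3,5-7)]) blast
      have "(\<Sum>f\<in>?D. \<Phi> (finv f x) (finv f y)) = (\<Sum>f\<in>?D. \<phi> (finv f ` {x, y}))"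
        using g(4) by (intro sum.cong) (auto simp: \<Phi>_def near_def finv_eq_iff)
      moreover have "sum \<phi> ?O = (\<Sum>G\<in>{G \<in> {h ` {x, y} | h. h \<in> \<Gamma>}. \<phi> G \<noteq> 0}. \<phi> G)"
      proof (rule sum.mono_neutral_right[OF m(2)])
        show "{G \<in> {h ` {x, y} | h. h \<in> \<Gamma>}. \<phi> G \<noteq> 0} \<subseteq> ?O"
        proof
          fix G assume "G \<in> {G \<in> {h ` {x, y} | h. h \<in> \<Gamma>}. \<phi> G \<noteq> 0}"
          then obtain h where h: "h \<in> \<Gamma>" "G = h ` {x, y}" "\<phi> G \<noteq> 0" by blast
          have "\<not> norm (h x - h y) < 2 * \<delta>"
            using small[of "h x" "h y"] h g in_eq_iff[OF h(1)] by auto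
          then have "\<delta> \<le> norm (h x - h y)" using \<delta>(1) by linarith
          then show "G \<in> ?O" using h by blast
        qed
      qed blast
      ultimately show ?thesis
        using m(1) closed[OF g(1-3,5-7)] by simp
    qed
  qed
  define A where "A = {G \<in> geodesics. \<delta> \<le> separation G}"
  define W where "W N G = window \<delta> N (end1 G) (end2 G)" for N G
  obtain M :: nat where M: "\<And>x y N. norm x = 1 \<Longrightarrow> norm y = 1 \<Longrightarrow> \<delta> \<le> norm (x - y) \<Longrightarrow>
      finite (window \<delta> N x y) \<and> 2 * N \<le> card (window \<delta> N x y) \<and> card (window \<delta> N x y) \<le> 2 * N + M"
  proof (rule card_window[OF \<delta>_pos unbounded])
    fix M :: nat
    assume "\<And>x y N. norm x = 1 \<Longrightarrow> norm y = 1 \<Longrightarrow> \<delta> \<le> norm (x - y) \<Longrightarrow>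
      finite (window \<delta> N x y) \<and> 2 * N \<le> card (window \<delta> N x y) \<and> card (window \<delta> N x y) \<le> 2 * N + M"
    then show thesis by (rule that)
  qed
  have Aends: "norm (end1 G) = 1 \<and> norm (end2 G) = 1 \<and> \<delta> \<le> norm (end1 G - end2 G) \<and> end1 G \<noteq> end2 G
      \<and> G = {end1 G, end2 G}" if "G \<in> A" for G
    using geodesic_ends[of G] that by (simp add: A_def separation_def)
  have MW: "finite (W N G)" "2 * N \<le> card (W N G)" "card (W N G) \<le> 2 * N + M" if "G \<in> A" for N G
    using M Aends[OF that] by (auto simp: W_def)
  define I1 I2 where "I1 = (\<integral>\<^sup>+G. ennreal (\<phi> G) \<partial>\<mu>)" and "I2 = (\<integral>\<^sup>+G. ennreal (- \<phi> G) \<partial>\<mu>)"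
  have fin: "I1 < \<infinity>" "I2 < \<infinity>"
  proof -
    have "I1 \<le> (\<integral>\<^sup>+G. ennreal \<bar>\<phi> G\<bar> \<partial>\<mu>)" "I2 \<le> (\<integral>\<^sup>+G. ennreal \<bar>\<phi> G\<bar> \<partial>\<mu>)"
      unfolding I1_def I2_def by (intro nn_integral_mono ennreal_leI; simp)+
    then show "I1 < \<infinity>" "I2 < \<infinity>"
      using nn_integral_test_function_finite[OF \<mu> \<phi>] by (auto intro: le_less_trans)
  qed
  define a where "a = enn2real (emeasure \<mu> A)"
  have a: "emeasure \<mu> A = ennreal a" "a \<ge> 0"
    using current_finite[OF \<mu> \<delta>(1)] by (auto simp: a_def A_def)
  have As: "A \<in> sets \<mu>" using separated_sets by (simp add: A_def current_sets[OF \<mu>])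
  have \<phi>A: "\<phi> G = 0" if "G \<in> geodesics" "G \<notin> A" for G
    using \<delta>1(2)[OF that(1)] that \<delta> by (simp add: A_def)
  have m\<phi>: "\<phi> \<in> borel_measurable geodesic_borel" by (rule test_function_measurable[OF \<phi>])
  have key: "enn2real I2 \<le> (1 + real M / (2 * real N)) * (enn2real I1 + (\<epsilon> * (1 + real M / (2 * real N)) + C / (2 * real N)) * a)"
    if "N \<ge> 1" "\<epsilon> > 0" "C \<ge> 0"
      and C: "\<And>x y N. norm x = 1 \<Longrightarrow> norm y = 1 \<Longrightarrow> \<delta> \<le> norm (x - y) \<Longrightarrow>
        - \<epsilon> * card (window \<delta> N x y) - C \<le> sum (translate x y) (window \<delta> N x y)"
    for N :: nat and \<epsilon> C :: real
  proof -
    \<comment> \<open>The total loss \<epsilon> * (2 * N + M) + C of a window, spread over the at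
      least \<open>2 * N\<close> elements in it.\<close>
    define \<kappa> where "\<kappa> = \<epsilon> * (1 + real M / (2 * real N)) + C / (2 * real N)"
    have \<kappa>: "\<kappa> \<ge> 0" using that by (simp add: \<kappa>_def)
    have \<kappa>N: "\<kappa> * (2 * N) = \<epsilon> * (2 * N + M) + C" using that(1) by (simp add: \<kappa>_def field_simps)
    \<comment> \<open>The correction is confined to \<open>A\<close>, where the current has finite
      mass; every geodesic pulled back along a window lies in \<open>A\<close>, so each term of a
      window sum receives it.\<close>
    define \<psi> where "\<psi> G = ennreal (\<phi> G) + ennreal \<kappa> * indicator A G" for G
    have m\<psi>: "\<psi> \<in> borel_measurable geodesic_borel"
      unfolding \<psi>_def using m\<phi> As by (simp add: current_sets[OF \<mu>])
    have win: "\<And>x y. norm x = 1 \<Longrightarrow> norm y = 1 \<Longrightarrow> \<delta> \<le> norm (x - y) \<Longrightarrow> finite (window \<delta> N x y)"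
      using M by blast
    have pt: "(\<Sum>f\<in>W N G. ennreal (- \<phi> (finv f ` G))) \<le> (\<Sum>f\<in>W N G. \<psi> (finv f ` G))" if G: "G \<in> A" for G
    proof -
      define v where "v f = \<phi> (finv f ` G)" for f
      have e: "norm (end1 G) = 1" "norm (end2 G) = 1" "\<delta> \<le> norm (end1 G - end2 G)" "end1 G \<noteq> end2 G" "G = {end1 G, end2 G}"
        using Aends[OF G] by auto
      have vW: "v f = translate (end1 G) (end2 G) f \<and> finv f ` G \<in> A" if "f \<in> W N G" for f
      proof -
        have f: "f \<in> \<Gamma>" "\<delta> \<le> norm (finv f (end1 G) - finv f (end2 G))"
          using that by (auto simp: W_def window_def near_def)
        have ne: "finv f (end1 G) \<noteq> finv f (end2 G)" using e(4) finv_eq_iff[OF f(1)] by simp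
        have im: "finv f ` G = {finv f (end1 G), finv f (end2 G)}" by (subst e(5)) simp
        have "{finv f (end1 G), finv f (end2 G)} \<in> geodesics"
          using ne f(1) e by (intro geodesicI) auto
        then show ?thesis using ne f(2) by (simp add: v_def im \<Phi>_def A_def separation_doubleton)
      qed
      have sumv: "- \<epsilon> * card (W N G) - C \<le> (\<Sum>f\<in>W N G. v f)"
        using C[OF e(1-3), of N] vW by (simp add: W_def)
      have "(\<Sum>f\<in>W N G. max 0 (- v f)) = (\<Sum>f\<in>W N G. max 0 (v f)) - (\<Sum>f\<in>W N G. v f)"
        unfolding sum_subtractf[symmetric] by (intro sum.cong) (auto simp: max_def)
      also have "\<dots> \<le> (\<Sum>f\<in>W N G. max 0 (v f)) + (\<epsilon> * (2 * N + M) + C)"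
      proof -
        have "\<epsilon> * card (W N G) \<le> \<epsilon> * (2 * N + M)"
          using MW(3)[OF G, of N] \<open>\<epsilon> > 0\<close> by (intro mult_left_mono) (auto simp flip: of_nat_add)
        then show ?thesis using sumv by linarith
      qed
      also have "\<dots> \<le> (\<Sum>f\<in>W N G. max 0 (v f)) + \<kappa> * card (W N G)"
      proof -
        have "\<kappa> * (2 * N) \<le> \<kappa> * card (W N G)"
          using MW(2)[OF G, of N] \<kappa> by (intro mult_left_mono) auto
        then show ?thesis using \<kappa>N by simp
      qed
      also have "\<dots> = (\<Sum>f\<in>W N G. max 0 (v f) + \<kappa>)" by (simp add: sum.distrib mult.commute)
      finally have real: "(\<Sum>f\<in>W N G. max 0 (- v f)) \<le> (\<Sum>f\<in>W N G. max 0 (v f) + \<kappa>)" .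
      have "(\<Sum>f\<in>W N G. ennreal (- \<phi> (finv f ` G))) = (\<Sum>f\<in>W N G. ennreal (max 0 (- v f)))"
        by (rule sum.cong[OF refl]) (simp add: v_def max_def ennreal_neg)
      also have "\<dots> = ennreal (\<Sum>f\<in>W N G. max 0 (- v f))" by (rule sum_ennreal) simp
      also have "\<dots> \<le> ennreal (\<Sum>f\<in>W N G. max 0 (v f) + \<kappa>)" using real by (rule ennreal_leI)
      also have "\<dots> = (\<Sum>f\<in>W N G. ennreal (max 0 (v f) + \<kappa>))" using \<kappa> by (intro sum_ennreal[symmetric]) simp
      also have "\<dots> = (\<Sum>f\<in>W N G. \<psi> (finv f ` G))"
        using vW \<kappa> by (intro sum.cong) (auto simp: \<psi>_def v_def max_def ennreal_neg ennreal_plus)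
      finally show ?thesis .
    qed
    have "ennreal (2 * N) * I2 \<le> (\<integral>\<^sup>+G. ennreal (- \<phi> G) * of_nat (card (W N G)) * indicator A G \<partial>\<mu>)"
    proof -
      have "ennreal (2 * N) * I2 = (\<integral>\<^sup>+G. ennreal (2 * N) * ennreal (- \<phi> G) \<partial>\<mu>)"
        unfolding I2_def using m\<phi> by (intro nn_integral_cmult[symmetric]) (simp add: current_measurable[OF \<mu>])
      also have "\<dots> \<le> (\<integral>\<^sup>+G. ennreal (- \<phi> G) * of_nat (card (W N G)) * indicator A G \<partial>\<mu>)"
      proof (rule nn_integral_mono)
        fix G assume "G \<in> space \<mu>"
        then have G: "G \<in> geodesics" by (simp add: current_space[OF \<mu>])
        show "ennreal (2 * N) * ennreal (- \<phi> G) \<le> ennreal (- \<phi> G) * of_nat (card (W N G)) * indicator A G"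
        proof (cases "G \<in> A")
          case True
          have "ennreal (2 * N) \<le> of_nat (card (W N G))"
            using MW(2)[OF True, of N] by (simp add: ennreal_of_nat_eq_real_of_nat ennreal_leI)
          then show ?thesis using True by (simp add: mult.commute mult_left_mono)
        next
          case False
          then show ?thesis using \<phi>A[OF G] by simp
        qed
      qed
      finally show ?thesis .
    qed
    also have "\<dots> = (\<integral>\<^sup>+G. (\<Sum>f\<in>W N G. ennreal (- \<phi> (finv f ` G))) * indicator A G \<partial>\<mu>)"
      unfolding W_def A_def using m\<phi> by (intro mass_transport[OF \<Gamma> \<mu> \<delta>(1) win, symmetric]) auto
    also have "\<dots> \<le> (\<integral>\<^sup>+G. (\<Sum>f\<in>W N G. \<psi> (finv f ` G)) * indicator A G \<partial>\<mu>)"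
      using pt by (intro nn_integral_mono) (auto simp: indicator_def)
    also have "\<dots> = (\<integral>\<^sup>+G. \<psi> G * of_nat (card (W N G)) * indicator A G \<partial>\<mu>)"
      unfolding W_def A_def using m\<psi> by (intro mass_transport[OF \<Gamma> \<mu> \<delta>(1) win]) auto
    also have "\<dots> \<le> (\<integral>\<^sup>+G. ennreal (2 * N + M) * \<psi> G \<partial>\<mu>)"
    proof (rule nn_integral_mono)
      fix G assume "G \<in> space \<mu>"
      show "\<psi> G * of_nat (card (W N G)) * indicator A G \<le> ennreal (2 * N + M) * \<psi> G"
      proof (cases "G \<in> A")
        case True
        have "of_nat (card (W N G)) \<le> ennreal (2 * N + M)"
          unfolding ennreal_of_nat_eq_real_of_nat using MW(3)[OF True, of N] by (intro ennreal_leI) linarith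
        then show ?thesis using True by (simp add: mult.commute mult_left_mono)
      qed simp
    qed
    also have "\<dots> = ennreal (2 * N + M) * (I1 + ennreal \<kappa> * emeasure \<mu> A)"
    proof -
      have "(\<integral>\<^sup>+G. \<psi> G \<partial>\<mu>) = I1 + ennreal \<kappa> * emeasure \<mu> A"
      proof -
        have "\<phi> \<in> borel_measurable \<mu>" using m\<phi> by (simp add: current_measurable[OF \<mu>])
        then show ?thesis
          unfolding \<psi>_def I1_def using As
          by (subst nn_integral_add) (auto simp: nn_integral_cmult_indicator)
      qed
      then show ?thesis
        using m\<psi> by (subst nn_integral_cmult) (auto simp: current_measurable[OF \<mu>])
    qed
    finally have le: "ennreal (2 * N) * I2 \<le> ennreal (2 * N + M) * (I1 + ennreal \<kappa> * emeasure \<mu> A)" .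
    have "I1 = ennreal (enn2real I1)" "I2 = ennreal (enn2real I2)" using fin by (simp_all add: less_top)
    then have "ennreal (2 * N * enn2real I2) \<le> ennreal ((2 * N + M) * (enn2real I1 + \<kappa> * a))"
    proof -
      assume i1: "I1 = ennreal (enn2real I1)" and i2: "I2 = ennreal (enn2real I2)"
      have "ennreal (2 * N * enn2real I2) = ennreal (2 * N) * I2"
        by (subst ennreal_mult) (auto simp flip: i2)
      also have "\<dots> \<le> ennreal (2 * N + M) * (I1 + ennreal \<kappa> * emeasure \<mu> A)" by (rule le)
      also have "\<dots> = ennreal (2 * N + M) * (ennreal (enn2real I1) + ennreal (\<kappa> * a))"
        using \<kappa> a by (simp add: ennreal_mult flip: i1)
      also have "\<dots> = ennreal ((2 * N + M) * (enn2real I1 + \<kappa> * a))"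
        using \<kappa> a by (simp add: ennreal_mult ennreal_plus)
      finally show ?thesis .
    qed
    then have "2 * N * enn2real I2 \<le> (2 * N + M) * (enn2real I1 + \<kappa> * a)"
      using \<kappa> a by (subst (asm) ennreal_le_iff) auto
    then have "enn2real I2 \<le> (2 * N + M) * (enn2real I1 + \<kappa> * a) / (2 * N)"
      using that(1) by (simp add: field_simps)
    also have "\<dots> = (1 + real M / (2 * real N)) * (enn2real I1 + \<kappa> * a)"
      using that(1) by (simp add: field_simps)
    finally show ?thesis unfolding \<kappa>_def .
  qed
  have bound: "enn2real I2 \<le> enn2real I1 + \<epsilon> * a" if \<epsilon>: "\<epsilon> > 0" for \<epsilon> :: real
  proof -
    obtain C where C: "\<And>x y N. norm x = 1 \<Longrightarrow> norm y = 1 \<Longrightarrow> \<delta> \<le> norm (x - y) \<Longrightarrow>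
        - \<epsilon> * card (window \<delta> N x y) - C \<le> sum (translate x y) (window \<delta> N x y)"
      using window_estimate[OF \<epsilon>] by blast
    have C': "- \<epsilon> * card (window \<delta> N x y) - max 0 C \<le> sum (translate x y) (window \<delta> N x y)"
      if "norm x = 1" "norm y = 1" "\<delta> \<le> norm (x - y)" for x y N
      using C[OF that, of N] max.cobounded2[of C 0] by linarith
    have inv: "(\<lambda>N. c / (2 * real N)) \<longlonglongrightarrow> 0" for c
      using tendsto_mult[OF tendsto_const[of "c / 2"] lim_1_over_n] by simp
    have "(\<lambda>N. (1 + real M / (2 * real N)) * (enn2real I1 + (\<epsilon> * (1 + real M / (2 * real N)) + max 0 C / (2 * real N)) * a))
        \<longlonglongrightarrow> (1 + 0) * (enn2real I1 + (\<epsilon> * (1 + 0) + 0) * a)" (is "?X \<longlonglongrightarrow> ?L")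
      by (intro tendsto_intros inv)
    moreover have "\<exists>k. \<forall>N\<ge>k. enn2real I2 \<le> ?X N"
    proof (intro exI[of _ 1] allI impI)
      fix N :: nat assume "1 \<le> N"
      then show "enn2real I2 \<le> ?X N"
      proof (rule key)
        show "\<epsilon> > 0" by (rule \<epsilon>)
        show "max 0 C \<ge> 0" by simp
      qed (rule C')
    qed
    ultimately have "enn2real I2 \<le> ?L" by (rule LIMSEQ_le_const)
    then show ?thesis by simp
  qed
  have "enn2real I2 \<le> enn2real I1"
  proof (rule field_le_epsilon)
    fix e :: real assume e: "e > 0"
    \<comment> \<open>The denominator is \<open>a + 1\<close> because the current may have no mass
      on \<open>A\<close>.\<close>
    have "enn2real I2 \<le> enn2real I1 + e / (a + 1) * a" using bound[of "e / (a + 1)"] e a by simp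
    also have "e / (a + 1) * a \<le> e" using e a by (simp add: field_simps)
    finally show "enn2real I2 \<le> enn2real I1 + e" by simp
  qed
  then show ?thesis
    using real_lebesgue_integral_def[OF integrable_test_function[OF \<mu> \<phi>]] by (simp add: I1_def I2_def)
qed

section \<open>The cone of currents\<close>

text \<open>Sum and product of the ends map the space of geodesics injectively and continuously into
  a Hausdorff space, so it is Hausdorff and its compact sets are closed.\<close>

lemma compactin_sets_geodesic_borel:
  assumes "compactin geodesic_topology K"
  shows "K \<in> sets geodesic_borel"
proof -
  have "inj_on (\<lambda>G. (\<Sum>G, \<Prod>G)) geodesics"
  proof (rule inj_onI)
    fix G H :: "complex set" assume GH: "G \<in> geodesics" "H \<in> geodesics" "(\<Sum>G, \<Prod>G) = (\<Sum>H, \<Prod>H)"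
    then have "end1 G = end1 H" "end2 G = end2 H" by (auto simp: end1_def end2_def)
    then show "G = H" using geodesic_ends(1) GH by metis
  qed
  moreover have "continuous_map geodesic_topology euclidean (\<lambda>G. (\<Sum>G, \<Prod>G) :: complex \<times> complex)"
    using continuous_on_ends_sym(1,2)[THEN continuous_map_geodesicD]
    by (intro continuous_map_geodesicI continuous_on_Pair)
  ultimately have "Hausdorff_space geodesic_topology"
    unfolding topspace_geodesic_topology[symmetric]
    by (intro Hausdorff_space_injective_preimage[OF Hausdorff_space_euclidean])
  then have "closedin geodesic_topology K" using assms by (rule compactin_imp_closedin)
  then have c: "K \<subseteq> geodesics" "openin geodesic_topology (geodesics - K)"
    by (auto simp: closedin_def topspace_geodesic_topology)
  have "space geodesic_borel - (geodesics - K) \<in> sets geodesic_borel"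
    using openin_sets_geodesic_borel[OF c(2)] by (rule sets.compl_sets)
  moreover have "space geodesic_borel - (geodesics - K) = K" using c(1) by auto
  ultimately show ?thesis by simp
qed

lemma deck_image_sets:
  assumes "g \<in> deck_group p" "B \<in> sets geodesic_borel"
  shows "(`) g ` B \<in> sets geodesic_borel"
proof -
  define f where "f = ext g"
  have f: "disc_aut f" using disc_aut_ext[of g] assms(1) by (simp add: f_def deck_group_def)
  have inv: "disc_aut (finv f)" "bij f" using disc_aut_inverse[OF f] by auto
  have B: "B \<subseteq> geodesics" using sets.sets_into_space[OF assms(2)] by simp
  have "(`) g ` B = (`) f ` B"
  proof (rule image_cong[OF refl])
    fix G assume "G \<in> B"
    then have "G \<in> geodesics" using B by blast
    then show "g ` G = f ` G" unfolding f_def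
      by (intro ext_image[symmetric]) (metis geodesicE insertE order_refl singletonD)
  qed
  also have "\<dots> = (\<lambda>G. finv f ` G) -` B \<inter> space geodesic_borel"
  proof (intro equalityI subsetI)
    fix H assume "H \<in> (`) f ` B"
    then obtain G where G: "G \<in> B" "H = f ` G" by blast
    have "finv f ` H = G" using G inv(2) by (simp add: bij_is_inj)
    moreover have "H \<in> geodesics" using disc_aut_image_geodesic[OF f] G B by blast
    ultimately show "H \<in> (\<lambda>G. finv f ` G) -` B \<inter> space geodesic_borel" using G by simp
  next
    fix H assume H: "H \<in> (\<lambda>G. finv f ` G) -` B \<inter> space geodesic_borel"
    have "f ` (finv f ` H) = H" using inv(2) by (simp add: bij_is_surj image_f_inv_f)
    then show "H \<in> (`) f ` B" using H by (intro image_eqI[of _ _ "finv f ` H"]) auto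
  qed
  finally show ?thesis using measurable_sets[OF disc_aut_image_measurable[OF inv(1)] assms(2)] by simp
qed

text \<open>For inner regularity the suprema for \<mu> and \<nu> run over different compact sets,
  which are merged by unions. The integral formula is proved for nonnegative functions by induction
  over measurable functions and then applied to positive and negative parts.\<close>

lemma current_combination:
  assumes \<mu>: "\<mu> \<in> currents p" and \<nu>: "\<nu> \<in> currents p" and ab: "0 \<le> a" "0 \<le> b"
  obtains \<rho> where "\<rho> \<in> currents p"
    "\<And>B. B \<in> sets geodesic_borel \<Longrightarrow> emeasure \<rho> B = ennreal a * emeasure \<mu> B + ennreal b * emeasure \<nu> B"
    "\<And>\<phi>. \<phi> \<in> test_functions \<Longrightarrow> (\<integral>G. \<phi> G \<partial>\<rho>) = a * (\<integral>G. \<phi> G \<partial>\<mu>) + b * (\<integral>G. \<phi> G \<partial>\<nu>)"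
proof -
  define m where "m B = ennreal a * emeasure \<mu> B + ennreal b * emeasure \<nu> B" for B
  define \<rho> where "\<rho> = measure_of geodesics (sets geodesic_borel) m"
  have s\<mu>: "sets \<mu> = sets geodesic_borel" and s\<nu>: "sets \<nu> = sets geodesic_borel"
    using current_sets \<mu> \<nu> by auto
  have sa: "sigma_algebra geodesics (sets geodesic_borel)"
    using sets.sigma_algebra_axioms[of geodesic_borel] by simp
  have s\<rho>: "sets \<rho> = sets geodesic_borel"
    unfolding \<rho>_def using sigma_algebra.sets_measure_of_eq[OF sa] .
  have "countably_additive (sets geodesic_borel) m"
  proof (rule countably_additiveI)
    fix F :: "nat \<Rightarrow> complex set set"
    assume F: "range F \<subseteq> sets geodesic_borel" "disjoint_family F" "\<Union>(range F) \<in> sets geodesic_borel"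
    have 1: "suminf (\<lambda>i. emeasure \<mu> (F i)) = emeasure \<mu> (\<Union>(range F))" "suminf (\<lambda>i. emeasure \<nu> (F i)) = emeasure \<nu> (\<Union>(range F))"
      using F by (intro suminf_emeasure; simp add: s\<mu> s\<nu>)+
    have "suminf (\<lambda>i. m (F i)) = suminf (\<lambda>i. ennreal a * emeasure \<mu> (F i)) + suminf (\<lambda>i. ennreal b * emeasure \<nu> (F i))"
      unfolding m_def by (rule suminf_add[symmetric]) auto
    also have "\<dots> = m (\<Union>(range F))" unfolding ennreal_suminf_cmult 1 m_def ..
    finally show "suminf (\<lambda>i. m (F i)) = m (\<Union>(range F))" .
  qed
  then have em: "emeasure \<rho> B = m B" if "B \<in> sets geodesic_borel" for B
    unfolding \<rho>_def using sa that
    by (intro emeasure_measure_of_sigma) (auto simp: positive_def m_def)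
  have nn: "(\<integral>\<^sup>+G. h G \<partial>\<rho>) = ennreal a * (\<integral>\<^sup>+G. h G \<partial>\<mu>) + ennreal b * (\<integral>\<^sup>+G. h G \<partial>\<nu>)"
    if "h \<in> borel_measurable geodesic_borel" for h
    using that
  proof (induction rule: borel_measurable_induct)
    case (cong f g)
    then have "f G = g G" if "G \<in> geodesics" for G using that by simp
    then have "(\<integral>\<^sup>+G. f G \<partial>M) = (\<integral>\<^sup>+G. g G \<partial>M)" if "sets M = sets geodesic_borel" for M
      using sets_eq_imp_space_eq[OF that] by (intro nn_integral_cong) auto
    then show ?case using cong s\<mu> s\<nu> s\<rho> by simp
  next
    case (set A)
    then show ?case using em[OF set] by (simp add: s\<mu> s\<nu> s\<rho> m_def)
  next
    case (mult u c)
    then show ?case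
      by (simp add: nn_integral_cmult measurable_cong_sets[OF s\<mu> refl] measurable_cong_sets[OF s\<nu> refl]
          measurable_cong_sets[OF s\<rho> refl] distrib_left mult_ac)
  next
    case (add u v)
    then show ?case
      by (simp add: nn_integral_add measurable_cong_sets[OF s\<mu> refl] measurable_cong_sets[OF s\<nu> refl]
          measurable_cong_sets[OF s\<rho> refl] distrib_left add_ac)
  next
    case (seq U)
    have conv: "(\<integral>\<^sup>+G. (SUP i. U i) G \<partial>M) = (SUP i. \<integral>\<^sup>+G. U i G \<partial>M)" if "sets M = sets geodesic_borel" for M
    proof -
      have "U i \<in> borel_measurable M" for i using seq by (simp add: measurable_cong_sets[OF that refl])
      moreover have "incseq U" using seq by simp
      ultimately have "(\<integral>\<^sup>+G. (SUP i. U i G) \<partial>M) = (SUP i. \<integral>\<^sup>+G. U i G \<partial>M)"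
        by (intro nn_integral_monotone_convergence_SUP)
      then show ?thesis by (simp add: SUP_apply image_image)
    qed
    have inc: "incseq (\<lambda>i. \<integral>\<^sup>+G. U i G \<partial>M)" for M
      using seq by (auto simp: incseq_def le_fun_def intro!: nn_integral_mono)
    have "(\<integral>\<^sup>+G. (SUP i. U i) G \<partial>\<rho>) = (SUP i. ennreal a * (\<integral>\<^sup>+G. U i G \<partial>\<mu>) + ennreal b * (\<integral>\<^sup>+G. U i G \<partial>\<nu>))"
      using conv[OF s\<rho>] seq by simp
    also have "\<dots> = (SUP i. ennreal a * (\<integral>\<^sup>+G. U i G \<partial>\<mu>)) + (SUP i. ennreal b * (\<integral>\<^sup>+G. U i G \<partial>\<nu>))"
      using inc by (intro ennreal_SUP_add) (auto simp: incseq_def intro!: mult_left_mono)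
    also have "\<dots> = ennreal a * (\<integral>\<^sup>+G. (SUP i. U i) G \<partial>\<mu>) + ennreal b * (\<integral>\<^sup>+G. (SUP i. U i) G \<partial>\<nu>)"
      unfolding conv[OF s\<mu>] conv[OF s\<nu>] by (simp add: SUP_mult_left_ennreal)
    finally show ?case .
  qed
  have "\<rho> \<in> currents p"
    unfolding currents_def
  proof (intro CollectI conjI allI ballI impI)
    show "sets \<rho> = sets geodesic_borel" by (rule s\<rho>)
    show "emeasure \<rho> K < \<infinity>" if K: "compactin geodesic_topology K" for K
    proof (cases "K \<in> sets geodesic_borel")
      case True
      have "emeasure \<mu> K < \<infinity>" "emeasure \<nu> K < \<infinity>" using \<mu> \<nu> K unfolding currents_def by auto
      then show ?thesis unfolding em[OF True] m_def by (simp add: ennreal_mult_less_top)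
    next
      case False
      then show ?thesis using emeasure_notin_sets[of K \<rho>] s\<rho> by simp
    qed
    show "emeasure \<rho> B = (SUP K \<in> {K. compactin geodesic_topology K \<and> K \<subseteq> B}. emeasure \<rho> K)"
      if B: "B \<in> sets geodesic_borel" for B
    proof (rule antisym)
      let ?I = "{K. compactin geodesic_topology K \<and> K \<subseteq> B}"
      have KG: "K \<in> sets geodesic_borel" if "compactin geodesic_topology K" for K
        by (rule compactin_sets_geodesic_borel[OF that])
      have "emeasure \<mu> B = (SUP K\<in>?I. emeasure \<mu> K)" "emeasure \<nu> B = (SUP K\<in>?I. emeasure \<nu> K)"
        using \<mu> \<nu> B unfolding currents_def by auto
      then have mB: "m B = (SUP K\<in>?I. ennreal a * emeasure \<mu> K) + (SUP K\<in>?I. ennreal b * emeasure \<nu> K)"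
        by (simp add: m_def SUP_mult_left_ennreal)
      have ne: "?I \<noteq> {}" by auto
      have le: "ennreal a * emeasure \<mu> K + ennreal b * emeasure \<nu> L \<le> (SUP K\<in>?I. m K)"
        if KL: "K \<in> ?I" "L \<in> ?I" for K L
      proof -
        have U: "K \<union> L \<in> ?I" using KL by (auto intro: compactin_Un)
        have "emeasure \<mu> K \<le> emeasure \<mu> (K \<union> L)" "emeasure \<nu> L \<le> emeasure \<nu> (K \<union> L)"
          using KL KG by (auto intro!: emeasure_mono simp: s\<mu> s\<nu>)
        then have "ennreal a * emeasure \<mu> K + ennreal b * emeasure \<nu> L \<le> m (K \<union> L)"
          unfolding m_def by (intro add_mono mult_left_mono) auto
        also have "\<dots> \<le> (SUP K\<in>?I. m K)" using U by (rule SUP_upper)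
        finally show ?thesis .
      qed
      have "m B = (SUP L\<in>?I. SUP K\<in>?I. ennreal a * emeasure \<mu> K + ennreal b * emeasure \<nu> L)"
        unfolding mB ennreal_SUP_add_left[OF ne, symmetric] ennreal_SUP_add_right[OF ne] ..
      also have "\<dots> \<le> (SUP K\<in>?I. m K)" using le by (intro SUP_least)
      also have "\<dots> = (SUP K\<in>?I. emeasure \<rho> K)"
        by (intro SUP_cong) (use em KG in \<open>auto simp: m_def\<close>)
      finally show "emeasure \<rho> B \<le> (SUP K\<in>?I. emeasure \<rho> K)" using em[OF B] by simp
      show "(SUP K\<in>?I. emeasure \<rho> K) \<le> emeasure \<rho> B"
        using B by (intro SUP_least emeasure_mono) (auto simp: s\<rho>)
    qed
    show "emeasure \<rho> ((`) g ` B) = emeasure \<rho> B" if g: "g \<in> deck_group p" and B: "B \<in> sets geodesic_borel" for g B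
    proof -
      have "(`) g ` B \<in> sets geodesic_borel" by (rule deck_image_sets[OF g B])
      moreover have "emeasure \<mu> ((`) g ` B) = emeasure \<mu> B" "emeasure \<nu> ((`) g ` B) = emeasure \<nu> B"
        using \<mu> \<nu> g B unfolding currents_def by auto
      ultimately show ?thesis using em B by (simp add: m_def)
    qed
  qed
  moreover have "(\<integral>G. \<phi> G \<partial>\<rho>) = a * (\<integral>G. \<phi> G \<partial>\<mu>) + b * (\<integral>G. \<phi> G \<partial>\<nu>)" if \<phi>: "\<phi> \<in> test_functions" for \<phi>
  proof -
    have part: "enn2real (\<integral>\<^sup>+G. ennreal (h G) \<partial>\<rho>)
        = a * enn2real (\<integral>\<^sup>+G. ennreal (h G) \<partial>\<mu>) + b * enn2real (\<integral>\<^sup>+G. ennreal (h G) \<partial>\<nu>)"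
      if h: "h \<in> borel_measurable geodesic_borel" "\<And>G. h G \<le> \<bar>\<phi> G\<bar>" for h
    proof -
      have "(\<integral>\<^sup>+G. ennreal (h G) \<partial>M) < \<infinity>" if "M \<in> currents p" for M
        by (rule le_less_trans[OF _ nn_integral_test_function_finite[OF that \<phi>]])
          (intro nn_integral_mono ennreal_leI h)
      then show ?thesis
        using nn[of "\<lambda>G. ennreal (h G)"] h(1) \<mu> \<nu> ab
        by (simp add: enn2real_plus ennreal_mult_less_top enn2real_mult)
    qed
    have "\<phi> \<in> borel_measurable geodesic_borel" by (rule test_function_measurable[OF \<phi>])
    then have p: "enn2real (\<integral>\<^sup>+G. ennreal (\<phi> G) \<partial>\<rho>)
        = a * enn2real (\<integral>\<^sup>+G. ennreal (\<phi> G) \<partial>\<mu>) + b * enn2real (\<integral>\<^sup>+G. ennreal (\<phi> G) \<partial>\<nu>)"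
      "enn2real (\<integral>\<^sup>+G. ennreal (- \<phi> G) \<partial>\<rho>)
        = a * enn2real (\<integral>\<^sup>+G. ennreal (- \<phi> G) \<partial>\<mu>) + b * enn2real (\<integral>\<^sup>+G. ennreal (- \<phi> G) \<partial>\<nu>)"
      by (intro part; simp)+
    show ?thesis
      unfolding p real_lebesgue_integral_def[OF integrable_test_function[OF \<mu> \<phi>]]
        real_lebesgue_integral_def[OF integrable_test_function[OF \<nu> \<phi>]]
        real_lebesgue_integral_def[OF integrable_test_function[OF \<open>\<rho> \<in> currents p\<close> \<phi>]]
      by (simp add: algebra_simps)
  qed
  ultimately show ?thesis using that em unfolding m_def by blast
qed

section \<open>Operations on test functions and weak* neighbourhoods\<close>

lemma test_function_zero: "(\<lambda>G. 0) \<in> test_functions"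
  unfolding test_functions_def by (auto intro!: exI[of _ "{}"])

lemma test_function_scale:
  assumes "\<phi> \<in> test_functions"
  shows "(\<lambda>G. c * \<phi> G) \<in> test_functions"
  using assms unfolding test_functions_def by (auto intro!: continuous_map_real_mult)

lemma test_function_abs:
  assumes "\<phi> \<in> test_functions"
  shows "(\<lambda>G. \<bar>\<phi> G\<bar>) \<in> test_functions"
  using assms unfolding test_functions_def by (auto intro!: continuous_map_real_abs)

lemma test_function_add:
  assumes "\<phi> \<in> test_functions" "\<psi> \<in> test_functions"
  shows "(\<lambda>G. \<phi> G + \<psi> G) \<in> test_functions"
proof -
  obtain K L where "compactin geodesic_topology K" "\<forall>G\<in>geodesics - K. \<phi> G = 0"
    "compactin geodesic_topology L" "\<forall>G\<in>geodesics - L. \<psi> G = 0"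
    using assms unfolding test_functions_def by blast
  then have "compactin geodesic_topology (K \<union> L)" "\<forall>G\<in>geodesics - (K \<union> L). \<phi> G + \<psi> G = 0"
    by (auto intro: compactin_Un)
  then show ?thesis
    using assms unfolding test_functions_def by (auto intro!: continuous_map_add)
qed

lemma test_function_sum:
  assumes "finite F" "\<And>\<phi>. \<phi> \<in> F \<Longrightarrow> h \<phi> \<in> test_functions"
  shows "(\<lambda>G. \<Sum>\<phi>\<in>F. h \<phi> G) \<in> test_functions"
  using assms by (induction F) (auto intro: test_function_zero test_function_add)

lemma topspace_weak_star_topology: "topspace (weak_star_topology p) = currents p"
proof -
  have "currents p = {\<mu> \<in> currents p. (\<integral>G. 0 \<partial>\<mu>) \<in> (UNIV :: real set)}" by simp
  then have "currents p \<in> {{\<mu> \<in> currents p. (\<integral>G. \<phi> G \<partial>\<mu>) \<in> U} | \<phi> U. \<phi> \<in> test_functions \<and> open U}"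
    using test_function_zero open_UNIV by blast
  then show ?thesis
    unfolding weak_star_topology_def topology_generated_by_topspace by blast
qed

lemma weak_star_neighbourhood:
  assumes "openin (weak_star_topology p) U" "\<mu> \<in> U"
  obtains F \<epsilon> where "finite F" "F \<subseteq> test_functions" "\<epsilon> > 0"
    "\<And>\<nu>. \<nu> \<in> currents p \<Longrightarrow> (\<And>\<phi>. \<phi> \<in> F \<Longrightarrow> \<bar>(\<integral>G. \<phi> G \<partial>\<nu>) - (\<integral>G. \<phi> G \<partial>\<mu>)\<bar> < \<epsilon>) \<Longrightarrow> \<nu> \<in> U"
proof -
  have "generate_topology_on {{\<mu> \<in> currents p. (\<integral>G. \<phi> G \<partial>\<mu>) \<in> U} | \<phi> U. \<phi> \<in> test_functions \<and> open U} U"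
    using assms(1) unfolding weak_star_topology_def by (rule openin_topology_generated_by)
  then have "\<exists>F \<epsilon>. finite F \<and> F \<subseteq> test_functions \<and> \<epsilon> > 0 \<and>
    (\<forall>\<nu>\<in>currents p. (\<forall>\<phi>\<in>F. \<bar>(\<integral>G. \<phi> G \<partial>\<nu>) - (\<integral>G. \<phi> G \<partial>\<mu>)\<bar> < \<epsilon>) \<longrightarrow> \<nu> \<in> U)"
    using assms(2)
  proof induction
    case (Int A B)
    then obtain F \<epsilon> H \<eta> where F: "finite F" "F \<subseteq> test_functions" "\<epsilon> > 0"
      "\<forall>\<nu>\<in>currents p. (\<forall>\<phi>\<in>F. \<bar>(\<integral>G. \<phi> G \<partial>\<nu>) - (\<integral>G. \<phi> G \<partial>\<mu>)\<bar> < \<epsilon>) \<longrightarrow> \<nu> \<in> A"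
      and H: "finite H" "H \<subseteq> test_functions" "\<eta> > 0"
      "\<forall>\<nu>\<in>currents p. (\<forall>\<phi>\<in>H. \<bar>(\<integral>G. \<phi> G \<partial>\<nu>) - (\<integral>G. \<phi> G \<partial>\<mu>)\<bar> < \<eta>) \<longrightarrow> \<nu> \<in> B"
      by blast
    show ?case
    proof (intro exI[of _ "F \<union> H"] exI[of _ "min \<epsilon> \<eta>"] conjI ballI impI)
      fix \<nu> assume "\<nu> \<in> currents p"
        "\<forall>\<phi>\<in>F \<union> H. \<bar>(\<integral>G. \<phi> G \<partial>\<nu>) - (\<integral>G. \<phi> G \<partial>\<mu>)\<bar> < min \<epsilon> \<eta>"
      then show "\<nu> \<in> A \<inter> B" using F(4) H(4) by simp
    qed (use F H in auto)
  next
    case (UN \<K>)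
    then obtain A where "A \<in> \<K>" "\<mu> \<in> A" by blast
    with UN.IH[OF this] show ?case by (meson UnionI)
  next
    case (Basis B)
    then obtain \<phi> V where B: "B = {\<mu> \<in> currents p. (\<integral>G. \<phi> G \<partial>\<mu>) \<in> V}" "\<phi> \<in> test_functions" "open V" by blast
    then have "(\<integral>G. \<phi> G \<partial>\<mu>) \<in> V" using Basis by blast
    then obtain \<epsilon> where e: "\<epsilon> > 0" "\<And>v. dist v (\<integral>G. \<phi> G \<partial>\<mu>) < \<epsilon> \<Longrightarrow> v \<in> V"
      using B(3) unfolding open_dist by blast
    show ?case
      using B(1,2) e by (intro exI[of _ "{\<phi>}"] exI[of _ \<epsilon>]) (auto simp: dist_real_def)
  qed simp
  then show ?thesis using that by metis
qed

section \<open>Density of closed curves\<close>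

text \<open>Compact sets have separation bounded below, so local finiteness of the orbit gives
  finite mass. For inner regularity finite sets serve as compact ones; a Borel set with infinitely
  many points of the orbit contains finite sets of arbitrarily large mass because \<open>k\<close>
  is positive.\<close>

lemma orbit_current:
  fixes k :: nat
  assumes \<O>: "\<O> \<subseteq> geodesics" and fin: "\<And>\<delta>. \<delta> > 0 \<Longrightarrow> finite {G \<in> \<O>. \<delta> \<le> separation G}"
    and inv: "\<And>g. g \<in> deck_group p \<Longrightarrow> (`) g ` \<O> = \<O> \<and> inj_on ((`) g) geodesics" and k: "k \<ge> 1"
  defines "\<nu> \<equiv> scale_measure (of_nat k) (distr (count_space \<O>) geodesic_borel (\<lambda>G. G))"
  shows "\<nu> \<in> currents p"
    and "\<phi> \<in> test_functions \<Longrightarrow> (\<integral>G. \<phi> G \<partial>\<nu>) = real k * (\<Sum>G\<in>{G \<in> \<O>. \<phi> G \<noteq> 0}. \<phi> G)"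
proof -
  have m: "(\<lambda>G. G) \<in> measurable (count_space \<O>) geodesic_borel" using \<O> by auto
  have s: "sets \<nu> = sets geodesic_borel" by (simp add: \<nu>_def)
  have em: "emeasure \<nu> B = of_nat k * emeasure (count_space \<O>) (B \<inter> \<O>)" if "B \<in> sets geodesic_borel" for B
    using m that by (simp add: \<nu>_def emeasure_distr)
  show cur: "\<nu> \<in> currents p"
    unfolding currents_def
  proof (intro CollectI conjI allI ballI impI)
    show "sets \<nu> = sets geodesic_borel" by (rule s)
    show "emeasure \<nu> K < \<infinity>" if K: "compactin geodesic_topology K" for K
    proof -
      obtain \<delta> where d: "\<delta> > 0" "\<And>G. G \<in> K \<Longrightarrow> \<delta> \<le> separation G" using compactin_separated[OF K] by blast
      have "finite (K \<inter> \<O>)" by (rule finite_subset[OF _ fin[OF d(1)]]) (use d in auto)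
      then show ?thesis
        using em[OF compactin_sets_geodesic_borel[OF K]] by (simp add: ennreal_mult_less_top of_nat_less_top)
    qed
    show "emeasure \<nu> B = (SUP K \<in> {K. compactin geodesic_topology K \<and> K \<subseteq> B}. emeasure \<nu> K)"
      if B: "B \<in> sets geodesic_borel" for B
    proof (rule antisym)
      let ?I = "{K. compactin geodesic_topology K \<and> K \<subseteq> B}"
      show "(SUP K\<in>?I. emeasure \<nu> K) \<le> emeasure \<nu> B"
        using B by (intro SUP_least emeasure_mono) (auto simp: s)
      have F: "of_nat (card F) \<le> (SUP K\<in>?I. emeasure \<nu> K) \<and> emeasure \<nu> F \<le> (SUP K\<in>?I. emeasure \<nu> K)"
        if F: "finite F" "F \<subseteq> B \<inter> \<O>" for F
      proof -
        have c: "compactin geodesic_topology F"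
          using F \<O> by (intro finite_imp_compactin) (auto simp: topspace_geodesic_topology)
        then have FI: "F \<in> ?I" using F by blast
        have e: "emeasure \<nu> F = of_nat k * of_nat (card F)"
          using em[OF compactin_sets_geodesic_borel[OF c]] F by (simp add: Int_absorb2)
        have "1 * of_nat (card F) \<le> (of_nat k * of_nat (card F) :: ennreal)"
          using k by (intro mult_right_mono) auto
        then have "of_nat (card F) \<le> emeasure \<nu> F" using e by simp
        moreover have "emeasure \<nu> F \<le> (SUP K\<in>?I. emeasure \<nu> K)" using FI by (rule SUP_upper)
        ultimately show ?thesis by (auto intro: order_trans)
      qed
      show "emeasure \<nu> B \<le> (SUP K\<in>?I. emeasure \<nu> K)"
      proof (cases "finite (B \<inter> \<O>)")
        case True
        have c: "compactin geodesic_topology (B \<inter> \<O>)"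
          using True \<O> by (intro finite_imp_compactin) (auto simp: topspace_geodesic_topology)
        have "emeasure \<nu> B = emeasure \<nu> (B \<inter> \<O>)"
          using em[OF B] em[OF compactin_sets_geodesic_borel[OF c]] by simp
        then show ?thesis using F[OF True] by simp
      next
        case False
        have "of_nat n \<le> (SUP K\<in>?I. emeasure \<nu> K)" for n
          using infinite_arbitrarily_large[OF False, of n] F by metis
        then have "(SUP n. of_nat n :: ennreal) \<le> (SUP K\<in>?I. emeasure \<nu> K)" by (rule SUP_least)
        then have "(SUP K\<in>?I. emeasure \<nu> K) = Orderings.top" unfolding ennreal_SUP_of_nat_eq_top by (simp only: top_unique)
        then show ?thesis by (simp only: top_greatest)
      qed
    qed
    show "emeasure \<nu> ((`) g ` B) = emeasure \<nu> B" if g: "g \<in> deck_group p" and B: "B \<in> sets geodesic_borel" for g B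
    proof -
      have BG: "B \<subseteq> geodesics" using sets.sets_into_space[OF B] by simp
      have inj: "inj_on ((`) g) geodesics" and im: "(`) g ` \<O> = \<O>" using inv[OF g] by auto
      have "(`) g ` B \<inter> \<O> = (`) g ` (B \<inter> \<O>)"
        using inj_on_image_Int[OF inj BG \<O>] im by simp
      moreover have "inj_on ((`) g) (B \<inter> \<O>)" using inj BG by (meson inf.coboundedI1 inj_on_subset)
      moreover have "(`) g ` (B \<inter> \<O>) \<subseteq> \<O>" using im by blast
      ultimately have "emeasure (count_space \<O>) ((`) g ` B \<inter> \<O>) = emeasure (count_space \<O>) (B \<inter> \<O>)"
        by (simp add: emeasure_count_space card_image finite_image_iff)
      then show ?thesis using em[OF B] em[OF deck_image_sets[OF g B]] by simp
    qed
  qed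
  show "(\<integral>G. \<phi> G \<partial>\<nu>) = real k * (\<Sum>G\<in>{G \<in> \<O>. \<phi> G \<noteq> 0}. \<phi> G)" if \<phi>: "\<phi> \<in> test_functions"
  proof -
    let ?F = "{G \<in> \<O>. \<phi> G \<noteq> 0}"
    obtain \<delta> where d: "\<delta> > 0" "\<And>G. G \<in> geodesics \<Longrightarrow> separation G < \<delta> \<Longrightarrow> \<phi> G = 0"
      using test_function_support[OF \<phi>] by blast
    have finF: "finite ?F" by (rule finite_subset[OF _ fin[OF d(1)]]) (use d(2) \<O> in \<open>force simp: not_less\<close>)
    have part: "enn2real (\<integral>\<^sup>+G. ennreal (h G) \<partial>\<nu>) = real k * (\<Sum>G\<in>?F. max 0 (h G))"
      if h: "h \<in> borel_measurable geodesic_borel" "\<And>G. \<phi> G = 0 \<Longrightarrow> h G = 0" for h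
    proof -
      have "(\<integral>\<^sup>+G. ennreal (h G) \<partial>\<nu>) = of_nat k * (\<integral>\<^sup>+G. ennreal (h G) \<partial>count_space \<O>)"
        using h(1) m unfolding \<nu>_def by (simp add: nn_integral_scale_measure nn_integral_distr)
      also have "(\<integral>\<^sup>+G. ennreal (h G) \<partial>count_space \<O>) = (\<Sum>G\<in>?F. ennreal (h G))"
        using finF h(2) by (intro nn_integral_count_space') auto
      also have "\<dots> = (\<Sum>G\<in>?F. ennreal (max 0 (h G)))"
        by (rule sum.cong[OF refl]) (simp add: max_def ennreal_neg)
      also have "\<dots> = ennreal (\<Sum>G\<in>?F. max 0 (h G))" by (rule sum_ennreal) simp
      finally have "enn2real (\<integral>\<^sup>+G. ennreal (h G) \<partial>\<nu>) = enn2real (of_nat k) * enn2real (ennreal (\<Sum>G\<in>?F. max 0 (h G)))"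
        by (simp add: enn2real_mult)
      then show ?thesis by (simp add: sum_nonneg enn2real_of_nat)
    qed
    have "\<phi> \<in> borel_measurable geodesic_borel" by (rule test_function_measurable[OF \<phi>])
    then have "(\<integral>G. \<phi> G \<partial>\<nu>) = real k * (\<Sum>G\<in>?F. max 0 (\<phi> G)) - real k * (\<Sum>G\<in>?F. max 0 (- \<phi> G))"
      using part[of \<phi>] part[of "\<lambda>G. - \<phi> G"] real_lebesgue_integral_def[OF integrable_test_function[OF cur \<phi>]] by simp
    also have "\<dots> = real k * (\<Sum>G\<in>?F. max 0 (\<phi> G) - max 0 (- \<phi> G))"
      by (simp add: sum_subtractf right_diff_distrib)
    also have "(\<Sum>G\<in>?F. max 0 (\<phi> G) - max 0 (- \<phi> G)) = (\<Sum>G\<in>?F. \<phi> G)"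
      by (rule sum.cong[OF refl]) (simp add: max_def)
    finally show ?thesis .
  qed
qed

text \<open>The link to \<open>current_positive\<close>: its sums over orbits are, up to a positive
  factor, integrals against curve currents. The orbit is locally finite by
  \<open>periodic_sum\<close>.\<close>

lemma hyperbolic_curve_current:
  assumes S: "compact S" and hyp: "hyperbolic_structure S p"
    and g: "g \<in> deck_auts p" and n: "norm x = 1" "norm y = 1" and fixed: "g x = x" "g y = y"
    and one: "1 < geo_pos x y g"
  obtains c and k :: nat where "closed_curve S c" "holonomy p c \<noteq> id" "curve_current p c \<in> currents p" "k \<ge> 1"
    "\<And>\<phi>. \<phi> \<in> test_functions \<Longrightarrow>
       (\<integral>G. \<phi> G \<partial>curve_current p c) = real k * (\<Sum>G\<in>{G \<in> {h ` {x, y} | h. h \<in> deck_auts p}. \<phi> G \<noteq> 0}. \<phi> G)"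
proof -
  interpret fuchsian_group "deck_auts p" by (rule fuchsian_deck_auts[OF S hyp])
  obtain c where c: "closed_curve S c" "holonomy p c \<noteq> id" "1 \<le> root_exponent p (holonomy p c)"
    "{f ` axis_ends (holonomy p c) | f. f \<in> deck_group p} = {h ` {x, y} | h. h \<in> deck_auts p}"
    using closed_curve_of_hyperbolic[OF S hyp g n fixed one] by blast
  define \<O> where "\<O> = {h ` {x, y} | h. h \<in> deck_auts p}"
  have "x \<noteq> y"
  proof
    assume "x = y"
    then have "geo_pos x y g = 1" using deriv_pos[OF g, of y] n by (simp add: geo_pos_def)
    then show False using one by simp
  qed
  have ne: "h x \<noteq> h y" if "h \<in> deck_auts p" for h using in_eq_iff[OF that] \<open>x \<noteq> y\<close> by simp
  have \<O>G: "\<O> \<subseteq> geodesics"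
    unfolding \<O>_def using ne n by (auto intro!: geodesicI)
  have finO: "finite {G \<in> \<O>. \<delta> \<le> separation G}" if "\<delta> > 0" for \<delta>
  proof -
    have "finite {h ` {x, y} | h. h \<in> deck_auts p \<and> \<delta> \<le> norm (h x - h y)}"
      by (rule periodic_sum[OF that g n fixed one]) blast
    moreover have "{G \<in> \<O>. \<delta> \<le> separation G} \<subseteq> {h ` {x, y} | h. h \<in> deck_auts p \<and> \<delta> \<le> norm (h x - h y)}"
    proof
      fix G assume G: "G \<in> {G \<in> \<O>. \<delta> \<le> separation G}"
      then obtain h where h: "h \<in> deck_auts p" "G = h ` {x, y}" unfolding \<O>_def by blast
      have "separation G = norm (h x - h y)" using separation_doubleton[OF ne[OF h(1)]] h(2) by simp
      then show "G \<in> {h ` {x, y} | h. h \<in> deck_auts p \<and> \<delta> \<le> norm (h x - h y)}" using G h by auto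
    qed
    ultimately show ?thesis by (rule rev_finite_subset)
  qed
  have inv: "(`) g ` \<O> = \<O> \<and> inj_on ((`) g) geodesics" if g: "g \<in> deck_group p" for g
  proof -
    have f: "ext g \<in> deck_auts p" using g deck_auts_eq by blast
    have e: "g ` G = ext g ` G" if "G \<in> geodesics" for G
      by (rule ext_image[symmetric]) (metis that geodesicE insertE order_refl singletonD)
    have "(`) g ` \<O> = (`) (ext g) ` \<O>" by (intro image_cong[OF refl] e) (rule subsetD[OF \<O>G])
    also have "\<dots> = \<O>"
    proof (intro equalityI subsetI)
      fix G assume "G \<in> (`) (ext g) ` \<O>"
      then obtain h where h: "h \<in> deck_auts p" "G = ext g ` (h ` {x, y})" unfolding \<O>_def by blast
      then have "G = (ext g \<circ> h) ` {x, y}" by (simp add: image_comp)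
      then show "G \<in> \<O>" unfolding \<O>_def using comp_in[OF f h(1)] by blast
    next
      fix G assume "G \<in> \<O>"
      then obtain h where h: "h \<in> deck_auts p" "G = h ` {x, y}" unfolding \<O>_def by blast
      have "ext g ` ((finv (ext g) \<circ> h) ` {x, y}) = G" using f h by simp
      moreover have "(finv (ext g) \<circ> h) ` {x, y} \<in> \<O>"
        unfolding \<O>_def using comp_in[OF finv_in[OF f] h(1)] by blast
      ultimately show "G \<in> (`) (ext g) ` \<O>" by blast
    qed
    moreover have "inj_on ((`) g) geodesics"
    proof (rule inj_onI)
      fix G H assume "G \<in> geodesics" "H \<in> geodesics" "g ` G = g ` H"
      then have "ext g ` G = ext g ` H" using e by simp
      then show "G = H" using bij_in[OF f] by (meson bij_is_inj inj_image_eq_iff)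
    qed
    ultimately show ?thesis by simp
  qed
  have cc: "curve_current p c = scale_measure (of_nat (root_exponent p (holonomy p c)))
      (distr (count_space \<O>) geodesic_borel (\<lambda>G. G))"
    unfolding curve_current_def Let_def c(4) \<O>_def ..
  show ?thesis
  proof (rule that[OF c(1,2) _ c(3)])
    show "curve_current p c \<in> currents p"
      unfolding cc by (rule orbit_current(1)[OF \<O>G finO inv c(3)])
    show "(\<integral>G. \<phi> G \<partial>curve_current p c) = real (root_exponent p (holonomy p c))
        * (\<Sum>G\<in>{G \<in> {h ` {x, y} | h. h \<in> deck_auts p}. \<phi> G \<noteq> 0}. \<phi> G)"
      if \<phi>: "\<phi> \<in> test_functions" for \<phi>
      unfolding cc \<O>_def[symmetric] by (rule orbit_current(2)[OF \<O>G finO inv c(3) \<phi>])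
  qed
qed

text \<open>The squared distance to \<open>\<mu>\<close> on finitely many test functions is almost minimised on the cone at
  some \<open>\<nu>\<close>; its gradient there is a test function that is almost nonnegative on closed curves, and
  hence on \<open>\<mu>\<close>, which forces the distance to be small.\<close>

lemma cone_of_curves_dense:
  assumes S: "compact S" and hyp: "hyperbolic_structure S p"
    and sub: "\<K> \<subseteq> currents p" and zero: "\<nu>0 \<in> \<K>"
    and cone: "\<And>\<mu> \<nu> \<rho> a b. \<mu> \<in> \<K> \<Longrightarrow> \<nu> \<in> \<K> \<Longrightarrow> \<rho> \<in> currents p \<Longrightarrow> 0 \<le> a \<Longrightarrow> 0 \<le> b \<Longrightarrow>
      (\<And>B. B \<in> sets geodesic_borel \<Longrightarrow> emeasure \<rho> B = ennreal a * emeasure \<mu> B + ennreal b * emeasure \<nu> B) \<Longrightarrow> \<rho> \<in> \<K>"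
    and curves: "\<And>c. closed_curve S c \<Longrightarrow> holonomy p c \<noteq> id \<Longrightarrow> curve_current p c \<in> currents p \<Longrightarrow> curve_current p c \<in> \<K>"
    and \<mu>: "\<mu> \<in> currents p" and F: "finite F" "F \<subseteq> test_functions" and "\<epsilon> > 0"
  obtains \<nu> where "\<nu> \<in> \<K>" "\<And>\<phi>. \<phi> \<in> F \<Longrightarrow> \<bar>(\<integral>G. \<phi> G \<partial>\<nu>) - (\<integral>G. \<phi> G \<partial>\<mu>)\<bar> < \<epsilon>"
proof -
  define I where "I \<nu> \<phi> = (\<integral>G. \<phi> G \<partial>\<nu>)" for \<nu> :: "complex set measure" and \<phi> :: "complex set \<Rightarrow> real"
  define Q where "Q \<nu> = (\<Sum>\<phi>\<in>F. (I \<nu> \<phi> - I \<mu> \<phi>)\<^sup>2)" for \<nu>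
  define N where "N \<nu> = (\<Sum>\<phi>\<in>F. (I \<nu> \<phi>)\<^sup>2)" for \<nu>
  define d where "d = Inf (Q ` \<K>)"
  have Q0: "Q \<nu> \<ge> 0" for \<nu> by (simp add: Q_def sum_nonneg)
  have N0: "N \<nu> \<ge> 0" for \<nu> by (simp add: N_def sum_nonneg)
  have bdd: "bdd_below (Q ` \<K>)" using Q0 by (intro bdd_belowI2[of _ 0])
  have d_le: "d \<le> Q \<nu>" if "\<nu> \<in> \<K>" for \<nu> unfolding d_def using bdd that by (intro cInf_lower) auto
  have comb: "\<exists>\<rho>\<in>\<K>. \<forall>\<phi>\<in>test_functions. I \<rho> \<phi> = a * I \<sigma> \<phi> + b * I \<tau> \<phi>"
    if st: "\<sigma> \<in> \<K>" "\<tau> \<in> \<K>" and ab: "0 \<le> a" "0 \<le> b" for \<sigma> \<tau> a b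
  proof -
    have c: "\<sigma> \<in> currents p" "\<tau> \<in> currents p" using st sub by auto
    obtain \<rho> where r: "\<rho> \<in> currents p"
      "\<And>B. B \<in> sets geodesic_borel \<Longrightarrow> emeasure \<rho> B = ennreal a * emeasure \<sigma> B + ennreal b * emeasure \<tau> B"
      "\<And>\<phi>. \<phi> \<in> test_functions \<Longrightarrow> (\<integral>G. \<phi> G \<partial>\<rho>) = a * (\<integral>G. \<phi> G \<partial>\<sigma>) + b * (\<integral>G. \<phi> G \<partial>\<tau>)"
      using current_combination[OF c ab] by blast
    have "\<rho> \<in> \<K>" by (rule cone[OF st r(1) ab r(2)])
    then show ?thesis using r(3) unfolding I_def by blast
  qed
  \<comment> \<open>A test function that dominates every member of \<open>F\<close>; its integral
    measures the size of a current and bounds the square root of \<open>N\<close>.\<close>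
  define \<omega> where "\<omega> G = (\<Sum>\<phi>\<in>F. \<bar>\<phi> G\<bar>)" for G
  have \<omega>: "\<omega> \<in> test_functions"
    unfolding \<omega>_def using F by (intro test_function_sum test_function_abs) auto
  have I_linear: "I \<nu> (\<lambda>G. \<Sum>\<phi>\<in>F. c \<phi> * \<phi> G) = (\<Sum>\<phi>\<in>F. c \<phi> * I \<nu> \<phi>)" if "\<nu> \<in> currents p" for \<nu> c
    unfolding I_def using integrable_test_function[OF that] F(2) by (subst Bochner_Integration.integral_sum) auto
  have I_\<omega>: "\<bar>I \<nu> \<phi>\<bar> \<le> I \<nu> (\<lambda>G. \<bar>\<phi> G\<bar>)" if "\<nu> \<in> currents p" for \<nu> \<phi>
    unfolding I_def using integral_abs_bound[of \<nu> \<phi>] .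
  have \<omega>_sum: "I \<nu> \<omega> = (\<Sum>\<phi>\<in>F. I \<nu> (\<lambda>G. \<bar>\<phi> G\<bar>))" if "\<nu> \<in> currents p" for \<nu>
    unfolding I_def \<omega>_def using integrable_test_function[OF that test_function_abs] F(2)
    by (subst Bochner_Integration.integral_sum) auto
  have \<omega>0: "I \<nu> \<omega> \<ge> 0" for \<nu> unfolding I_def \<omega>_def by (simp add: sum_nonneg)
  have N_\<omega>: "N \<nu> \<le> (I \<nu> \<omega>)\<^sup>2" if \<nu>: "\<nu> \<in> currents p" for \<nu>
  proof -
    have "(I \<nu> \<phi>)\<^sup>2 \<le> I \<nu> (\<lambda>G. \<bar>\<phi> G\<bar>) * I \<nu> \<omega>" if "\<phi> \<in> F" for \<phi>
    proof -
      have "I \<nu> (\<lambda>G. \<bar>\<phi> G\<bar>) \<le> I \<nu> \<omega>"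
        unfolding \<omega>_sum[OF \<nu>] using F(1) that by (intro member_le_sum) (auto simp: I_def)
      then have "\<bar>I \<nu> \<phi>\<bar> * \<bar>I \<nu> \<phi>\<bar> \<le> I \<nu> (\<lambda>G. \<bar>\<phi> G\<bar>) * I \<nu> \<omega>"
        using I_\<omega>[OF \<nu>, of \<phi>] \<omega>0[of \<nu>] by (intro mult_mono) auto
      then show ?thesis by (simp add: power2_eq_square)
    qed
    then have "N \<nu> \<le> (\<Sum>\<phi>\<in>F. I \<nu> (\<lambda>G. \<bar>\<phi> G\<bar>) * I \<nu> \<omega>)" unfolding N_def by (rule sum_mono)
    also have "\<dots> = (I \<nu> \<omega>)\<^sup>2"
      by (simp add: sum_distrib_right[symmetric] \<omega>_sum[OF \<nu>] power2_eq_square)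
    finally show ?thesis .
  qed
  \<comment> \<open>Makes the final estimate read \<open>Q \<nu> \<le> s * C0\<close>: the first
    term comes from the bound on \<open>N \<nu>\<close>, the second from the defect of the gradient
    on \<mu>.\<close>
  define C0 where "C0 = (1 + (2 * d + 2 + 2 * N \<mu>)) / 2 + I \<mu> \<omega>"
  have d0: "d \<ge> 0" unfolding d_def using zero Q0 by (intro cInf_greatest) auto
  have C0: "C0 > 0" unfolding C0_def using d0 N0[of \<mu>] \<omega>0[of \<mu>]
    by (intro add_pos_nonneg divide_pos_pos add_nonneg_nonneg mult_nonneg_nonneg) auto
  define s where "s = min 1 (\<epsilon>\<^sup>2 / (2 * C0))"
  have s: "0 < s" "s \<le> 1" "s * C0 < \<epsilon>\<^sup>2"
  proof -
    show "0 < s" using C0 \<open>\<epsilon> > 0\<close> by (simp add: s_def)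
    show "s \<le> 1" unfolding s_def by (rule min.cobounded1)
    have "s \<le> \<epsilon>\<^sup>2 / (2 * C0)" unfolding s_def by (rule min.cobounded2)
    then have "s * C0 \<le> \<epsilon>\<^sup>2 / 2" using C0 by (simp add: field_simps)
    moreover have "\<epsilon>\<^sup>2 > 0" using \<open>\<epsilon> > 0\<close> by simp
    ultimately show "s * C0 < \<epsilon>\<^sup>2" by linarith
  qed
  \<comment> \<open>The infimum need not be attained. Minimising up to \<open>s\<^sup>2\<close>
    costs only order \<open>s\<close> in the first order conditions.\<close>
  obtain \<nu> where \<nu>: "\<nu> \<in> \<K>" "Q \<nu> < d + s\<^sup>2"
  proof -
    have "Q ` \<K> \<noteq> {}" using zero by blast
    then have "\<exists>q\<in>Q ` \<K>. q < d + s\<^sup>2"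
      unfolding d_def using s(1) bdd by (subst cInf_less_iff[symmetric]) auto
    then show thesis using that by blast
  qed
  have \<nu>c: "\<nu> \<in> currents p" using \<nu>(1) sub by blast
  define \<psi> where "\<psi> G = (\<Sum>\<phi>\<in>F. (I \<nu> \<phi> - I \<mu> \<phi>) * \<phi> G)" for G
  have I\<psi>: "I \<sigma> \<psi> = (\<Sum>\<phi>\<in>F. (I \<nu> \<phi> - I \<mu> \<phi>) * I \<sigma> \<phi>)" if "\<sigma> \<in> currents p" for \<sigma>
    unfolding \<psi>_def by (rule I_linear[OF that])
  have \<psi>: "\<psi> \<in> test_functions"
    unfolding \<psi>_def using F by (intro test_function_sum test_function_scale) auto
  have expand: "(\<Sum>\<phi>\<in>F. (I \<nu> \<phi> - I \<mu> \<phi> + t * I \<sigma> \<phi>)\<^sup>2) = Q \<nu> + 2 * t * I \<sigma> \<psi> + t\<^sup>2 * N \<sigma>"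
    if "\<sigma> \<in> currents p" for \<sigma> t
    unfolding Q_def N_def I\<psi>[OF that] sum_distrib_left sum.distrib[symmetric]
    by (intro sum.cong) (auto simp: power2_eq_square algebra_simps)
  \<comment> \<open>Adding a multiple \<open>t\<close> of \<sigma> to \<nu> cannot lower
    \<open>Q\<close> by \<open>s\<^sup>2\<close> or more. For \<open>t = s / q\<close> the quadratic
    term is at most \<open>s\<^sup>2\<close>, which leaves a defect \<open>s * q\<close> in the
    linear one.\<close>
  have curve_ge: "- s * I \<sigma> \<omega> \<le> I \<sigma> \<psi>" if \<sigma>: "\<sigma> \<in> \<K>" for \<sigma>
  proof -
    have \<sigma>c: "\<sigma> \<in> currents p" using \<sigma> sub by blast
    have ineq: "- s\<^sup>2 < 2 * t * I \<sigma> \<psi> + t\<^sup>2 * N \<sigma>" if t: "t \<ge> 0" for t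
    proof -
      obtain \<rho> where r: "\<rho> \<in> \<K>" "\<forall>\<phi>\<in>test_functions. I \<rho> \<phi> = 1 * I \<nu> \<phi> + t * I \<sigma> \<phi>"
        using comb[OF \<nu>(1) \<sigma> zero_le_one t] by blast
      have "Q \<rho> = (\<Sum>\<phi>\<in>F. (I \<nu> \<phi> - I \<mu> \<phi> + t * I \<sigma> \<phi>)\<^sup>2)"
        unfolding Q_def using r(2) F(2) by (intro sum.cong) (auto simp: algebra_simps)
      then show ?thesis using d_le[OF r(1)] \<nu>(2) expand[OF \<sigma>c, of t] by linarith
    qed
    define q where "q = I \<sigma> \<omega>"
    have Nq: "N \<sigma> \<le> q\<^sup>2" unfolding q_def by (rule N_\<omega>[OF \<sigma>c])
    show ?thesis
    proof (cases "q = 0")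
      case True
      then have "N \<sigma> = 0" using Nq N0[of \<sigma>] by simp
      then have "I \<sigma> \<phi> = 0" if "\<phi> \<in> F" for \<phi>
        using that F(1) unfolding N_def by (simp add: sum_nonneg_eq_0_iff)
      then have "I \<sigma> \<psi> = 0" unfolding I\<psi>[OF \<sigma>c] by (simp add: sum.neutral)
      then show ?thesis using True by (simp add: q_def)
    next
      case False
      then have q: "q > 0" using \<omega>0[of \<sigma>] by (simp add: q_def)
      have "(s / q)\<^sup>2 * N \<sigma> \<le> (s / q)\<^sup>2 * q\<^sup>2" using Nq by (intro mult_left_mono) auto
      also have "\<dots> = s\<^sup>2" using q by (simp add: power_divide)
      finally have "- s\<^sup>2 < 2 * (s / q) * I \<sigma> \<psi> + s\<^sup>2" using ineq[of "s / q"] q s(1) by simp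
      then have "0 < 2 * (s / q) * (I \<sigma> \<psi> + s * q)"
        using q by (simp add: power2_eq_square field_simps)
      then have "0 < I \<sigma> \<psi> + s * q" using q s(1) by (simp add: zero_less_mult_iff zero_less_divide_iff)
      then show ?thesis by (simp add: q_def)
    qed
  qed
  \<comment> \<open>The added multiple of \<omega> absorbs the defect in \<open>curve_ge\<close>, so
    the integral is nonnegative on the whole cone.\<close>
  define \<psi>' where "\<psi>' G = \<psi> G + s * \<omega> G" for G
  have \<psi>': "\<psi>' \<in> test_functions"
    unfolding \<psi>'_def by (intro test_function_add test_function_scale \<psi> \<omega>)
  have I\<psi>': "I \<sigma> \<psi>' = I \<sigma> \<psi> + s * I \<sigma> \<omega>" if "\<sigma> \<in> currents p" for \<sigma>
    unfolding I_def \<psi>'_def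
    using integrable_test_function[OF that \<psi>] integrable_test_function[OF that \<omega>] by simp
  interpret fuchsian_group "deck_auts p" by (rule fuchsian_deck_auts[OF S hyp])
  have "0 \<le> (\<integral>G. \<psi>' G \<partial>\<mu>)"
  proof (rule current_positive[OF refl \<mu> \<psi>'])
    fix g x y assume g: "g \<in> deck_auts p" "norm x = 1" "norm y = 1" "g x = x" "g y = y" "1 < geo_pos x y g"
    obtain c and k :: nat where c: "closed_curve S c" "holonomy p c \<noteq> id" "curve_current p c \<in> currents p" "k \<ge> 1"
      "\<And>\<phi>. \<phi> \<in> test_functions \<Longrightarrow>
       (\<integral>G. \<phi> G \<partial>curve_current p c) = real k * (\<Sum>G\<in>{G \<in> {h ` {x, y} | h. h \<in> deck_auts p}. \<phi> G \<noteq> 0}. \<phi> G)"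
      using hyperbolic_curve_current[OF S hyp g] by blast
    have "0 \<le> I (curve_current p c) \<psi>'"
      using curve_ge[OF curves[OF c(1-3)]] I\<psi>'[OF c(3)] by simp
    then have "0 \<le> real k * (\<Sum>G\<in>{G \<in> {h ` {x, y} | h. h \<in> deck_auts p}. \<psi>' G \<noteq> 0}. \<psi>' G)"
      unfolding I_def c(5)[OF \<psi>'] .
    then show "0 \<le> (\<Sum>G\<in>{G \<in> {h ` {x, y} | h. h \<in> deck_auts p}. \<psi>' G \<noteq> 0}. \<psi>' G)"
      using c(4) by (simp add: zero_le_mult_iff)
  qed
  then have \<mu>\<psi>: "- s * I \<mu> \<omega> \<le> I \<mu> \<psi>" using I\<psi>'[OF \<mu>] by (simp add: I_def)
  \<comment> \<open>Scaling by \<open>1 - s\<close> stays in the cone, so \<nu> is almost critical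
    along its own ray, which bounds the gradient at \<nu> from above.\<close>
  have \<nu>\<psi>: "I \<nu> \<psi> \<le> s * (1 + N \<nu>) / 2"
  proof -
    obtain \<rho> where r: "\<rho> \<in> \<K>" "\<forall>\<phi>\<in>test_functions. I \<rho> \<phi> = (1 - s) * I \<nu> \<phi> + 0 * I \<nu> \<phi>"
      using comb[OF \<nu>(1) \<nu>(1), of "1 - s" 0] s(2) by auto
    have "Q \<rho> = (\<Sum>\<phi>\<in>F. (I \<nu> \<phi> - I \<mu> \<phi> + (- s) * I \<nu> \<phi>)\<^sup>2)"
      unfolding Q_def
    proof (rule sum.cong[OF refl])
      fix \<phi> assume "\<phi> \<in> F"
      then have e: "I \<rho> \<phi> = (1 - s) * I \<nu> \<phi> + 0 * I \<nu> \<phi>" using r(2) F(2) by blast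
      show "(I \<rho> \<phi> - I \<mu> \<phi>)\<^sup>2 = (I \<nu> \<phi> - I \<mu> \<phi> + - s * I \<nu> \<phi>)\<^sup>2"
        unfolding e by (simp add: algebra_simps)
    qed
    then have "- s\<^sup>2 < 2 * (- s) * I \<nu> \<psi> + s\<^sup>2 * N \<nu>"
      using d_le[OF r(1)] \<nu>(2) expand[OF \<nu>c, of "- s"] by simp
    then have "s * (2 * I \<nu> \<psi>) \<le> s * (s * (1 + N \<nu>))" by (simp add: power2_eq_square algebra_simps)
    then show ?thesis using s(1) by simp
  qed
  have "N \<nu> \<le> 2 * Q \<nu> + 2 * N \<mu>"
  proof -
    have "(I \<nu> \<phi>)\<^sup>2 \<le> 2 * (I \<nu> \<phi> - I \<mu> \<phi>)\<^sup>2 + 2 * (I \<mu> \<phi>)\<^sup>2" for \<phi>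
      using zero_le_power2[of "I \<nu> \<phi> - 2 * I \<mu> \<phi>"] by (simp add: power2_eq_square algebra_simps)
    then have "N \<nu> \<le> (\<Sum>\<phi>\<in>F. 2 * (I \<nu> \<phi> - I \<mu> \<phi>)\<^sup>2 + 2 * (I \<mu> \<phi>)\<^sup>2)"
      unfolding N_def by (intro sum_mono)
    then show ?thesis by (simp add: Q_def N_def sum.distrib sum_distrib_left)
  qed
  moreover have "s\<^sup>2 \<le> 1" using s by (simp add: power_le_one)
  ultimately have N\<nu>: "N \<nu> \<le> 2 * d + 2 + 2 * N \<mu>" using \<nu>(2) by linarith
  have "Q \<nu> = I \<nu> \<psi> - I \<mu> \<psi>"
    unfolding I\<psi>[OF \<nu>c] I\<psi>[OF \<mu>] Q_def sum_subtractf[symmetric]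
    by (intro sum.cong) (auto simp: power2_eq_square algebra_simps)
  also have "\<dots> \<le> s * (1 + (2 * d + 2 + 2 * N \<mu>)) / 2 + s * I \<mu> \<omega>"
  proof -
    have "s * (1 + N \<nu>) / 2 \<le> s * (1 + (2 * d + 2 + 2 * N \<mu>)) / 2"
      using N\<nu> s(1) by (intro divide_right_mono mult_left_mono) auto
    then show ?thesis using \<mu>\<psi> \<nu>\<psi> by simp
  qed
  also have "\<dots> = s * C0" by (simp add: C0_def algebra_simps)
  finally have small: "Q \<nu> < \<epsilon>\<^sup>2" using s(3) by simp
  have "\<bar>(\<integral>G. \<phi> G \<partial>\<nu>) - (\<integral>G. \<phi> G \<partial>\<mu>)\<bar> < \<epsilon>" if "\<phi> \<in> F" for \<phi>
  proof -
    have "(I \<nu> \<phi> - I \<mu> \<phi>)\<^sup>2 \<le> Q \<nu>"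
      unfolding Q_def using F(1) that by (intro member_le_sum) auto
    then have "\<bar>I \<nu> \<phi> - I \<mu> \<phi>\<bar>\<^sup>2 < \<epsilon>\<^sup>2" using small by simp
    then have "\<bar>I \<nu> \<phi> - I \<mu> \<phi>\<bar> < \<epsilon>" by (rule power_less_imp_less_base) (use \<open>\<epsilon> > 0\<close> in simp)
    then show ?thesis unfolding I_def .
  qed
  then show ?thesis using that \<nu>(1) by blast
qed

section \<open>From domination on curves to domination of lengths\<close>

theorem corollary8p11:
  fixes S :: "'a::topological_space set"
    and p :: "complex \<Rightarrow> 'a"
    and i :: "complex set measure \<Rightarrow> complex set measure \<Rightarrow> real"
    and \<mu>\<^sub>1 \<mu>\<^sub>2 :: "complex set measure"
  assumes "closed_surface S" and "connected S" and "orientable_surface S" and "genus S \<ge> 2"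
    and "hyperbolic_structure S p"
    and "intersection_form S p i"
    and "\<mu>\<^sub>1 \<in> currents p" and "\<mu>\<^sub>2 \<in> currents p"
    and "\<forall>c. closed_curve S c \<longrightarrow> curve_intersection p \<mu>\<^sub>1 c \<le> curve_intersection p \<mu>\<^sub>2 c"
  shows "\<forall>d L. length_pseudometric S d \<and>
               (\<forall>c. closed_curve S c \<longrightarrow> curve_length S d c < \<infinity>) \<and>
               current_length S p i d L
           \<longrightarrow> L \<mu>\<^sub>1 \<le> L \<mu>\<^sub>2"
proof (intro allI impI)
  fix d :: "'a \<Rightarrow> 'a \<Rightarrow> real" and L :: "complex set measure \<Rightarrow> real"
  assume "length_pseudometric S d \<and> (\<forall>c. closed_curve S c \<longrightarrow> curve_length S d c < \<infinity>) \<and> current_length S p i d L"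
  then obtain \<mu>d where \<mu>d: "\<mu>d \<in> currents p" "\<And>\<mu>. \<mu> \<in> currents p \<Longrightarrow> L \<mu> = i \<mu>d \<mu>"
    unfolding current_length_def dual_current_def by blast
  have S: "compact S" using assms(1) by (simp add: closed_surface_def)
  note cur = assms(7,8)
  have nonneg: "0 \<le> i \<mu> \<nu>" and sym: "i \<mu> \<nu> = i \<nu> \<mu>" if "\<mu> \<in> currents p" "\<nu> \<in> currents p" for \<mu> \<nu>
    using assms(6) that unfolding intersection_form_def by blast+
  have lin: "i \<rho> \<xi> = a * i \<mu> \<xi> + b * i \<nu> \<xi>"
    if "\<mu> \<in> currents p" "\<nu> \<in> currents p" "\<rho> \<in> currents p" "\<xi> \<in> currents p" "0 \<le> a" "0 \<le> b"
      "\<And>B. B \<in> sets geodesic_borel \<Longrightarrow> emeasure \<rho> B = ennreal a * emeasure \<mu> B + ennreal b * emeasure \<nu> B"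
    for \<mu> \<nu> \<rho> \<xi> a b
    using assms(6) that unfolding intersection_form_def by blast
  have cont: "continuous_map (prod_topology (weak_star_topology p) (weak_star_topology p)) euclideanreal (\<lambda>(\<mu>, \<nu>). i \<mu> \<nu>)"
    using assms(6) unfolding intersection_form_def by blast
  have curve: "ennreal (i \<mu> (curve_current p c)) = curve_intersection p \<mu> c"
    if "\<mu> \<in> currents p" "closed_curve S c" "holonomy p c \<noteq> id" for \<mu> c
    using assms(6) that unfolding intersection_form_def by blast
  define \<K> where "\<K> = {\<nu> \<in> currents p. i \<nu> \<mu>\<^sub>1 \<le> i \<nu> \<mu>\<^sub>2}"
  \<comment> \<open>The zero current, built with zero coefficients, shows that the cone is
    nonempty.\<close>
  obtain \<nu>0 where \<nu>0: "\<nu>0 \<in> currents p"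
    "\<And>B. B \<in> sets geodesic_borel \<Longrightarrow> emeasure \<nu>0 B = ennreal 0 * emeasure \<mu>\<^sub>1 B + ennreal 0 * emeasure \<mu>\<^sub>1 B"
  proof (rule current_combination[OF cur(1) cur(1) order_refl order_refl])
    fix \<rho> assume "\<rho> \<in> currents p"
      "\<And>B. B \<in> sets geodesic_borel \<Longrightarrow> emeasure \<rho> B = ennreal 0 * emeasure \<mu>\<^sub>1 B + ennreal 0 * emeasure \<mu>\<^sub>1 B"
    then show thesis by (rule that)
  qed
  have zero: "\<nu>0 \<in> \<K>"
    using lin[OF cur(1) cur(1) \<nu>0(1) _ order_refl order_refl \<nu>0(2)] cur \<nu>0(1) by (simp add: \<K>_def)
  have cone: "\<rho> \<in> \<K>"
    if K: "\<mu> \<in> \<K>" "\<nu> \<in> \<K>" and r: "\<rho> \<in> currents p" and ab: "0 \<le> a" "0 \<le> b"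
      and em: "\<And>B. B \<in> sets geodesic_borel \<Longrightarrow> emeasure \<rho> B = ennreal a * emeasure \<mu> B + ennreal b * emeasure \<nu> B"
    for \<mu> \<nu> \<rho> a b
  proof -
    have m: "\<mu> \<in> currents p" "\<nu> \<in> currents p" using K by (auto simp: \<K>_def)
    have "i \<rho> \<xi> = a * i \<mu> \<xi> + b * i \<nu> \<xi>" if "\<xi> \<in> currents p" for \<xi>
      by (rule lin[OF m r that ab em])
    then show ?thesis
      using K r ab cur by (auto simp: \<K>_def intro!: add_mono mult_left_mono)
  qed
  have curves: "curve_current p c \<in> \<K>"
    if c: "closed_curve S c" "holonomy p c \<noteq> id" "curve_current p c \<in> currents p" for c
  proof -
    have "ennreal (i \<mu>\<^sub>1 (curve_current p c)) \<le> ennreal (i \<mu>\<^sub>2 (curve_current p c))"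
      using assms(9) c curve[OF cur(1) c(1,2)] curve[OF cur(2) c(1,2)] by simp
    then have "i \<mu>\<^sub>1 (curve_current p c) \<le> i \<mu>\<^sub>2 (curve_current p c)"
      using nonneg[OF cur(2) c(3)] by simp
    then show ?thesis using c(3) sym[OF cur(1) c(3)] sym[OF cur(2) c(3)] by (simp add: \<K>_def)
  qed
  have cont1: "continuous_map (weak_star_topology p) euclideanreal (\<lambda>\<nu>. i \<nu> \<xi>)" if "\<xi> \<in> currents p" for \<xi>
  proof -
    have "continuous_map (weak_star_topology p) (prod_topology (weak_star_topology p) (weak_star_topology p)) (\<lambda>\<nu>. (\<nu>, \<xi>))"
      using that by (intro continuous_map_pairedI) (auto simp: topspace_weak_star_topology)
    from continuous_map_compose[OF this cont] show ?thesis by (simp add: o_def)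
  qed
  have "i \<mu>d \<mu>\<^sub>1 \<le> i \<mu>d \<mu>\<^sub>2"
  proof (rule ccontr)
    \<comment> \<open>By continuity in the first variable a reversed strict inequality at
      \<open>\<mu>d\<close> would hold on a weak* neighbourhood, which meets the cone by
      density.\<close>
    assume neg: "\<not> ?thesis"
    have "continuous_map (weak_star_topology p) euclideanreal (\<lambda>\<nu>. i \<nu> \<mu>\<^sub>2 - i \<nu> \<mu>\<^sub>1)"
      using cont1 cur by (intro continuous_map_diff) auto
    then have "openin (weak_star_topology p) {\<nu> \<in> topspace (weak_star_topology p). i \<nu> \<mu>\<^sub>2 - i \<nu> \<mu>\<^sub>1 \<in> {..<0}}"
      by (rule openin_continuous_map_preimage) simp
    moreover have "\<mu>d \<in> {\<nu> \<in> topspace (weak_star_topology p). i \<nu> \<mu>\<^sub>2 - i \<nu> \<mu>\<^sub>1 \<in> {..<0}}"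
      using neg \<mu>d(1) by (simp add: topspace_weak_star_topology)
    ultimately obtain F \<epsilon> where F: "finite F" "F \<subseteq> test_functions" "\<epsilon> > 0"
      "\<And>\<nu>. \<nu> \<in> currents p \<Longrightarrow> (\<And>\<phi>. \<phi> \<in> F \<Longrightarrow> \<bar>(\<integral>G. \<phi> G \<partial>\<nu>) - (\<integral>G. \<phi> G \<partial>\<mu>d)\<bar> < \<epsilon>) \<Longrightarrow>
         \<nu> \<in> {\<nu> \<in> topspace (weak_star_topology p). i \<nu> \<mu>\<^sub>2 - i \<nu> \<mu>\<^sub>1 \<in> {..<0}}"
      by (rule weak_star_neighbourhood) blast
    have sub: "\<K> \<subseteq> currents p" by (auto simp: \<K>_def)
    obtain \<nu> where "\<nu> \<in> \<K>" "\<And>\<phi>. \<phi> \<in> F \<Longrightarrow> \<bar>(\<integral>G. \<phi> G \<partial>\<nu>) - (\<integral>G. \<phi> G \<partial>\<mu>d)\<bar> < \<epsilon>"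
    proof (rule cone_of_curves_dense[OF S assms(5) sub zero _ curves \<mu>d(1) F(1-3)])
      fix \<mu> \<nu> \<rho> a b
      assume K: "\<mu> \<in> \<K>" "\<nu> \<in> \<K>" "\<rho> \<in> currents p" "0 \<le> a" "0 \<le> b"
        "\<And>B. B \<in> sets geodesic_borel \<Longrightarrow> emeasure \<rho> B = ennreal a * emeasure \<mu> B + ennreal b * emeasure \<nu> B"
      show "\<rho> \<in> \<K>" by (rule cone[OF K])
    next
      fix \<nu> assume "\<nu> \<in> \<K>" "\<And>\<phi>. \<phi> \<in> F \<Longrightarrow> \<bar>(\<integral>G. \<phi> G \<partial>\<nu>) - (\<integral>G. \<phi> G \<partial>\<mu>d)\<bar> < \<epsilon>"
      then show thesis by (rule that)
    qed
    then have "i \<nu> \<mu>\<^sub>2 - i \<nu> \<mu>\<^sub>1 < 0" "i \<nu> \<mu>\<^sub>1 \<le> i \<nu> \<mu>\<^sub>2" using F(4)[of \<nu>] by (auto simp: \<K>_def)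
    then show False by simp
  qed
  then show "L \<mu>\<^sub>1 \<le> L \<mu>\<^sub>2" using \<mu>d(2) cur by simp
qed

end
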